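(* Let $\ell\ge2$ be even, let $K\ge\ell/2$ be an integer, and let $\mathsf R_{\mathrm{lex}}$ be the lexicographic $(K,\ell)$-rule. Let $$c_1:=\lim_{z\to0^+}\left(\log z+\ell\int_1^z\frac{dx}{-2+(1-x^2)^{\ell/2}+(1-x)^\ell}\right),\qquad d_1:=e^{c_1}.$$ Then for every $c\in\mathbb R$, $$\lim_{n\to\infty}\Pr\left[T_{\mathrm{con}}^{\mathrm{lex}}\le\frac{n\log n+cn}{\ell}\right]=\lim_{n\to\infty}\Pr\left[Y_1^{\mathrm{lex}}\left(\left\lfloor\frac{n\log n+cn}{\ell}\right\rfloor\right)=0\right]=e^{-d_1e^{-c}},$$ and for every $\ell$-Achlioptas process $\mathsf A$ and every $c\in\mathbb R$, $$\limsup_{n\to\infty}\Pr\left[T_{\mathrm{con}}^{\mathsf A}\le\frac{n\log n+cn}{\ell}\right]\le\limsup_{n\to\infty}\Pr\left[Y_1^{\mathsf A}\left(\left\lfloor\frac{n\log n+cn}{\ell}\right\rfloor\right)=0\right]\le\lim_{n\to\infty}\Pr\left[Y_1^{\mathrm{lex}}\left(\left\lfloor\frac{n\log n+cn}{\ell}\right\rfloor\right)=0\right].$$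
   Context: $\log$ is the natural logarithm. An $\ell$-Achlioptas process $\mathsf A$ (with $\ell$ even) builds a random graph sequence $(G_N^{\mathsf A})_{N\ge0}$ on vertex set $[n]=\{1,\dots,n\}$, for each $n$: $G_0^{\mathsf A}$ has no edges; in each round $\ell$ vertices $v_1,\dots,v_\ell$ are drawn independently and uniformly at random from $[n]$ (repetitions allowed), and by an arbitrary strategy exactly one of the edges $\{v_1,v_2\},\{v_3,v_4\},\dots,\{v_{\ell-1},v_\ell\}$ is chosen and added to the current graph (loops and multiple edges are ignored). $Y_1^{\mathsf A}(N)$ is the number of isolated vertices of $G_N^{\mathsf A}$, and $T_{\mathrm{con}}^{\mathsf A}$ is the smallest $N$ such that $G_N^{\mathsf A}$ is connected ($\infty$ if there is none). Let $S_K=\{1,\dots,K,\omega\}$, where $\omega$ is a formal symbol standing for "larger than $K$", ordered so that $1<2<\dots<K<\omega$. The rule $\mathsf R_{\mathrm{lex}}:S_K^\ell\to\{1,\dots,\ell/2\}$ is defined as follows. Given $(s_1,\dots,s_\ell)$, let $s'_{2i-1}=\min\{s_{2i-1},s_{2i}\}$ and $s'_{2i}=\max\{s_{2i-1},s_{2i}\}$ for $1\le i\le\ell/2$. Then $\mathsf R_{\mathrm{lex}}(s_1,\dots,s_\ell)$ is the smallest $i\in\{1,\dots,\ell/2\}$ for which the pair $(s'_{2i-1},s'_{2i})$ is minimal in the lexicographic order. The associated process, denoted by the superscript $\mathrm{lex}$, is the $\ell$-Achlioptas process in which, in each round, the edge $\{v_{2i-1},v_{2i}\}$ is added, where $i=\mathsf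 R_{\mathrm{lex}}(s_1,\dots,s_\ell)$ and $s_j$ is the number of vertices of the component containing $v_j$ in the current graph if this is at most $K$, and $s_j=\omega$ otherwise; $Y_1^{\mathrm{lex}}(N)$ and $T_{\mathrm{con}}^{\mathrm{lex}}$ denote its number of isolated vertices after $N$ rounds and its connectivity time. *)

theory Defs
  imports "HOL-Probability.Probability"
begin

section \<open>Simple graphs on the vertex set \<open>{1..n}\<close>, given by their sets of edges\<close>

definition adj :: "nat set set \<Rightarrow> (nat \<times> nat) set" where
  "adj E = {(v, w). {v, w} \<in> E}"

definition graph_connected :: "nat \<Rightarrow> nat set set \<Rightarrow> bool" where
  "graph_connected n E \<longleftrightarrow> (\<forall>v\<in>{1..n}. \<forall>w\<in>{1..n}. (v, w) \<in> (adj E)\<^sup>*)"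

definition component :: "nat set set \<Rightarrow> nat \<Rightarrow> nat set" where
  "component E v = {w. (v, w) \<in> (adj E)\<^sup>*}"

definition isolated_vertices :: "nat \<Rightarrow> nat set set \<Rightarrow> nat set" where
  "isolated_vertices n E = {v \<in> {1..n}. \<not> (\<exists>w. {v, w} \<in> E)}"

section \<open>Achlioptas processes\<close>

text \<open>Tuples are lists, so their entries are numbered from 0; candidate edge \<open>i < l div 2\<close>
  of a tuple joins its entries \<open>2 * i\<close> and \<open>2 * i + 1\<close>.\<close>

definition vertex_tuples :: "nat \<Rightarrow> nat \<Rightarrow> nat list set" where
  "vertex_tuples l n = {vs. length vs = l \<and> set vs \<subseteq> {1..n}}"

text \<open>\<open>V N\<close> is the tuple drawn in round \<open>N + 1\<close> and \<open>C N\<close> the number of the edge chosen in that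
  round.\<close>

definition graph_after ::
    "(nat \<Rightarrow> 'a \<Rightarrow> nat list) \<Rightarrow> (nat \<Rightarrow> 'a \<Rightarrow> nat) \<Rightarrow> nat \<Rightarrow> 'a \<Rightarrow> nat set set" where
  "graph_after V C N \<omega> =
     {{v, w} | v w k. k < N \<and> v = V k \<omega> ! (2 * C k \<omega>) \<and> w = V k \<omega> ! (2 * C k \<omega> + 1) \<and> v \<noteq> w}"

definition history ::
    "(nat \<Rightarrow> 'a \<Rightarrow> nat list) \<Rightarrow> (nat \<Rightarrow> 'a \<Rightarrow> nat) \<Rightarrow> nat \<Rightarrow> 'a \<Rightarrow> (nat list \<times> nat) list" where
  "history V C N \<omega> = map (\<lambda>k. (V k \<omega>, C k \<omega>)) [0..<N]"

text \<open>An arbitrary strategy, possibly randomised, may use everything except the future draws: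
  each tuple is uniform and independent of all earlier tuples and choices, while the choice
  made in a round may depend in any way on the past, the current tuple and extra randomness.\<close>

definition achlioptas_process ::
    "nat \<Rightarrow> nat \<Rightarrow> 'a measure \<Rightarrow> (nat \<Rightarrow> 'a \<Rightarrow> nat list) \<Rightarrow> (nat \<Rightarrow> 'a \<Rightarrow> nat) \<Rightarrow> bool" where
  "achlioptas_process l n M V C \<longleftrightarrow>
     prob_space M \<and>
     (\<forall>N. V N \<in> M \<rightarrow>\<^sub>M count_space (vertex_tuples l n) \<and>
          C N \<in> M \<rightarrow>\<^sub>M count_space {..<l div 2} \<and>
          distr M (count_space (vertex_tuples l n)) (V N)
            = uniform_count_measure (vertex_tuples l n) \<and>
          prob_space.indep_set M
            ((\<lambda>A. V N -` A \<inter> space M) ` Pow (vertex_tuples l n))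
            (range (\<lambda>B. history V C N -` B \<inter> space M)))"

definition Y1 ::
    "nat \<Rightarrow> (nat \<Rightarrow> 'a \<Rightarrow> nat list) \<Rightarrow> (nat \<Rightarrow> 'a \<Rightarrow> nat) \<Rightarrow> nat \<Rightarrow> 'a \<Rightarrow> nat" where
  "Y1 n V C N \<omega> = card (isolated_vertices n (graph_after V C N \<omega>))"

text \<open>The infimum of the empty set is \<open>\<infinity>\<close> in \<^typ>\<open>enat\<close>.\<close>

definition Tcon ::
    "nat \<Rightarrow> (nat \<Rightarrow> 'a \<Rightarrow> nat list) \<Rightarrow> (nat \<Rightarrow> 'a \<Rightarrow> nat) \<Rightarrow> 'a \<Rightarrow> enat" where
  "Tcon n V C \<omega> = Inf {enat N | N. graph_connected n (graph_after V C N \<omega>)}"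

section \<open>The lexicographic rule\<close>

text \<open>The set \<open>S\<^sub>K = {1, \<dots>, K, \<omega>}\<close> is represented in \<^typ>\<open>enat\<close>, with \<open>\<infinity>\<close> in the role of the
  symbol for ``larger than \<open>K\<close>''.\<close>

definition truncated_size :: "nat \<Rightarrow> nat set set \<Rightarrow> nat \<Rightarrow> enat" where
  "truncated_size K E v =
     (if card (component E v) \<le> K then enat (card (component E v)) else \<infinity>)"

definition sorted_pair :: "enat list \<Rightarrow> nat \<Rightarrow> enat \<times> enat" where
  "sorted_pair s i =
     (min (s ! (2 * i)) (s ! (2 * i + 1)), max (s ! (2 * i)) (s ! (2 * i + 1)))"

definition lex_le :: "enat \<times> enat \<Rightarrow> enat \<times> enat \<Rightarrow> bool" where
  "lex_le p q \<longleftrightarrow> fst p < fst q \<or> (fst p = fst q \<and> snd p \<le> snd q)"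

definition lex_rule :: "enat list \<Rightarrow> nat" where
  "lex_rule s =
     (LEAST i. i < length s div 2 \<and>
        (\<forall>j < length s div 2. lex_le (sorted_pair s i) (sorted_pair s j)))"

definition lex_process ::
    "nat \<Rightarrow> nat \<Rightarrow> nat \<Rightarrow> 'a measure \<Rightarrow> (nat \<Rightarrow> 'a \<Rightarrow> nat list) \<Rightarrow> (nat \<Rightarrow> 'a \<Rightarrow> nat) \<Rightarrow> bool" where
  "lex_process K l n M V C \<longleftrightarrow>
     achlioptas_process l n M V C \<and>
     (\<forall>N. \<forall>\<omega>\<in>space M.
        C N \<omega> = lex_rule (map (truncated_size K (graph_after V C N \<omega>)) (V N \<omega>)))"

section \<open>The constants and the time scale\<close>

definition c1_fun :: "nat \<Rightarrow> real \<Rightarrow> real" where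
  "c1_fun l z = ln z + real l *
     (LBINT x=ereal 1..ereal z. 1 / (-2 + (1 - x\<^sup>2) ^ (l div 2) + (1 - x) ^ l))"

definition c1 :: "nat \<Rightarrow> real" where
  "c1 l = Lim (at_right 0) (c1_fun l)"

definition d1 :: "nat \<Rightarrow> real" where
  "d1 l = exp (c1 l)"

definition time_bound :: "nat \<Rightarrow> real \<Rightarrow> nat \<Rightarrow> real" where
  "time_bound l c n = (real n * ln (real n) + c * real n) / real l"

end

theory Submission
  imports Defs "HOL-Real_Asymp.Real_Asymp"
begin

text \<open>\<^bold>\<open>Isolated vertices.\<close> If a fraction \<open>x\<close> of the vertices is isolated, then a random tuple allows a
strategy to remove at most \<open>max_drop\<close> of them: two if some candidate edge joins two isolated
vertices, one if some isolated vertex occurs, otherwise none. The mean of this number is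
\<open>rate l x\<close>. The lexicographic rule attains the maximum unless it picks a loop, so it is
essentially optimal, and in the limit the fraction follows \<open>x' = - rate l x\<close>. Let \<open>potential\<close> be the
solution \<open>\<psi>\<close> of \<open>rate * \<psi>' = l * \<psi>\<close> with \<open>\<psi> x \<sim> x\<close> at 0. It linearises the equation: along its
solutions \<open>\<psi>\<close> decays exactly like \<open>exp (- l * t)\<close>. Moreover \<open>\<psi> 1 = d1 l\<close>, which is where the
integral in the definition of \<open>c1\<close> comes from.

So \<open>n * \<psi> (Y / n)\<close> acts as a number of vertices each of which is still isolated one round later
with probability \<open>exp (- l / n)\<close>, independently of the others. For independent vertices the
generating function \<open>(1 - \<theta>) ^ Y\<close> is preserved in the mean when \<open>\<theta>\<close> grows by the factor
\<open>exp (l / n)\<close> in each round. Accordingly the quantity \<open>survival\<close>, which is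
\<open>(1 - \<theta>) powr (n * \<psi> (Y / n))\<close>, has almost constant mean for the lexicographic process, and for
every other process its mean can only decrease, up to the same error. The crucial point is that
this error is \<open>O(1 / n\<^sup>2)\<close> per round, uniformly in the state: with \<open>s = - ln (1 - \<theta>)\<close> it is a multiple
of \<open>(s * x)\<^sup>2 + s * x / n\<close> times \<open>survival\<close>, and \<open>survival\<close> is at most \<open>exp (- b * s * n * x)\<close>. Over
\<open>O(n * log n)\<close> rounds the errors add up to \<open>o(1)\<close>, and no concentration argument is needed
(\<open>survival_average\<close>, \<open>expectation_survival\<close>). Choose \<open>\<theta>\<close> so that it ends just below \<open>1 - \<delta>\<close>. Then it
starts at \<open>(1 - \<delta>) * exp (- c) / n\<close>, so the initial value converges to
\<open>exp (- (1 - \<delta>) * exp (- c) * d1)\<close>, and the final value differs from the indicator of \<open>Y = 0\<close> by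
a quantity between 0 and about \<open>\<delta> powr b\<close>. Letting \<open>\<delta>\<close> tend to 0 gives both the limit law and the
upper bound for all processes (\<open>isolated_limsup\<close>, \<open>isolated_lex_liminf\<close>).

\<^bold>\<open>Connectivity.\<close> Whatever the strategy, after \<open>n * sqrt (ln n)\<close> rounds there are at most \<open>\<delta> * n\<close>
components with high probability, because while there are more, all candidate edges join
different components with probability bounded below (\<open>prob_many_components\<close>). From then on almost
all vertices lie in components of more than \<open>K\<close> vertices. Let \<open>B\<close> count the components with at least
two vertices. One with at most \<open>K\<close> vertices is absorbed as soon as one of its at least two vertices
appears anywhere in a tuple of otherwise large components, so at a rate of at least about \<open>2 * l / n\<close>. A larger
one can rely only on the first candidate edge, but it has at least \<open>K + 1\<close> vertices, so its
rate is at least about \<open>2 * (K + 1) / n \<ge> (l + 2) / n\<close>; this is the reason for \<open>K \<ge> l / 2\<close>. New components of this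
kind arise only from two isolated vertices, at a rate proportional to \<open>(Y / n)\<^sup>2\<close>. Altogether
\<open>B - 1 + 2 * l * Y * (Y - 1) / n\<close> decays at a rate of almost \<open>(l + 1) / n\<close>
(\<open>merge_potential_drift\<close>). During \<open>n * log n / l\<close> rounds it drops from \<open>O(n)\<close> to \<open>o(1)\<close>, so that at
the end \<open>B \<le> 1\<close>, and the only remaining obstacles to connectivity are isolated vertices.\<close>

section \<open>The limiting differential equation\<close>

text \<open>The drift of the number of isolated vertices under the lexicographic rule, see \<open>jump_prob_mean\<close> and
\<open>card_max_drop\<close>; the negative of the denominator in \<open>c1_fun\<close>.\<close>

definition rate :: "nat \<Rightarrow> real \<Rightarrow> real" where
  "rate l x = 2 - (1 - x\<^sup>2) ^ (l div 2) - (1 - x) ^ l"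

text \<open>The factorisation \<open>rate = x * rate_quot\<close> with \<open>rate_quot = l - x * rate_defect\<close> takes the pole out of
the integrand: \<open>l / rate - 1 / x\<close> is the quotient \<open>rate_defect / rate_quot\<close>, which is smooth on the
unit interval, including 0.\<close>

definition rate_quot :: "nat \<Rightarrow> real \<Rightarrow> real" where
  "rate_quot l x = x * (\<Sum>k<l div 2. (1 - x\<^sup>2) ^ k) + (\<Sum>k<l. (1 - x) ^ k)"

definition rate_defect :: "nat \<Rightarrow> real \<Rightarrow> real" where
  "rate_defect l x = (\<Sum>k<l. \<Sum>j<k. (1 - x) ^ j) - (\<Sum>k<l div 2. (1 - x\<^sup>2) ^ k)"

lemma one_minus_power: "1 - (1 - x) ^ k = x * (\<Sum>j<k. (1 - x) ^ j)" for x :: real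
  using one_diff_power_eq[of "1 - x" k] by simp

lemma rate_eq: "rate l x = x * rate_quot l x"
  using one_minus_power[of "x\<^sup>2" "l div 2"] one_minus_power[of x l]
  by (simp add: rate_def rate_quot_def algebra_simps power2_eq_square)

lemma rate_quot_eq: "rate_quot l x = real l - x * rate_defect l x"
proof -
  have "real l - (\<Sum>k<l. (1 - x) ^ k) = (\<Sum>k<l. 1 - (1 - x) ^ k)"
    by (simp add: sum_subtractf)
  also have "\<dots> = x * (\<Sum>k<l. \<Sum>j<k. (1 - x) ^ j)"
    by (simp add: one_minus_power sum_distrib_left)
  finally show ?thesis
    by (simp add: rate_quot_def rate_defect_def algebra_simps)
qed

lemma rate_quot_ge_1:
  assumes "l \<ge> 1" "x \<in> {0..1}"
  shows "rate_quot l x \<ge> 1"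
proof -
  have x2: "x\<^sup>2 \<le> 1" using assms by (simp add: power_le_one)
  have "(1 - x) ^ 0 \<le> (\<Sum>k<l. (1 - x) ^ k)"
    using assms by (intro member_le_sum) auto
  moreover have "0 \<le> x * (\<Sum>k<l div 2. (1 - x\<^sup>2) ^ k)"
    using assms x2 by (intro mult_nonneg_nonneg sum_nonneg) auto
  ultimately show ?thesis by (simp add: rate_quot_def)
qed

text \<open>\<open>potential l\<close> is the solution \<open>\<psi>\<close> of \<open>rate * \<psi>' = l * \<psi>\<close> normalised by \<open>\<psi>' 0 = 1\<close>.\<close>

definition log_excess :: "nat \<Rightarrow> real \<Rightarrow> real" where
  "log_excess l y = integral {0..y} (\<lambda>x. rate_defect l x / rate_quot l x)"

definition potential :: "nat \<Rightarrow> real \<Rightarrow> real" where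
  "potential l y = y * exp (log_excess l y)"

definition potential' :: "nat \<Rightarrow> real \<Rightarrow> real" where
  "potential' l y = real l * exp (log_excess l y) / rate_quot l y"

lemma continuous_on_excess:
  assumes "l \<ge> 1"
  shows "continuous_on {0..1} (\<lambda>x. rate_defect l x / rate_quot l x)"
proof (rule continuous_on_divide)
  show "continuous_on {0..1} (rate_defect l)" "continuous_on {0..1} (rate_quot l)"
    unfolding rate_defect_def rate_quot_def by (intro continuous_intros)+
  show "\<forall>x\<in>{0..1}. rate_quot l x \<noteq> 0" using rate_quot_ge_1[OF assms] by force
qed

lemma log_excess_deriv:
  assumes "l \<ge> 1" "y \<in> {0..1}"
  shows "(log_excess l has_real_derivative rate_defect l y / rate_quot l y) (at y within {0..1})"
  unfolding log_excess_def
  using integral_has_real_derivative[OF continuous_on_excess[OF assms(1)] assms(2)] .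

lemma log_excess_0 [simp]: "log_excess l 0 = 0"
  by (simp add: log_excess_def)

lemma potential_0 [simp]: "potential l 0 = 0"
  by (simp add: potential_def)

lemma rate_times_potential':
  assumes "l \<ge> 1" "x \<in> {0..1}"
  shows "rate l x * potential' l x = real l * potential l x"
  using rate_quot_ge_1[OF assms] by (simp add: rate_eq potential_def potential'_def)

lemma potential_deriv:
  assumes "l \<ge> 1" "y \<in> {0..1}"
  shows "(potential l has_real_derivative potential' l y) (at y within {0..1})"
proof -
  have nz: "rate_quot l y \<noteq> 0" using rate_quot_ge_1[OF assms] by simp
  have e: "1 + y * (rate_defect l y / rate_quot l y) = real l / rate_quot l y"
    using nz rate_quot_eq[of l y] by (simp add: field_simps)
  have "(potential l has_real_derivative
      1 * exp (log_excess l y) + exp (log_excess l y) * (rate_defect l y / rate_quot l y) * y)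
      (at y within {0..1})"
    unfolding potential_def[abs_def]
    by (intro DERIV_mult DERIV_fun_exp log_excess_deriv assms derivative_intros DERIV_ident)
  moreover have "1 * exp (log_excess l y) + exp (log_excess l y) * (rate_defect l y / rate_quot l y) * y
      = exp (log_excess l y) * (1 + y * (rate_defect l y / rate_quot l y))"
    by (simp add: algebra_simps)
  ultimately show ?thesis unfolding e by (simp add: potential'_def mult.commute)
qed

lemma potential'_nonneg: "l \<ge> 1 \<Longrightarrow> x \<in> {0..1} \<Longrightarrow> potential' l x \<ge> 0"
  using rate_quot_ge_1[of l x] by (simp add: potential'_def)

lemma potential'_0: "l \<ge> 1 \<Longrightarrow> potential' l 0 = 1"
  using rate_quot_eq[of l 0] by (simp add: potential'_def)

text \<open>The quotient rule gives a continuous second derivative of \<open>potential\<close> on the compact unit interval.\<close>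

lemma potential'_lipschitz:
  assumes "l \<ge> 1"
  obtains B where "B > 0" "\<And>x y. x \<in> {0..1} \<Longrightarrow> y \<in> {0..1} \<Longrightarrow>
    \<bar>potential' l x - potential' l y\<bar> \<le> B * \<bar>x - y\<bar>"
proof -
  define p where "p = rate_quot l"
  define q where "q = rate_defect l"
  define p' where "p' x = (\<Sum>k<l div 2. (1 - x\<^sup>2) ^ k)
     + (\<Sum>k<l div 2. real k * ((1 - x\<^sup>2) ^ (k - Suc 0) * (- (2 * x)))) * x
     + (\<Sum>k<l. real k * ((1 - x) ^ (k - Suc 0) * (- 1)))" for x :: real
  have p1: "p x \<ge> 1" if "x \<in> {0..1}" for x
    using rate_quot_ge_1[OF assms that] by (simp add: p_def)
  have dp: "(p has_real_derivative p' x) (at x within {0..1})" for x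
    unfolding p_def rate_quot_def[abs_def] p'_def
    by (rule derivative_eq_intros refl | simp add: mult_ac)+
  define d where "d x = real l * (exp (log_excess l x) * (q x / p x) * p x
      - exp (log_excess l x) * p' x) / (p x * p x)" for x
  have D: "(potential' l has_real_derivative d x) (at x within {0..1})" if x: "x \<in> {0..1}" for x
  proof -
    have le: "(log_excess l has_real_derivative q x / p x) (at x within {0..1})"
      using log_excess_deriv[OF assms x] by (simp add: p_def q_def)
    have "((\<lambda>x. exp (log_excess l x) / p x) has_real_derivative
        ((exp (log_excess l x) * (q x / p x)) * p x - exp (log_excess l x) * p' x) / (p x * p x))
        (at x within {0..1})"
      using p1[OF x] by (intro DERIV_divide dp) (auto intro!: derivative_eq_intros le)
    from DERIV_cmult[OF this, of "real l"] show ?thesis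
      by (simp add: potential'_def[abs_def] p_def d_def)
  qed
  have cl: "continuous_on {0..1} (log_excess l)"
    using log_excess_deriv[OF assms] by (intro DERIV_continuous_on) 
  have "continuous_on {0..1} d"
    unfolding d_def
    by (intro continuous_intros cl)
      (use p1 in \<open>force simp: p_def q_def p'_def[abs_def] rate_quot_def[abs_def] rate_defect_def[abs_def]
         intro!: continuous_intros\<close>)+
  then have "compact (d ` {0..1})" by (intro compact_continuous_image) auto
  then obtain B where B: "B > 0" "\<And>x. x \<in> {0..1} \<Longrightarrow> \<bar>d x\<bar> \<le> B"
    using compact_imp_bounded bounded_pos by (metis image_eqI real_norm_def)
  have "norm (potential' l x - potential' l y) \<le> B * norm (x - y)"
    if "x \<in> {0..1}" "y \<in> {0..1}" for x y
    using D B(2) that by (intro field_differentiable_bound[of "{0..1}"]) auto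
  then show thesis using B(1) that by simp
qed

lemma potential_taylor:
  assumes "l \<ge> 1"
  obtains B where "B > 0" "\<And>x y. x \<in> {0..1} \<Longrightarrow> y \<in> {0..1} \<Longrightarrow>
    \<bar>potential l y - potential l x - potential' l x * (y - x)\<bar> \<le> B * (y - x)\<^sup>2"
proof -
  obtain B where B: "B > 0" "\<And>x y. x \<in> {0..1} \<Longrightarrow> y \<in> {0..1} \<Longrightarrow>
    \<bar>potential' l x - potential' l y\<bar> \<le> B * \<bar>x - y\<bar>" using potential'_lipschitz[OF assms] by metis
  have "\<bar>potential l y - potential l x - potential' l x * (y - x)\<bar> \<le> B * (y - x)\<^sup>2"
    if xy: "x \<in> {0..1}" "y \<in> {0..1}" for x y
  proof -
    let ?S = "closed_segment x y"
    have sub: "?S \<subseteq> {0..1}" using xy by (simp add: closed_segment_subset)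
    have "norm ((potential l y - potential' l x * y) - (potential l x - potential' l x * x))
        \<le> (B * \<bar>y - x\<bar>) * norm (y - x)"
    proof (rule field_differentiable_bound[of ?S _ "\<lambda>z. potential' l z - potential' l x"])
      fix z assume z: "z \<in> ?S"
      then have z1: "z \<in> {0..1}" using sub by auto
      show "((\<lambda>z. potential l z - potential' l x * z) has_real_derivative
          potential' l z - potential' l x) (at z within ?S)"
        using DERIV_subset[OF potential_deriv[OF assms z1] sub]
        by (auto intro!: derivative_eq_intros)
      have "\<bar>z - x\<bar> \<le> \<bar>y - x\<bar>" using z by (auto simp: closed_segment_eq_real_ivl split: if_splits)
      then show "norm (potential' l z - potential' l x) \<le> B * \<bar>y - x\<bar>"
        using B(2)[OF z1 xy(1)] B(1) by (smt (verit) mult_left_mono real_norm_def)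
    qed auto
    then show ?thesis by (simp add: algebra_simps power2_eq_square)
  qed
  with B(1) that show thesis by blast
qed

lemma potential_lower:
  assumes "l \<ge> 1"
  obtains b where "b > 0" "\<And>y. y \<in> {0..1} \<Longrightarrow> potential l y \<ge> b * y"
proof -
  have "continuous_on {0..1} (log_excess l)"
    using log_excess_deriv[OF assms] by (intro DERIV_continuous_on) 
  then have "compact (log_excess l ` {0..1})" by (intro compact_continuous_image) auto
  then obtain B where B: "\<And>x. x \<in> {0..1} \<Longrightarrow> \<bar>log_excess l x\<bar> \<le> B"
    using compact_imp_bounded bounded_pos by (metis image_eqI real_norm_def)
  have "potential l y \<ge> exp (- B) * y" if "y \<in> {0..1}" for y
    using B[OF that] that unfolding potential_def
    by (subst mult.commute) (intro mult_left_mono; auto)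
  then show thesis using that[of "exp (- B)"] by simp
qed

text \<open>An antiderivative of \<open>- 1 / rate\<close> is \<open>- (ln x + log_excess l x) / l\<close>. Its logarithm cancels the
term \<open>ln z\<close> of \<open>c1_fun\<close>, and hence the limit at 0 exists.\<close>

lemma c1_fun_eq:
  assumes "l \<ge> 1" "0 < z" "z \<le> 1"
  shows "c1_fun l z = log_excess l 1 - log_excess l z"
proof -
  let ?h = "\<lambda>x. 1 / (-2 + (1 - x\<^sup>2) ^ (l div 2) + (1 - x) ^ l)"
  let ?F = "\<lambda>x. - (ln x + log_excess l x) / real l"
  have h: "?h x = - 1 / rate l x" for x
    by (simp add: rate_def divide_simps)
  have pos: "rate l x > 0" if "x \<in> {z..1}" for x
  proof -
    have "rate_quot l x \<ge> 1" using assms that by (intro rate_quot_ge_1) auto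
    moreover have "x > 0" using assms that by auto
    ultimately show ?thesis by (simp add: rate_eq)
  qed
  have "(LBINT x=ereal 1..ereal z. ?h x) = ?F z - ?F 1"
  proof (rule interval_integral_FTC_finite)
    have mm: "{min 1 z..max 1 z} = {z..1}" using assms by auto
    show "continuous_on {min 1 z..max 1 z} ?h"
      unfolding mm h by (intro continuous_intros)
        (use pos in \<open>force simp: rate_def[abs_def] intro!: continuous_intros\<close>)+
    fix x assume "min 1 z \<le> x" "x \<le> max 1 z"
    then have x: "x \<in> {z..1}" using assms by auto
    then have x1: "x \<in> {0..1}" and x0: "x > 0" using assms by auto
    have rq: "rate_quot l x \<ge> 1" using rate_quot_ge_1[OF assms(1) x1] .
    have "(log_excess l has_real_derivative rate_defect l x / rate_quot l x) (at x within {z..1})"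
      using log_excess_deriv[OF assms(1) x1] by (rule DERIV_subset) (use assms in auto)
    then have "(?F has_real_derivative - (1 / x + rate_defect l x / rate_quot l x) / real l)
        (at x within {z..1})"
      using x0 assms(1) by (auto intro!: derivative_eq_intros simp: divide_simps)
    also have "- (1 / x + rate_defect l x / rate_quot l x) / real l = ?h x"
    proof -
      have "1 / x + rate_defect l x / rate_quot l x = real l / rate l x"
        using x0 rq rate_quot_eq[of l x] by (simp add: rate_eq field_simps)
      then show ?thesis unfolding h using assms(1) by simp
    qed
    finally show "(?F has_vector_derivative ?h x) (at x within {min 1 z..max 1 z})"
      unfolding mm by (simp add: has_real_derivative_iff_has_vector_derivative)
  qed
  then show ?thesis using assms(1) by (simp add: c1_fun_def field_simps)
qed

lemma c1_fun_tendsto: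
  assumes "l \<ge> 1"
  shows "(c1_fun l \<longlongrightarrow> log_excess l 1) (at_right 0)"
proof -
  have "continuous (at 0 within {0..1}) (log_excess l)"
    using log_excess_deriv[OF assms, of 0] by (intro DERIV_continuous) auto
  then have "(log_excess l \<longlongrightarrow> 0) (at 0 within {0..1})"
    by (simp add: continuous_within)
  then have "(log_excess l \<longlongrightarrow> 0) (at_right 0)"
    using at_within_Icc_at_right[of 0 "1::real"] by simp
  then have "((\<lambda>z. log_excess l 1 - log_excess l z) \<longlongrightarrow> log_excess l 1 - 0) (at_right 0)"
    by (intro tendsto_intros)
  then have "((\<lambda>z. log_excess l 1 - log_excess l z) \<longlongrightarrow> log_excess l 1) (at_right 0)" by simp
  moreover have "\<forall>\<^sub>F z in at_right 0. log_excess l 1 - log_excess l z = c1_fun l z"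
  proof -
    have "\<forall>\<^sub>F z in at_right 0. z \<in> {0<..<1::real}" by (rule eventually_at_right_real) simp
    then show ?thesis by eventually_elim (use assms in \<open>auto simp: c1_fun_eq\<close>)
  qed
  ultimately show ?thesis by (rule Lim_transform_eventually)
qed

lemma c1_eq: "l \<ge> 1 \<Longrightarrow> c1 l = log_excess l 1"
  unfolding c1_def by (intro tendsto_Lim c1_fun_tendsto) auto

lemma potential_1: "l \<ge> 1 \<Longrightarrow> potential l 1 = d1 l"
  by (simp add: potential_def d1_def c1_eq)


section \<open>One-step estimates\<close>

text \<open>The law of \<open>max_drop\<close> under a uniform tuple when a fraction \<open>x\<close> of the vertices is isolated; all
arguments \<open>d \<ge> 2\<close> share the value for 2.\<close>

definition jump_prob :: "nat \<Rightarrow> real \<Rightarrow> nat \<Rightarrow> real" where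
  "jump_prob l x d = (if d = 0 then (1 - x) ^ l
     else if d = 1 then (1 - x\<^sup>2) ^ (l div 2) - (1 - x) ^ l
     else 1 - (1 - x\<^sup>2) ^ (l div 2))"

lemma jump_prob_mean: "jump_prob l x 1 + 2 * jump_prob l x 2 = rate l x"
  by (simp add: jump_prob_def rate_def)

lemma jump_prob_sum: "jump_prob l x 0 + jump_prob l x 1 + jump_prob l x 2 = 1"
  by (simp add: jump_prob_def)

lemma one_minus_power_le: "x \<in> {0..1} \<Longrightarrow> 1 - (1 - x) ^ k \<le> real k * x" for x :: real
  using Bernoulli_inequality[of "- x" k] by simp

lemma jump_prob_bounds:
  assumes "even l" "x \<in> {0..1}"
  shows "0 \<le> jump_prob l x 1" "jump_prob l x 1 \<le> real l * x"
    "0 \<le> jump_prob l x 2" "jump_prob l x 2 \<le> real l * x\<^sup>2"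
proof -
  have x2: "0 \<le> 1 - x\<^sup>2" using assms by (simp add: power_le_one)
  have "((1 - x)\<^sup>2) ^ (l div 2) \<le> (1 - x\<^sup>2) ^ (l div 2)"
  proof (rule power_mono)
    have "(1 - x)\<^sup>2 = 1 - x\<^sup>2 - 2 * (x * (1 - x))" by (simp add: power2_eq_square algebra_simps)
    moreover have "x * (1 - x) \<ge> 0" using assms by simp
    ultimately show "(1 - x)\<^sup>2 \<le> 1 - x\<^sup>2" by linarith
  qed simp
  moreover have "((1 - x)\<^sup>2) ^ (l div 2) = (1 - x) ^ l"
    using assms by (simp flip: power_mult)
  ultimately show "0 \<le> jump_prob l x 1" by (simp add: jump_prob_def)
  have "(1 - x\<^sup>2) ^ (l div 2) \<le> 1" using x2 assms by (intro power_le_one) auto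
  then show "0 \<le> jump_prob l x 2" "jump_prob l x 1 \<le> real l * x"
    using one_minus_power_le[OF assms(2), of l] by (simp_all add: jump_prob_def)
  have "jump_prob l x 2 \<le> real (l div 2) * x\<^sup>2"
    using one_minus_power_le[of "x\<^sup>2" "l div 2"] assms by (simp add: jump_prob_def power_le_one)
  also have "\<dots> \<le> real l * x\<^sup>2" by (intro mult_right_mono) auto
  finally show "jump_prob l x 2 \<le> real l * x\<^sup>2" .
qed

lemma exp_minus_one_le: "exp t - 1 \<le> t * exp t" for t :: real
proof -
  have "exp t * (1 - t) \<le> exp t * exp (- t)"
    using exp_ge_add_one_self[of "- t"] by (intro mult_left_mono) auto
  then show ?thesis by (simp add: algebra_simps flip: exp_add)
qed

lemma exp_taylor1_ge: "0 \<le> exp t - 1 - t" for t :: real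
  using exp_ge_add_one_self[of t] by linarith

lemma exp_taylor2_le: "0 \<le> t \<Longrightarrow> exp t - 1 - t \<le> t\<^sup>2 * exp t" for t :: real
proof -
  assume "0 \<le> t"
  then have "t * (exp t - 1) \<le> t * (t * exp t)"
    by (intro mult_left_mono exp_minus_one_le)
  then show ?thesis using exp_minus_one_le[of t] by (simp add: power2_eq_square algebra_simps)
qed

text \<open>The error vanishes at \<open>u = 0\<close> and at \<open>u = 1\<close>. In the application \<open>u\<close> is \<open>potential' l x\<close>, which
differs from 1 by \<open>O(x)\<close>, so the factor \<open>\<bar>u - 1\<bar>\<close> supplies the second power of \<open>x\<close>; the first one
is the probability of a jump.\<close>

lemma exp_slope_error:
  fixes s u U S :: real
  assumes "0 \<le> s" "s \<le> S" "0 \<le> u" "u \<le> U" "1 \<le> U"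
  shows "\<bar>exp (s * u) - 1 - (exp s - 1) * u\<bar> \<le> s\<^sup>2 * (2 * U * exp (S * U)) * \<bar>u - 1\<bar>"
proof -
  have "norm ((exp (s * u) - (exp s - 1) * u) - (exp (s * 1) - (exp s - 1) * 1))
      \<le> s\<^sup>2 * (2 * U * exp (S * U)) * norm (u - 1)"
  proof (rule field_differentiable_bound[of "{0..U}" _ "\<lambda>v. s * exp (s * v) - (exp s - 1)"])
    fix v assume v: "v \<in> {0..U}"
    show "((\<lambda>v. exp (s * v) - (exp s - 1) * v) has_real_derivative
        s * exp (s * v) - (exp s - 1)) (at v within {0..U})"
      by (auto intro!: derivative_eq_intros)
    have sv: "s * v \<le> S * U" "s * v \<le> s * U" "S * 1 \<le> S * U" "0 \<le> s * v"
      using assms v by (auto intro!: mult_mono mult_left_mono simp del: mult_1_right)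
    have "exp (s * v) - 1 \<le> (s * v) * exp (s * v)" by (rule exp_minus_one_le)
    also have "\<dots> \<le> (s * U) * exp (S * U)"
      using sv assms v by (intro mult_mono) auto
    finally have "s * (exp (s * v) - 1) \<le> s * ((s * U) * exp (S * U))"
      using assms by (intro mult_left_mono)
    then have 1: "s * exp (s * v) - s \<le> s\<^sup>2 * (U * exp (S * U))"
      by (simp add: power2_eq_square algebra_simps)
    have 2: "s * exp (s * v) - s \<ge> 0"
      using assms sv mult_left_mono[of 1 "exp (s * v)" s] by simp
    have "exp s - 1 - s \<le> s\<^sup>2 * exp s" using exp_taylor2_le[of s] assms by simp
    also have "\<dots> \<le> s\<^sup>2 * (U * exp (S * U))"
    proof (intro mult_left_mono)
      have "1 * exp s \<le> U * exp (S * U)" using assms sv by (intro mult_mono) auto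
      then show "exp s \<le> U * exp (S * U)" by simp
    qed simp
    finally have 3: "exp s - 1 - s \<le> s\<^sup>2 * (U * exp (S * U))" .
    have 4: "0 \<le> exp s - 1 - s" by (rule exp_taylor1_ge)
    show "norm (s * exp (s * v) - (exp s - 1)) \<le> s\<^sup>2 * (2 * U * exp (S * U))"
      using 1 2 3 4 by (simp add: abs_le_iff)
  qed (use assms in auto)
  then show ?thesis by (simp add: algebra_simps)
qed

text \<open>For jumps of size two no such factor is needed, since their probability is \<open>O(x\<^sup>2)\<close>.\<close>

lemma exp_double_slope_error:
  fixes s u U S :: real
  assumes "0 \<le> s" "s \<le> S" "0 \<le> u" "u \<le> U"
  shows "\<bar>exp (2 * s * u) - 1 - 2 * (exp s - 1) * u\<bar>
    \<le> s\<^sup>2 * (4 * U\<^sup>2 * exp (2 * S * U) + 2 * U * exp S)"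
proof -
  have su: "s * u \<le> S * U" "s * u \<le> s * U" "0 \<le> s * u"
    using assms by (auto intro!: mult_mono mult_left_mono)
  have "exp (2 * s * u) - 1 - 2 * s * u \<le> (2 * s * u)\<^sup>2 * exp (2 * s * u)"
    using exp_taylor2_le[of "2 * s * u"] su by (simp add: mult.assoc)
  also have "\<dots> \<le> (2 * s * U)\<^sup>2 * exp (2 * S * U)"
    using su assms by (intro mult_mono power_mono) (auto simp: mult.assoc)
  finally have 1: "exp (2 * s * u) - 1 - 2 * s * u \<le> s\<^sup>2 * (4 * U\<^sup>2 * exp (2 * S * U))"
    by (simp add: power_mult_distrib algebra_simps)
  have 2: "0 \<le> exp (2 * s * u) - 1 - 2 * s * u"
    using exp_ge_add_one_self[of "2 * s * u"] by linarith
  have "exp s - 1 - s \<le> s\<^sup>2 * exp s" using exp_taylor2_le[of s] assms by simp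
  also have "\<dots> \<le> s\<^sup>2 * exp S" using assms by (intro mult_left_mono) auto
  finally have "u * (exp s - 1 - s) \<le> U * (s\<^sup>2 * exp S)"
    using assms exp_taylor1_ge[of s] by (intro mult_mono) (auto simp del: diff_ge_0_iff_ge)
  then have 3: "2 * u * (exp s - 1 - s) \<le> s\<^sup>2 * (2 * U * exp S)" by (simp add: algebra_simps)
  have 4: "0 \<le> 2 * u * (exp s - 1 - s)"
    using assms exp_taylor1_ge[of s] by (intro mult_nonneg_nonneg) (auto simp del: diff_ge_0_iff_ge)
  have "exp (2 * s * u) - 1 - 2 * (exp s - 1) * u
      = (exp (2 * s * u) - 1 - 2 * s * u) - 2 * u * (exp s - 1 - s)" by (simp add: algebra_simps)
  then show ?thesis using 1 2 3 4 by (simp add: abs_le_iff distrib_left)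
qed

text \<open>\<open>U\<close> and \<open>b\<close> are constants for the smoothness and the growth of \<open>potential\<close>, and \<open>S\<close> is the largest
value of \<open>- ln (1 - t)\<close> for which the estimates are made. All error constants below depend only on
\<open>l\<close>, \<open>U\<close>, \<open>b\<close> and \<open>S\<close>, never on \<open>n\<close>.\<close>

locale survival_estimates =
  fixes l :: nat and U b S :: real
  assumes l: "l \<ge> 1" "even l"
    and U: "U \<ge> 1" "\<And>x. x \<in> {0..1} \<Longrightarrow> 0 \<le> potential' l x" "\<And>x. x \<in> {0..1} \<Longrightarrow> potential' l x \<le> U"
      "\<And>x. x \<in> {0..1} \<Longrightarrow> \<bar>potential' l x - 1\<bar> \<le> U * x"
      "\<And>x. x \<in> {0..1} \<Longrightarrow> 0 \<le> potential l x" "\<And>x. x \<in> {0..1} \<Longrightarrow> potential l x \<le> U * x"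
      "\<And>x y. x \<in> {0..1} \<Longrightarrow> y \<in> {0..1} \<Longrightarrow>
        \<bar>potential l y - potential l x - potential' l x * (y - x)\<bar> \<le> U * (y - x)\<^sup>2"
    and b: "b > 0" "\<And>y. y \<in> {0..1} \<Longrightarrow> potential l y \<ge> b * y"

lemma survival_estimates_exist:
  assumes "l \<ge> 1" "even l"
  obtains U b where "survival_estimates l U b"
proof -
  obtain b where b: "b > 0" "\<And>y. y \<in> {0..1} \<Longrightarrow> potential l y \<ge> b * y"
    using potential_lower[OF assms(1)] by metis
  obtain A where A: "A > 0" "\<And>x y. x \<in> {0..1} \<Longrightarrow> y \<in> {0..1} \<Longrightarrow>
    \<bar>potential' l x - potential' l y\<bar> \<le> A * \<bar>x - y\<bar>" using potential'_lipschitz[OF assms(1)] by metis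
  obtain B where B: "B > 0" "\<And>x y. x \<in> {0..1} \<Longrightarrow> y \<in> {0..1} \<Longrightarrow>
    \<bar>potential l y - potential l x - potential' l x * (y - x)\<bar> \<le> B * (y - x)\<^sup>2"
    using potential_taylor[OF assms(1)] by metis
  define U where "U = 1 + A + B"
  have A': "\<bar>potential' l x - 1\<bar> \<le> A * x" if "x \<in> {0..1}" for x
    using A(2)[OF that, of 0] that assms by (simp add: potential'_0)
  have "survival_estimates l U b"
  proof
    show "l \<ge> 1" "even l" "b > 0" by fact+
    show "U \<ge> 1" using A B by (simp add: U_def)
    fix x :: real assume x: "x \<in> {0..1}"
    show "potential l x \<ge> b * x" using b(2)[OF x] .
    show "0 \<le> potential' l x" using potential'_nonneg[OF assms(1) x] .
    have "A * x \<le> A * 1" using x A by (intro mult_left_mono) auto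
    then show "potential' l x \<le> U" using A'[OF x] B by (simp add: U_def)
    have "A * x \<le> U * x" using x A B by (intro mult_right_mono) (auto simp: U_def)
    then show "\<bar>potential' l x - 1\<bar> \<le> U * x" using A'[OF x] by simp
    show "0 \<le> potential l x" using x by (simp add: potential_def)
    have "potential l x \<le> x + B * x\<^sup>2" using B(2)[of 0 x] x assms by (simp add: potential'_0)
    also have "B * x\<^sup>2 \<le> B * x" using x B
      by (intro mult_left_mono) (auto simp: power2_eq_square mult_left_le_one_le)
    also have "x + B * x \<le> U * x" using x A by (simp add: U_def distrib_right)
    finally show "potential l x \<le> U * x" by simp
    fix y :: real assume y: "y \<in> {0..1}"
    have "B * (y - x)\<^sup>2 \<le> U * (y - x)\<^sup>2" using A by (intro mult_right_mono) (auto simp: U_def)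
    then show "\<bar>potential l y - potential l x - potential' l x * (y - x)\<bar> \<le> U * (y - x)\<^sup>2"
      using B(2)[OF x y] by simp
  qed
  then show thesis by (rule that)
qed

text \<open>Here \<open>s\<close> and \<open>r\<close> are the values of \<open>- ln (1 - \<theta>)\<close> after and before a round. With
\<open>\<mu> = exp s - 1 = t / (1 - t)\<close> one has \<open>s - r = ln (1 + \<mu> * (1 - exp (- h)))\<close>, which is \<open>\<mu> * h\<close> up to
second order in \<open>h\<close>. The second-order term keeps a factor \<open>s\<close>, which is needed early in the process,
where \<open>s\<close> is tiny.\<close>

lemma discount_step:
  fixes t h S :: real
  assumes "0 \<le> t" "t < 1" "- ln (1 - t) \<le> S" "0 \<le> h"
  defines "s \<equiv> - ln (1 - t)"
  defines "r \<equiv> - ln (1 - t * exp (- h))"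
  shows "0 \<le> s - r" "s - r \<le> (exp s - 1) * h"
    "(exp s - 1) * h - s * (exp S * (exp S + 1)) * h\<^sup>2 \<le> s - r"
proof -
  define q where "q = exp (- h)"
  define mu where "mu = exp s - 1"
  have q: "0 \<le> q" "q \<le> 1" using assms by (auto simp: q_def)
  have tq: "t * q \<le> t" using q assms(1) mult_left_mono[of q 1 t] by simp
  have es: "exp s = 1 / (1 - t)" using assms by (simp add: s_def exp_minus divide_simps)
  have s0: "0 \<le> s" using assms by (simp add: s_def)
  have mu: "mu = t / (1 - t)" unfolding mu_def es using assms(2) by (simp add: field_simps)
  have mu0: "0 \<le> mu" using s0 by (simp add: mu_def)
  have "s - r = ln ((1 - t * q) / (1 - t))"
    using assms tq by (simp add: s_def r_def q_def ln_div)
  also have "(1 - t * q) / (1 - t) = 1 + mu * (1 - q)"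
    using assms by (simp add: mu field_simps)
  finally have sr: "s - r = ln (1 + mu * (1 - q))" .
  have p0: "0 \<le> mu * (1 - q)" using mu0 q by simp
  show "0 \<le> s - r" using sr p0 by simp
  have qh: "1 - q \<le> h" using exp_ge_add_one_self[of "- h"] by (simp add: q_def)
  have ph: "mu * (1 - q) \<le> mu * h" using qh mu0 by (intro mult_left_mono)
  have "s - r \<le> mu * (1 - q)" unfolding sr using p0 by (rule ln_add_one_self_le_self)
  also note ph
  finally show "s - r \<le> (exp s - 1) * h" by (simp add: mu_def)
  have ql: "1 - q \<ge> h - h\<^sup>2"
  proof -
    have "exp h * (1 - h + h\<^sup>2) \<ge> 1"
    proof -
      have "(1 + h) * (1 - h + h\<^sup>2) = 1 + h ^ 3" by (simp add: algebra_simps power2_eq_square power3_eq_cube)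
      moreover have "1 - h + h\<^sup>2 \<ge> 0"
        using zero_le_power2[of "h - 1"] assms by (simp add: power2_eq_square algebra_simps)
      moreover have "h ^ 3 \<ge> 0" using assms by simp
      ultimately show ?thesis
        using mult_right_mono[of "1 + h" "exp h" "1 - h + h\<^sup>2"] exp_ge_add_one_self[of h]
        by linarith
    qed
    then have "q \<le> 1 - h + h\<^sup>2"
      by (simp add: q_def exp_minus inverse_eq_divide pos_divide_le_eq mult.commute)
    then show ?thesis by simp
  qed
  have eS: "exp s \<le> exp S" using assms by (simp add: s_def)
  have "mu \<le> s * exp s" unfolding mu_def by (rule exp_minus_one_le)
  also have "\<dots> \<le> s * exp S" using eS s0 by (intro mult_left_mono) auto
  finally have mus: "mu \<le> s * exp S" .
  have "mu * h - mu * h\<^sup>2 \<le> mu * (1 - q)" using ql mu0 mult_left_mono by (fastforce simp: algebra_simps)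
  moreover have "mu * (1 - q) - (mu * (1 - q))\<^sup>2 \<le> s - r"
  proof -
    define z where "z = mu * (1 - q)"
    have z: "0 \<le> z" using p0 by (simp add: z_def)
    have "- ln (1 + z) = ln (1 / (1 + z))" using z by (simp add: ln_div)
    also have "\<dots> \<le> 1 / (1 + z) - 1" using z by (intro ln_le_minus_one) simp
    also have "\<dots> = - z / (1 + z)" using z by (simp add: field_simps)
    also have "\<dots> \<le> - z + z\<^sup>2"
    proof -
      have "(z - z\<^sup>2) * (1 + z) = z - z ^ 3" by (simp add: algebra_simps power2_eq_square power3_eq_cube)
      then have "(z - z\<^sup>2) * (1 + z) \<le> z" using z by simp
      then have "z - z\<^sup>2 \<le> z / (1 + z)" using z by (simp add: pos_le_divide_eq)
      then show ?thesis by simp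
    qed
    finally show ?thesis by (simp add: sr z_def)
  qed
  moreover have "(mu * (1 - q))\<^sup>2 \<le> (s * exp S * exp S) * h\<^sup>2"
  proof -
    have "(mu * (1 - q))\<^sup>2 \<le> (mu * h)\<^sup>2" using ph p0 by (intro power_mono)
    also have "\<dots> = (mu * mu) * h\<^sup>2" by (simp add: power2_eq_square)
    also have "\<dots> \<le> (s * exp S * exp S) * h\<^sup>2"
    proof (intro mult_right_mono mult_mono mus)
      show "mu \<le> exp S" unfolding mu_def using eS by linarith
    qed (use mu0 s0 in auto)
    finally show ?thesis .
  qed
  moreover have "mu * h\<^sup>2 \<le> s * exp S * h\<^sup>2" using mus by (intro mult_right_mono) auto
  ultimately show "(exp s - 1) * h - s * (exp S * (exp S + 1)) * h\<^sup>2 \<le> s - r"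
    unfolding mu_def[symmetric] by (simp add: algebra_simps)
qed

abbreviation discount :: "nat \<Rightarrow> nat \<Rightarrow> real \<Rightarrow> real" where
  "discount l n t \<equiv> t * exp (- real l / real n)"

text \<open>The mean of \<open>exp (s * d * \<psi>' x)\<close> over a drop \<open>d\<close> with law \<open>jump_prob l x\<close>; for \<open>t = 1 - exp (- s)\<close>
this is the expected factor by which a drop changes \<open>survival\<close>, to first order.\<close>

definition mean_factor :: "nat \<Rightarrow> real \<Rightarrow> real \<Rightarrow> real" where
  "mean_factor l x s = jump_prob l x 0 + jump_prob l x 1 * exp (s * potential' l x)
     + jump_prob l x 2 * exp (2 * s * potential' l x)"

definition (in survival_estimates) mean_const :: real where
  "mean_const = real l * (2 * U * exp (S * U)) * U
     + real l * (4 * U\<^sup>2 * exp (2 * S * U) + 2 * U * exp S)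
     + (exp S * real l * U)\<^sup>2 * exp (exp S * real l * U * S)
     + exp S * (exp S + 1) * (real l)\<^sup>2 * U"

lemma (in survival_estimates) mean_const_nonneg: "mean_const \<ge> 0"
  using U(1) by (simp add: mean_const_def)

text \<open>The cancellation behind the whole argument. The mean factor is
\<open>1 + (exp s - 1) * \<psi>' x * rate x\<close> and the discount contributes \<open>1 + (exp s - 1) * l * \<psi> x\<close>, both
up to the stated error. The two agree by the differential equation for \<open>\<psi>\<close>.\<close>

lemma (in survival_estimates) mean_factor_error:
  assumes n: "n \<ge> 1" and x: "x \<in> {0..1}" and t: "0 \<le> t" "t < 1" and S: "- ln (1 - t) \<le> S"
  shows "\<bar>mean_factor l x (- ln (1 - t))
        - exp ((- ln (1 - t) + ln (1 - discount l n t)) * (real n * potential l x))\<bar>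
      \<le> mean_const * ((- ln (1 - t) * x)\<^sup>2 + - ln (1 - t) * x / real n)"
proof -
  define C1 where "C1 = real l * (2 * U * exp (S * U)) * U"
  define C2 where "C2 = real l * (4 * U\<^sup>2 * exp (2 * S * U) + 2 * U * exp S)"
  define T where "T = exp S * real l * U"
  define C3 where "C3 = T\<^sup>2 * exp (T * S)"
  define C4 where "C4 = exp S * (exp S + 1) * (real l)\<^sup>2 * U"
  have C: "0 \<le> C1" "0 \<le> C2" "0 \<le> C3" "0 \<le> C4" "0 \<le> T"
    using U(1) by (auto simp: C1_def C2_def C3_def C4_def T_def)
  define s where "s = - ln (1 - t)"
  define r where "r = - ln (1 - t * exp (- real l / real n))"
  define u where "u = potential' l x"
  define psi where "psi = potential l x"
  define p1 where "p1 = jump_prob l x 1"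
  define p2 where "p2 = jump_prob l x 2"
  have s: "0 \<le> s" "s \<le> S" using t S by (auto simp: s_def)
  have u: "0 \<le> u" "u \<le> U" "\<bar>u - 1\<bar> \<le> U * x" using U x by (auto simp: u_def)
  have psi: "0 \<le> psi" "psi \<le> U * x" using U x by (auto simp: psi_def)
  have p: "0 \<le> p1" "p1 \<le> real l * x" "0 \<le> p2" "p2 \<le> real l * x\<^sup>2"
    using jump_prob_bounds[OF l(2) x] by (auto simp: p1_def p2_def)
  have x0: "0 \<le> x" using x by simp
  define e1 where "e1 = exp (s * u) - 1 - (exp s - 1) * u"
  define e2 where "e2 = exp (2 * s * u) - 1 - 2 * (exp s - 1) * u"
  have "\<bar>e1\<bar> \<le> s\<^sup>2 * (2 * U * exp (S * U)) * \<bar>u - 1\<bar>"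
    unfolding e1_def using s u U(1) by (intro exp_slope_error)
  also have "\<dots> \<le> s\<^sup>2 * (2 * U * exp (S * U)) * (U * x)"
    using u U(1) by (intro mult_left_mono) auto
  finally have "p1 * \<bar>e1\<bar> \<le> (real l * x) * (s\<^sup>2 * (2 * U * exp (S * U)) * (U * x))"
    using p x0 by (intro mult_mono) auto
  then have E1: "p1 * \<bar>e1\<bar> \<le> C1 * (s * x)\<^sup>2"
    by (simp add: C1_def power2_eq_square algebra_simps)
  have "\<bar>e2\<bar> \<le> s\<^sup>2 * (4 * U\<^sup>2 * exp (2 * S * U) + 2 * U * exp S)"
    unfolding e2_def using s u by (intro exp_double_slope_error)
  then have "p2 * \<bar>e2\<bar> \<le> (real l * x\<^sup>2) * (s\<^sup>2 * (4 * U\<^sup>2 * exp (2 * S * U) + 2 * U * exp S))"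
    using p by (intro mult_mono) auto
  then have E2: "p2 * \<bar>e2\<bar> \<le> C2 * (s * x)\<^sup>2"
    by (simp add: C2_def power2_eq_square algebra_simps)
  have m: "u * (p1 + 2 * p2) = real l * psi"
    using rate_times_potential'[OF l(1) x] jump_prob_mean[of l x]
    by (simp add: u_def p1_def p2_def psi_def mult.commute)
  define w where "w = (s - r) * (real n * psi)"
  define h where "h = real l / real n"
  have h0: "0 \<le> h" by (simp add: h_def)
  have ds: "0 \<le> s - r" "s - r \<le> (exp s - 1) * h"
    "(exp s - 1) * h - s * (exp S * (exp S + 1)) * h\<^sup>2 \<le> s - r"
    using discount_step[OF t S h0] by (auto simp: s_def r_def h_def)
  have nh: "h * real n = real l" using n by (simp add: h_def)
  have npsi: "0 \<le> real n * psi" using psi by simp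
  have w0: "0 \<le> w" using ds npsi by (simp add: w_def)
  have "w \<le> (exp s - 1) * h * (real n * psi)" unfolding w_def using ds npsi by (intro mult_right_mono)
  also have "\<dots> = (exp s - 1) * psi * (h * real n)" by (simp add: mult_ac)
  also have "\<dots> = (exp s - 1) * real l * psi" unfolding nh by (simp add: mult_ac)
  finally have w1: "w \<le> (exp s - 1) * real l * psi" .
  have "(exp s - 1) * (real l * psi) \<le> (s * exp S) * (real l * (U * x))"
  proof (intro mult_mono psi mult_left_mono)
    show "exp s - 1 \<le> s * exp S"
      using exp_minus_one_le[of s] s mult_left_mono[of "exp s" "exp S" s] by simp
  qed (use s psi in auto)
  then have w2: "w \<le> T * (s * x)" using w1 by (simp add: T_def algebra_simps)
  have "s * x \<le> S * 1" using s x by (intro mult_mono) auto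
  then have "T * (s * x) \<le> T * S" using C by (intro mult_left_mono) auto
  then have w3: "w \<le> T * S" using w2 by simp
  have "exp w - 1 - w \<le> w\<^sup>2 * exp w" using w0 by (rule exp_taylor2_le)
  also have "\<dots> \<le> (T * (s * x))\<^sup>2 * exp (T * S)"
    using w0 w2 w3 by (intro mult_mono power_mono) auto
  finally have E3: "exp w - 1 - w \<le> C3 * (s * x)\<^sup>2" by (simp add: C3_def power_mult_distrib mult_ac)
  have E3': "0 \<le> exp w - 1 - w" by (rule exp_taylor1_ge)
  have "((exp s - 1) * h - s * (exp S * (exp S + 1)) * h\<^sup>2) * (real n * psi) \<le> w"
    unfolding w_def using ds npsi by (intro mult_right_mono)
  moreover have "((exp s - 1) * h - s * (exp S * (exp S + 1)) * h\<^sup>2) * (real n * psi)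
     = (exp s - 1) * psi * (h * real n) - s * (exp S * (exp S + 1)) * psi * h * (h * real n)"
    by (simp add: algebra_simps power2_eq_square)
  moreover have "s * (exp S * (exp S + 1)) * psi * h * (h * real n) \<le> C4 * (s * x / real n)"
  proof -
    have "s * (exp S * (exp S + 1)) * psi * h * (h * real n)
        = s * (exp S * (exp S + 1)) * (real l)\<^sup>2 / real n * psi"
      unfolding nh by (simp add: h_def power2_eq_square)
    also have "\<dots> \<le> s * (exp S * (exp S + 1)) * (real l)\<^sup>2 / real n * (U * x)"
      using s psi by (intro mult_left_mono) auto
    finally show ?thesis by (simp add: C4_def mult_ac)
  qed
  ultimately have E4: "(exp s - 1) * real l * psi - w \<le> C4 * (s * x / real n)"
    unfolding nh by (simp add: mult_ac)
  have "jump_prob l x 0 + p1 * exp (s * u) + p2 * exp (2 * s * u) - exp w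
     = (jump_prob l x 0 + p1 + p2) + p1 * e1 + p2 * e2 + (exp s - 1) * (u * (p1 + 2 * p2)) - exp w"
    by (simp add: e1_def e2_def algebra_simps)
  also have "\<dots> = p1 * e1 + p2 * e2 - (exp w - 1 - w) + ((exp s - 1) * real l * psi - w)"
    unfolding m using jump_prob_sum[of l x] by (simp add: p1_def p2_def)
  finally have eq: "jump_prob l x 0 + p1 * exp (s * u) + p2 * exp (2 * s * u) - exp w = \<dots>" .
  have "\<bar>p1 * e1\<bar> \<le> C1 * (s * x)\<^sup>2" "\<bar>p2 * e2\<bar> \<le> C2 * (s * x)\<^sup>2"
    using E1 E2 p by (simp_all add: abs_mult)
  then have "\<bar>jump_prob l x 0 + p1 * exp (s * u) + p2 * exp (2 * s * u) - exp w\<bar>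
      \<le> C1 * (s * x)\<^sup>2 + C2 * (s * x)\<^sup>2 + C3 * (s * x)\<^sup>2 + C4 * (s * x / real n)"
    unfolding eq using E3 E3' E4 w1 by linarith
  also have "\<dots> \<le> (C1 + C2 + C3 + C4) * ((s * x)\<^sup>2 + s * x / real n)"
  proof -
    have "0 \<le> s * x / real n" using s x0 by simp
    then have "0 \<le> (C1 + C2 + C3) * (s * x / real n)" "0 \<le> C4 * (s * x)\<^sup>2"
      using C by (auto intro!: mult_nonneg_nonneg simp del: times_divide_eq_right)
    moreover have "(C1 + C2 + C3 + C4) * (a + z) = C1 * a + C2 * a + C3 * a + C4 * z
        + ((C1 + C2 + C3) * z + C4 * a)" for a z by (simp add: algebra_simps)
    ultimately show ?thesis by simp
  qed
  finally show ?thesis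
    by (simp add: s_def r_def u_def psi_def p1_def p2_def w_def mean_factor_def mean_const_def
      C1_def C2_def C3_def C4_def T_def)
qed

lemma mult_exp_neg_le:
  fixes b t :: real
  assumes "b > 0" "t \<ge> 0"
  shows "t * exp (- b * t) \<le> 1 / b" "t\<^sup>2 * exp (- b * t) \<le> 4 / b\<^sup>2"
proof -
  have *: "t * exp (- b * t) \<le> 1 / b" if "b > 0" for b
  proof -
    have "b * t \<le> exp (b * t)" using exp_ge_add_one_self[of "b * t"] by linarith
    then show ?thesis using that by (simp add: exp_minus field_simps)
  qed
  show "t * exp (- b * t) \<le> 1 / b" using *[OF assms(1)] .
  have "(t * exp (- (b / 2) * t))\<^sup>2 \<le> (1 / (b / 2))\<^sup>2"
    using *[of "b / 2"] assms by (intro power_mono) auto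
  moreover have "(t * exp (- (b / 2) * t))\<^sup>2 = t\<^sup>2 * exp (- b * t)"
    by (simp add: power_mult_distrib power2_eq_square flip: exp_add)
  ultimately show "t\<^sup>2 * exp (- b * t) \<le> 4 / b\<^sup>2" by (simp add: power_divide)
qed

text \<open>This is \<open>(1 - t) powr (n * \<psi> (Y / n))\<close>, the probability that none of \<open>n * \<psi> (Y / n)\<close> objects is
selected if each is selected independently with probability \<open>t\<close>. It equals 1 when \<open>Y = 0\<close>.\<close>

definition survival :: "nat \<Rightarrow> nat \<Rightarrow> real \<Rightarrow> nat \<Rightarrow> real" where
  "survival l n t Y = exp (ln (1 - t) * (real n * potential l (real Y / real n)))"

definition (in survival_estimates) jump_const :: real where
  "jump_const = exp (2 * S * U) * (4 * U * exp (4 * S * U))"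

text \<open>The Taylor error of \<open>n * \<psi>\<close> over a jump of size at most 2 is \<open>O(1 / n)\<close>, and it occurs only if there
is a jump.\<close>

lemma (in survival_estimates) survival_jump_error:
  fixes n Y D :: nat
  assumes n: "n \<ge> 1" and Y: "Y \<le> n" and D: "D \<le> Y" "D \<le> 2" and t: "0 \<le> t" "t < 1"
    and S: "- ln (1 - t) \<le> S"
  shows "\<bar>survival l n t (Y - D)
        - survival l n t Y * exp (real D * - ln (1 - t) * potential' l (real Y / real n))\<bar>
      \<le> (if D = 0 then 0 else jump_const * survival l n t Y * (- ln (1 - t) / real n))"
proof -
  define s where "s = - ln (1 - t)"
  define x where "x = real Y / real n"
  define y where "y = real (Y - D) / real n"
  define u where "u = potential' l x"
  have s: "0 \<le> s" "s \<le> S" using t S by (auto simp: s_def)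
  have xy: "x \<in> {0..1}" "y \<in> {0..1}" using n Y D by (auto simp: x_def y_def divide_simps)
  have u: "0 \<le> u" "u \<le> U" using U xy by (auto simp: u_def)
  have yx: "y - x = - (real D / real n)"
    using D n by (simp add: x_def y_def of_nat_diff field_simps)
  define e where "e = real n * (potential l y - potential l x) + real D * u"
  have "e = real n * (potential l y - potential l x - u * (y - x))"
    unfolding yx using n by (simp add: e_def field_simps)
  then have "\<bar>e\<bar> = real n * \<bar>potential l y - potential l x - u * (y - x)\<bar>"
    by (simp add: abs_mult)
  also have "\<dots> \<le> real n * (U * (y - x)\<^sup>2)"
    unfolding u_def using U(7)[OF xy] by (intro mult_left_mono) auto
  also have "\<dots> = U * (real D)\<^sup>2 / real n"
    unfolding yx using n by (simp add: power2_eq_square)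
  finally have e: "\<bar>e\<bar> \<le> U * (real D)\<^sup>2 / real n" .
  have "(real D)\<^sup>2 \<le> 2\<^sup>2" using D by (intro power_mono) auto
  then have e4: "\<bar>e\<bar> \<le> 4 * U / real n"
    using e U(1) mult_left_mono[of "(real D)\<^sup>2" 4 U] divide_right_mono[of "U * (real D)\<^sup>2" "4 * U" "real n"]
    by simp
  have "4 * U / real n \<le> 4 * U" using n U(1) by (simp add: divide_le_eq)
  then have e4': "\<bar>e\<bar> \<le> 4 * U" using e4 by simp
  define A where "A = survival l n t Y"
  have A: "A = exp (- s * (real n * potential l x))" by (simp add: A_def survival_def s_def x_def)
  have "survival l n t (Y - D) = exp (- s * (real n * potential l y))"
    by (simp add: survival_def s_def y_def)
  also have "- s * (real n * potential l y)
      = - s * (real n * potential l x) + real D * s * u + - s * e"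
    by (simp add: e_def algebra_simps)
  finally have g: "survival l n t (Y - D) = A * exp (real D * s * u) * exp (- s * e)"
    unfolding A exp_add .
  show ?thesis
  proof (cases "D = 0")
    case False
    have "\<bar>survival l n t (Y - D) - A * exp (real D * s * u)\<bar>
        = A * exp (real D * s * u) * \<bar>exp (- s * e) - 1\<bar>"
    proof -
      have "survival l n t (Y - D) - A * exp (real D * s * u)
         = A * exp (real D * s * u) * (exp (- s * e) - 1)" unfolding g by (simp add: algebra_simps)
      then show ?thesis by (simp add: abs_mult A)
    qed
    also have "\<dots> \<le> A * exp (2 * S * U) * (s * (4 * U / real n) * exp (4 * S * U))"
    proof (intro mult_mono)
      have "real D * s * u \<le> 2 * S * U" using s u D by (intro mult_mono) auto
      then show "exp (real D * s * u) \<le> exp (2 * S * U)" by simp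
      have *: "\<bar>exp z - 1\<bar> \<le> \<bar>z\<bar> * exp \<bar>z\<bar>" for z :: real
      proof (cases "z \<ge> 0")
        case True
        then show ?thesis using exp_minus_one_le[of z] by simp
      next
        case False
        have "1 - exp z \<le> - z" using exp_ge_add_one_self[of z] by linarith
        also have "- z * 1 \<le> - z * exp (- z)" using False by (intro mult_left_mono) auto
        finally show ?thesis using False by simp
      qed
      have "\<bar>- s * e\<bar> = s * \<bar>e\<bar>" using s by (simp add: abs_mult)
      then have "\<bar>exp (- s * e) - 1\<bar> \<le> (s * \<bar>e\<bar>) * exp (s * \<bar>e\<bar>)" using *[of "- s * e"] by simp
      also have "\<dots> \<le> (s * (4 * U / real n)) * exp (4 * S * U)"
      proof (rule mult_mono)
        show "s * \<bar>e\<bar> \<le> s * (4 * U / real n)" using e4 s by (intro mult_left_mono) auto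
        have "s * \<bar>e\<bar> \<le> S * (4 * U)" using e4' s by (intro mult_mono) auto
        then show "exp (s * \<bar>e\<bar>) \<le> exp (4 * S * U)" by (simp add: mult_ac)
        show "0 \<le> s * (4 * U / real n)" using s U(1) by simp
      qed auto
      finally show "\<bar>exp (- s * e) - 1\<bar> \<le> s * (4 * U / real n) * exp (4 * S * U)" .
    qed (auto simp: A)
    also have "\<dots> = jump_const * A * (s / real n)" by (simp add: jump_const_def)
    finally show ?thesis using False by (simp add: A_def s_def u_def x_def)
  qed (simp add: g A A_def)
qed

definition (in survival_estimates) step_const :: real where
  "step_const = mean_const * (4 / b\<^sup>2 + 1 / b) + (jump_const + 2 * U * exp (2 * S * U)) * real l * (1 / b)"

text \<open>\<open>D\<close> is the actual drop caused by the outcome \<open>w\<close> and \<open>Dh\<close> the largest possible one. A smaller drop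
only makes \<open>survival\<close> smaller, which gives the upper bound for every strategy. The lower bound needs
\<open>D = Dh\<close> outside a set of relative size \<open>O(x / n)\<close>. All errors are multiples of \<open>(s * x)\<^sup>2 + s * x / n\<close>
with \<open>s = - ln (1 - t)\<close> times \<open>survival\<close>; with \<open>\<tau> = s * n * x\<close> this is \<open>(\<tau>\<^sup>2 + \<tau>) / n\<^sup>2\<close> times at most
\<open>exp (- b * \<tau>)\<close>, hence \<open>O(1 / n\<^sup>2)\<close>.\<close>

lemma (in survival_estimates) survival_average:
  fixes D Dh :: "'c \<Rightarrow> nat" and \<Omega> :: "'c set" and n Y :: nat
  assumes n: "n \<ge> 1" and Y: "Y \<le> n" and t: "0 \<le> t" "t < 1" and S: "- ln (1 - t) \<le> S" and fin: "finite \<Omega>"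
    and D: "\<And>w. w \<in> \<Omega> \<Longrightarrow> D w \<le> Dh w \<and> D w \<le> Y \<and> Dh w \<le> 2"
    and card: "\<And>d. d \<le> 2 \<Longrightarrow> real (card {w \<in> \<Omega>. Dh w = d}) = real (card \<Omega>) * jump_prob l (real Y / real n) d"
  shows "(\<Sum>w\<in>\<Omega>. survival l n t (Y - D w))
        \<le> real (card \<Omega>) * (survival l n (discount l n t) Y + step_const / (real n)\<^sup>2)"
    and "real (card {w \<in> \<Omega>. D w \<noteq> Dh w}) \<le> real (card \<Omega>) * (real l * (real Y / real n) / real n) \<Longrightarrow>
      real (card \<Omega>) * (survival l n (discount l n t) Y - step_const / (real n)\<^sup>2)
        \<le> (\<Sum>w\<in>\<Omega>. survival l n t (Y - D w))"
proof -
  define C3 where "C3 = 2 * U * exp (2 * S * U)"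
  have C3: "C3 \<ge> 0" using U(1) by (simp add: C3_def)
  have C2: "jump_const \<ge> 0" using U(1) by (simp add: jump_const_def)
  define s where "s = - ln (1 - t)"
  define x where "x = real Y / real n"
  define u where "u = potential' l x"
  define A where "A = survival l n t Y"
  define W where "W = real (card \<Omega>)"
  define F where "F d = A * exp (real d * s * u)" for d :: nat
  have s: "0 \<le> s" "s \<le> S" using t S by (auto simp: s_def)
  have x: "x \<in> {0..1}" using n Y by (auto simp: x_def divide_simps)
  have u: "0 \<le> u" "u \<le> U" using U x by (auto simp: u_def)
  have A0: "0 < A" by (simp add: A_def survival_def)
  have W0: "0 \<le> W" by (simp add: W_def)
  define \<tau> where "\<tau> = s * real n * x"
  have \<tau>: "\<tau> \<ge> 0" using s x by (simp add: \<tau>_def)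
  have A_le: "A \<le> exp (- b * \<tau>)"
  proof -
    have "s * (real n * (b * x)) \<le> s * (real n * potential l x)"
      using b x s by (intro mult_left_mono) auto
    moreover have "A = exp (- (s * (real n * potential l x)))"
      by (simp add: A_def survival_def s_def x_def)
    moreover have "- b * \<tau> = - (s * (real n * (b * x)))" by (simp add: \<tau>_def)
    ultimately show ?thesis by (simp only: exp_le_cancel_iff neg_le_iff_le)
  qed
  have A1: "A * \<tau> \<le> 1 / b"
    using mult_right_mono[OF A_le \<tau>] mult_exp_neg_le(1)[OF b(1) \<tau>] by (simp add: mult.commute)
  have A2: "A * \<tau>\<^sup>2 \<le> 4 / b\<^sup>2"
    using mult_right_mono[OF A_le, of "\<tau>\<^sup>2"] mult_exp_neg_le(2)[OF b(1) \<tau>] by (simp add: mult.commute)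
  have sx: "s * x = \<tau> / real n" using n by (simp add: \<tau>_def)
  have sumF: "(\<Sum>w\<in>\<Omega>. F (Dh w)) = W * (F 0 * jump_prob l x 0 + F 1 * jump_prob l x 1 + F 2 * jump_prob l x 2)"
  proof -
    have "(\<Sum>w\<in>\<Omega>. F (Dh w)) = (\<Sum>d\<in>{0,1,2}. \<Sum>w\<in>{w \<in> \<Omega>. Dh w = d}. F (Dh w))"
      using D by (intro sum.group[symmetric] fin) force+
    also have "\<dots> = (\<Sum>d\<in>{0,1,2}. real (card {w \<in> \<Omega>. Dh w = d}) * F d)"
      by (intro sum.cong refl) simp
    also have "\<dots> = (\<Sum>d\<in>{0,1,2}. W * jump_prob l x d * F d)"
      by (intro sum.cong refl) (auto simp: card W_def x_def)
    finally show ?thesis by (simp add: algebra_simps)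
  qed
  define m where "m = F 0 * jump_prob l x 0 + F 1 * jump_prob l x 1 + F 2 * jump_prob l x 2"
  define g where "g = survival l n (discount l n t) Y"
  have g: "g = A * exp ((- ln (1 - t) + ln (1 - discount l n t)) * (real n * potential l x))"
    by (simp add: g_def A_def survival_def x_def algebra_simps flip: exp_add)
  have "m - g = A * (mean_factor l x (- ln (1 - t))
      - exp ((- ln (1 - t) + ln (1 - discount l n t)) * (real n * potential l x)))"
    unfolding g m_def F_def s_def u_def mean_factor_def by (simp add: algebra_simps)
  then have "\<bar>m - g\<bar> \<le> A * (mean_const * ((s * x)\<^sup>2 + s * x / real n))"
    using mean_factor_error[OF n x t S] A0 by (simp add: abs_mult s_def)
  also have "\<dots> = mean_const * (A * \<tau>\<^sup>2 + A * \<tau>) / (real n)\<^sup>2"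
    unfolding sx by (simp add: power2_eq_square add_divide_distrib algebra_simps)
  also have "\<dots> \<le> mean_const * (4 / b\<^sup>2 + 1 / b) / (real n)\<^sup>2"
    using A1 A2 mean_const_nonneg by (intro divide_right_mono mult_left_mono add_mono) auto
  finally have mg: "\<bar>m - g\<bar> \<le> mean_const * (4 / b\<^sup>2 + 1 / b) / (real n)\<^sup>2" .
  define B where "B = {w \<in> \<Omega>. Dh w \<noteq> 0}"
  have cB: "real (card B) \<le> W * (real l * x)"
  proof -
    have "real (card {w \<in> \<Omega>. Dh w = 0}) + real (card B) = W"
      using fin unfolding W_def B_def of_nat_add[symmetric]
      by (subst card_Un_disjoint[symmetric]) (auto intro!: arg_cong[of _ _ card])
    then have "real (card B) = W * (1 - jump_prob l x 0)"
      using card[of 0] by (simp add: W_def x_def algebra_simps)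
    also have "\<dots> \<le> W * (real l * x)"
      using one_minus_power_le[OF x, of l] W0 by (intro mult_left_mono) (simp_all add: jump_prob_def)
    finally show ?thesis .
  qed
  have sn: "0 \<le> jump_const * A * (s / real n)" using C2 A0 s by simp
  have err: "(real (card \<Omega>') :: real) * (C' * A * (s / real n)) \<le> W * (C' * real l * (1 / b) / (real n)\<^sup>2)"
    if c': "real (card \<Omega>') \<le> W * (real l * x / k)" and C': "C' \<ge> 0" and k: "k \<ge> 1"
    for \<Omega>' :: "'c set" and C' k :: real
  proof -
    have "W * (real l * x / k) \<le> W * (real l * x / 1)"
      using k W0 x by (intro mult_left_mono divide_left_mono) auto
    then have c: "real (card \<Omega>') \<le> W * (real l * x)" using c' by simp
    have "real (card \<Omega>') * (C' * A * (s / real n)) \<le> (W * (real l * x)) * (C' * A * (s / real n))"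
      using c C' A0 s by (intro mult_right_mono) auto
    also have "\<dots> = W * (C' * real l * (A * \<tau>) / (real n)\<^sup>2)"
      using n by (simp add: \<tau>_def power2_eq_square field_simps)
    also have "\<dots> \<le> W * (C' * real l * (1 / b) / (real n)\<^sup>2)"
      using A1 C' W0 by (intro mult_left_mono divide_right_mono) auto
    finally show ?thesis .
  qed
  have jump: "\<bar>survival l n t (Y - D w) - F (D w)\<bar> \<le> (if w \<in> B then jump_const * A * (s / real n) else 0)"
    if w: "w \<in> \<Omega>" for w
  proof -
    have "\<bar>survival l n t (Y - D w) - F (D w)\<bar> \<le> (if D w = 0 then 0 else jump_const * A * (s / real n))"
      using survival_jump_error[OF n Y _ _ t S, of "D w"] D[OF w] unfolding F_def A_def s_def u_def x_def by linarith
    also have "\<dots> \<le> (if w \<in> B then jump_const * A * (s / real n) else 0)"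
      using D[OF w] w sn by (auto simp: B_def)
    finally show ?thesis .
  qed
  have sumB: "(\<Sum>w\<in>\<Omega>. if w \<in> B then jump_const * A * (s / real n) else 0) \<le> W * (jump_const * real l * (1 / b) / (real n)\<^sup>2)"
  proof -
    have "(\<Sum>w\<in>\<Omega>. if w \<in> B then jump_const * A * (s / real n) else 0) = real (card B) * (jump_const * A * (s / real n))"
      using fin by (subst sum.inter_restrict[symmetric]) (auto simp: B_def Int_def)
    also have "\<dots> \<le> W * (jump_const * real l * (1 / b) / (real n)\<^sup>2)"
      using err[of B 1 jump_const] cB C2 by simp
    finally show ?thesis .
  qed
  have Fmono: "F (D w) \<le> F (Dh w)" if "w \<in> \<Omega>" for w
    unfolding F_def using D[OF that] s u A0 by (auto intro!: mult_right_mono simp: mult.assoc)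
  have n2: "C3 * real l * (1 / b) / (real n)\<^sup>2 \<ge> 0" "jump_const * real l * (1 / b) / (real n)\<^sup>2 \<ge> 0"
    using C3 C2 b by auto
  have CstE: "step_const / (real n)\<^sup>2 = mean_const * (4 / b\<^sup>2 + 1 / b) / (real n)\<^sup>2
      + jump_const * real l * (1 / b) / (real n)\<^sup>2 + C3 * real l * (1 / b) / (real n)\<^sup>2"
    by (simp add: step_const_def C3_def add_divide_distrib distrib_right)
  have "(\<Sum>w\<in>\<Omega>. survival l n t (Y - D w)) \<le> (\<Sum>w\<in>\<Omega>. F (Dh w) + (if w \<in> B then jump_const * A * (s / real n) else 0))"
  proof (rule sum_mono)
    fix w assume w: "w \<in> \<Omega>"
    show "survival l n t (Y - D w) \<le> F (Dh w) + (if w \<in> B then jump_const * A * (s / real n) else 0)"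
      using jump[OF w] Fmono[OF w] by linarith
  qed
  also have "\<dots> \<le> W * m + W * (jump_const * real l * (1 / b) / (real n)\<^sup>2)"
    unfolding sum.distrib sumF m_def using sumB by simp
  also have "\<dots> = W * (m + jump_const * real l * (1 / b) / (real n)\<^sup>2)" by (simp add: algebra_simps)
  also have "\<dots> \<le> W * (g + step_const / (real n)\<^sup>2)"
    using mg W0 n2 CstE by (intro mult_left_mono) linarith+
  finally have upper: "(\<Sum>w\<in>\<Omega>. survival l n t (Y - D w)) \<le> W * (g + step_const / (real n)\<^sup>2)" .
  have lower: "(\<Sum>w\<in>\<Omega>. survival l n t (Y - D w)) \<ge> W * (g - step_const / (real n)\<^sup>2)"
    if bad: "real (card {w \<in> \<Omega>. D w \<noteq> Dh w}) \<le> real (card \<Omega>) * (real l * (real Y / real n) / real n)"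
  proof -
    define L where "L = {w \<in> \<Omega>. D w \<noteq> Dh w}"
    have FD: "F (D w) \<ge> F (Dh w) - (if w \<in> L then C3 * A * s else 0)" if w: "w \<in> \<Omega>" for w
    proof (cases "w \<in> L")
      case True
      have "real (Dh w) * s * u \<le> 2 * s * U" using s u D[OF w] by (intro mult_mono) auto
      moreover have "2 * s * U \<le> 2 * S * U" using s U by (intro mult_right_mono) auto
      moreover have z0: "0 \<le> real (Dh w) * s * u" using s u by simp
      moreover have "0 \<le> 2 * s * U" using s U by simp
      ultimately have "(real (Dh w) * s * u) * exp (real (Dh w) * s * u) \<le> (2 * s * U) * exp (2 * S * U)"
        by (intro mult_mono[of "real (Dh w) * s * u"]) auto
      then have "exp (real (Dh w) * s * u) - 1 \<le> (2 * s * U) * exp (2 * S * U)"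
        using exp_minus_one_le[of "real (Dh w) * s * u"] by linarith
      then have "A * (exp (real (Dh w) * s * u) - 1) \<le> A * ((2 * s * U) * exp (2 * S * U))"
        using A0 by (intro mult_left_mono) auto
      moreover have "A * 1 \<le> F (D w)" unfolding F_def using A0 s u by (intro mult_left_mono) auto
      ultimately show ?thesis using True by (simp add: F_def C3_def algebra_simps)
    qed (use w in \<open>auto simp: L_def\<close>)
    have "(\<Sum>w\<in>\<Omega>. if w \<in> L then C3 * A * s else 0) = real (card L) * (C3 * A * s)"
      using fin by (subst sum.inter_restrict[symmetric]) (auto simp: L_def Int_def)
    also have "\<dots> \<le> W * (C3 * real l * (1 / b) / (real n)\<^sup>2)"
    proof -
      have "real (card L) * (C3 * A * s) \<le> (W * (real l * x / real n)) * (C3 * A * s)"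
        using bad C3 A0 s by (intro mult_right_mono) (auto simp: L_def W_def x_def)
      also have "\<dots> = W * (C3 * real l * (A * \<tau>) / (real n)\<^sup>2)"
        using n by (simp add: \<tau>_def power2_eq_square field_simps)
      also have "\<dots> \<le> W * (C3 * real l * (1 / b) / (real n)\<^sup>2)"
        using A1 C3 W0 by (intro mult_left_mono divide_right_mono) auto
      finally show ?thesis .
    qed
    finally have sumL: "(\<Sum>w\<in>\<Omega>. if w \<in> L then C3 * A * s else 0) \<le> \<dots>" .
    have "W * (g - step_const / (real n)\<^sup>2)
        \<le> W * (m - jump_const * real l * (1 / b) / (real n)\<^sup>2 - C3 * real l * (1 / b) / (real n)\<^sup>2)"
      using mg W0 n2 CstE by (intro mult_left_mono) linarith+
    also have "\<dots> \<le> (\<Sum>w\<in>\<Omega>. F (Dh w) - (if w \<in> L then C3 * A * s else 0)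
        - (if w \<in> B then jump_const * A * (s / real n) else 0))"
      unfolding sum_subtractf sumF m_def[symmetric] using sumB sumL
      unfolding right_diff_distrib by linarith
    also have "\<dots> \<le> (\<Sum>w\<in>\<Omega>. survival l n t (Y - D w))"
    proof (rule sum_mono)
      fix w assume w: "w \<in> \<Omega>"
      show "F (Dh w) - (if w \<in> L then C3 * A * s else 0) - (if w \<in> B then jump_const * A * (s / real n) else 0)
         \<le> survival l n t (Y - D w)"
        using jump[OF w] FD[OF w] by linarith
    qed
    finally show ?thesis .
  qed
  show "(\<Sum>w\<in>\<Omega>. survival l n t (Y - D w))
      \<le> real (card \<Omega>) * (survival l n (discount l n t) Y + step_const / (real n)\<^sup>2)"
    using upper by (simp add: W_def g_def)
  show "real (card {w \<in> \<Omega>. D w \<noteq> Dh w}) \<le> real (card \<Omega>) * (real l * (real Y / real n) / real n) \<Longrightarrow>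
    real (card \<Omega>) * (survival l n (discount l n t) Y - step_const / (real n)\<^sup>2)
      \<le> (\<Sum>w\<in>\<Omega>. survival l n t (Y - D w))"
    using lower by (simp add: W_def g_def)
qed


section \<open>Graphs and histories\<close>

definition add_edge :: "nat set set \<Rightarrow> nat \<Rightarrow> nat \<Rightarrow> nat set set" where
  "add_edge E v w = (if v = w then E else insert {v, w} E)"

definition next_graph :: "nat set set \<Rightarrow> nat list \<Rightarrow> nat \<Rightarrow> nat set set" where
  "next_graph E vs i = add_edge E (vs ! (2 * i)) (vs ! (2 * i + 1))"

definition simple_graphs :: "nat \<Rightarrow> nat set set set" where
  "simple_graphs n = Pow {{v, w} | v w. v \<in> {1..n} \<and> w \<in> {1..n} \<and> v \<noteq> w}"

text \<open>The graph built by a list of draws and choices. Since the graph is a function of the history, it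
is independent of the next draw.\<close>

definition graph_of :: "(nat list \<times> nat) list \<Rightarrow> nat set set" where
  "graph_of h = (\<Union>k<length h. add_edge {} (fst (h ! k) ! (2 * snd (h ! k))) (fst (h ! k) ! (2 * snd (h ! k) + 1)))"

lemma graph_after_UN:
  "graph_after V C N \<omega> = (\<Union>k<N. add_edge {} (V k \<omega> ! (2 * C k \<omega>)) (V k \<omega> ! (2 * C k \<omega> + 1)))"
  unfolding graph_after_def add_edge_def by (auto split: if_splits)

lemma graph_after_eq: "k \<le> N \<Longrightarrow> graph_after V C k \<omega> = graph_of (take k (history V C N \<omega>))"
  unfolding graph_after_UN graph_of_def by (simp add: history_def)

lemma graph_after_eq': "graph_after V C N \<omega> = graph_of (history V C N \<omega>)"
  unfolding graph_after_UN graph_of_def by (simp add: history_def)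

lemma graph_after_0: "graph_after V C 0 \<omega> = {}"
  by (simp add: graph_after_def)

lemma graph_after_Suc:
  "graph_after V C (Suc N) \<omega> = next_graph (graph_after V C N \<omega>) (V N \<omega>) (C N \<omega>)"
  unfolding graph_after_UN next_graph_def lessThan_Suc by (simp add: add_edge_def)

lemma graph_after_mono: "N \<le> N' \<Longrightarrow> graph_after V C N \<omega> \<subseteq> graph_after V C N' \<omega>"
  unfolding graph_after_UN by (intro UN_mono) auto

lemma vertex_tuples_nth: "vs \<in> vertex_tuples l n \<Longrightarrow> p < l \<Longrightarrow> vs ! p \<in> {1..n}"
  unfolding vertex_tuples_def using nth_mem by blast

lemma next_graph_simple:
  assumes "E \<in> simple_graphs n" "vs \<in> vertex_tuples l n" "i < l div 2"
  shows "next_graph E vs i \<in> simple_graphs n"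
proof -
  have "vs ! (2 * i) \<in> set vs" "vs ! (2 * i + 1) \<in> set vs"
    using assms by (auto simp: vertex_tuples_def)
  then have "vs ! (2 * i) \<in> {1..n}" "vs ! (2 * i + 1) \<in> {1..n}"
    using assms(2) by (auto simp: vertex_tuples_def)
  then show ?thesis using assms(1)
    unfolding next_graph_def add_edge_def simple_graphs_def by simp blast
qed

lemma finite_vertex_tuples: "finite (vertex_tuples l n)"
  using finite_lists_length_eq[of "{1..n}" l] by (simp add: vertex_tuples_def conj_commute)

lemma card_vertex_tuples: "card (vertex_tuples l n) = n ^ l"
  using card_lists_length_eq[of "{1..n}" l] by (simp add: vertex_tuples_def conj_commute)

section \<open>Averaging over the next draw\<close>

lemma expectation_of_bool: "integral\<^sup>L M (\<lambda>\<omega>. of_bool (P \<omega>) :: real) = \<P>(\<omega> in M. P \<omega>)"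
proof -
  have "integral\<^sup>L M (\<lambda>\<omega>. of_bool (P \<omega>) :: real) = integral\<^sup>L M (indicator {\<omega> \<in> space M. P \<omega>})"
    by (intro Bochner_Integration.integral_cong) (auto simp: indicator_def)
  then show ?thesis by (simp add: Int_absorb2 subset_iff)
qed

locale achlioptas = prob_space M for M :: "'a measure" +
  fixes l n :: nat and V :: "nat \<Rightarrow> 'a \<Rightarrow> nat list" and C :: "nat \<Rightarrow> 'a \<Rightarrow> nat"
  assumes process: "achlioptas_process l n M V C" and n_pos: "n \<ge> 1"
    and l_ge_2: "l \<ge> 2" and l_even: "even l"

lemma achlioptas_intro:
  "achlioptas_process l n M V C \<Longrightarrow> n \<ge> 1 \<Longrightarrow> l \<ge> 2 \<Longrightarrow> even l \<Longrightarrow> achlioptas M l n V C"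
  by (simp add: achlioptas_def achlioptas_axioms_def achlioptas_process_def)

context achlioptas
begin

lemma V_tuple: "\<omega> \<in> space M \<Longrightarrow> V N \<omega> \<in> vertex_tuples l n"
  using process measurable_space[of "V N" M "count_space (vertex_tuples l n)" \<omega>]
  by (simp add: achlioptas_process_def)

lemma C_less: "\<omega> \<in> space M \<Longrightarrow> C N \<omega> < l div 2"
  using process measurable_space[of "C N" M "count_space {..<l div 2}" \<omega>]
  by (simp add: achlioptas_process_def)

lemma graph_after_simple: "\<omega> \<in> space M \<Longrightarrow> graph_after V C N \<omega> \<in> simple_graphs n"
proof (induction N)
  case 0
  then show ?case by (simp add: graph_after_0 simple_graphs_def)
next
  case (Suc N)
  then show ?case unfolding graph_after_Suc
    by (intro next_graph_simple[OF _ V_tuple C_less]) auto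
qed

lemma prob_V:
  assumes "vs \<in> vertex_tuples l n"
  shows "prob (V N -` {vs} \<inter> space M) = 1 / real n ^ l"
proof -
  let ?T = "vertex_tuples l n"
  have V: "V N \<in> M \<rightarrow>\<^sub>M count_space ?T"
    and D: "distr M (count_space ?T) (V N) = uniform_count_measure ?T"
    using process by (auto simp: achlioptas_process_def)
  have "prob (V N -` {vs} \<inter> space M) = measure (distr M (count_space ?T) (V N)) {vs}"
    using V assms by (simp add: measure_distr)
  also have "\<dots> = 1 / real n ^ l"
    unfolding D using assms measure_uniform_count_measure[OF finite_vertex_tuples, of "{vs}" l n]
    by (simp add: card_vertex_tuples)
  finally show ?thesis .
qed

lemma history_event: "history V C N -` B \<inter> space M \<in> events"
  and draw_indep: "A \<subseteq> vertex_tuples l n \<Longrightarrow>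
    prob ((V N -` A \<inter> space M) \<inter> (history V C N -` B \<inter> space M))
    = prob (V N -` A \<inter> space M) * prob (history V C N -` B \<inter> space M)"
proof -
  have I: "indep_set ((\<lambda>A. V N -` A \<inter> space M) ` Pow (vertex_tuples l n))
       (range (\<lambda>B. history V C N -` B \<inter> space M))"
    using process by (simp add: achlioptas_process_def)
  show "history V C N -` B \<inter> space M \<in> events"
    using indep_setD_ev2[OF I] by blast
  show "A \<subseteq> vertex_tuples l n \<Longrightarrow>
    prob ((V N -` A \<inter> space M) \<inter> (history V C N -` B \<inter> space M))
    = prob (V N -` A \<inter> space M) * prob (history V C N -` B \<inter> space M)"
    by (intro indep_setD[OF I]) auto
qed

lemma measurable_history [measurable]: "history V C N \<in> M \<rightarrow>\<^sub>M count_space UNIV"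
  using history_event by (auto simp: measurable_def)

lemma measurable_graph_after [measurable]: "graph_after V C N \<in> M \<rightarrow>\<^sub>M count_space UNIV"
proof -
  have "(\<lambda>\<omega>. graph_of (history V C N \<omega>)) \<in> M \<rightarrow>\<^sub>M count_space UNIV" by measurable
  then show ?thesis by (simp add: graph_after_eq'[abs_def])
qed

definition histories :: "nat \<Rightarrow> (nat list \<times> nat) list set" where
  "histories N = {h. set h \<subseteq> vertex_tuples l n \<times> {..<l div 2} \<and> length h = N}"

lemma finite_histories: "finite (histories N)"
  unfolding histories_def using finite_vertex_tuples by (intro finite_lists_length_eq) auto

lemma history_in: "\<omega> \<in> space M \<Longrightarrow> history V C N \<omega> \<in> histories N"
  using V_tuple C_less by (auto simp: histories_def history_def)

lemma integrable_history: "integrable M (\<lambda>\<omega>. F (history V C N \<omega>) :: real)"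
proof (rule integrable_const_bound)
  show "AE \<omega> in M. norm (F (history V C N \<omega>)) \<le> (\<Sum>h\<in>histories N. \<bar>F h\<bar>)"
    using history_in finite_histories
    by (intro AE_I2) (auto intro!: member_le_sum[of _ _ "\<lambda>h. \<bar>F h\<bar>"])
  have "(\<lambda>\<omega>. F (history V C N \<omega>)) \<in> M \<rightarrow>\<^sub>M borel"
    using measurable_history by (rule measurable_compose) auto
  then show "(\<lambda>\<omega>. F (history V C N \<omega>)) \<in> borel_measurable M" .
qed

lemma integrable_graph: "integrable M (\<lambda>\<omega>. F (graph_after V C N \<omega>) :: real)"
  unfolding graph_after_eq' by (rule integrable_history)

lemma graph_event: "{\<omega> \<in> space M. P (graph_after V C N \<omega>)} \<in> events"
proof -
  have "{\<omega> \<in> space M. P (graph_after V C N \<omega>)} = graph_after V C N -` {E. P E} \<inter> space M" by auto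
  then show ?thesis using measurable_sets[OF measurable_graph_after, of "{E. P E}"] by simp
qed

lemma expectation_history:
  "expectation (\<lambda>\<omega>. F (history V C N \<omega>)) =
     (\<Sum>h\<in>histories N. F h * prob (history V C N -` {h} \<inter> space M))" for F :: "_ \<Rightarrow> real"
proof -
  have "expectation (\<lambda>\<omega>. F (history V C N \<omega>))
     = expectation (\<lambda>\<omega>. \<Sum>h\<in>histories N. F h * indicator (history V C N -` {h} \<inter> space M) \<omega>)"
  proof (rule Bochner_Integration.integral_cong[OF refl])
    fix \<omega> assume w: "\<omega> \<in> space M"
    have "(\<Sum>h\<in>histories N. F h * indicator (history V C N -` {h} \<inter> space M) \<omega>)
       = (\<Sum>h\<in>histories N. if h = history V C N \<omega> then F h else 0)"
      using w by (intro sum.cong) (auto simp: indicator_def)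
    then show "F (history V C N \<omega>)
       = (\<Sum>h\<in>histories N. F h * indicator (history V C N -` {h} \<inter> space M) \<omega>)"
      using history_in[OF w] finite_histories by simp
  qed
  also have "\<dots> = (\<Sum>h\<in>histories N. expectation (\<lambda>\<omega>. F h * indicator (history V C N -` {h} \<inter> space M) \<omega>))"
    using history_event by (intro Bochner_Integration.integral_sum integrable_mult_right) (auto simp: emeasure_eq_measure)
  finally show ?thesis using history_event by simp
qed

text \<open>The next tuple is uniform and independent of the history, and both take finitely many values, so
conditioning on the history is a finite sum.\<close>

lemma expectation_draw:
  fixes G :: "(nat list \<times> nat) list \<Rightarrow> nat list \<Rightarrow> real"
  shows "expectation (\<lambda>\<omega>. G (history V C N \<omega>) (V N \<omega>))
    = expectation (\<lambda>\<omega>. (\<Sum>vs\<in>vertex_tuples l n. G (history V C N \<omega>) vs) / real n ^ l)"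
proof -
  let ?T = "vertex_tuples l n"
  let ?A = "\<lambda>h vs. (V N -` {vs} \<inter> space M) \<inter> (history V C N -` {h} \<inter> space M)"
  have V: "V N \<in> M \<rightarrow>\<^sub>M count_space ?T" using process by (auto simp: achlioptas_process_def)
  have ev: "?A h vs \<in> events" if "vs \<in> ?T" for h vs
    using history_event measurable_sets[OF V, of "{vs}"] that by auto
  have "expectation (\<lambda>\<omega>. G (history V C N \<omega>) (V N \<omega>))
     = expectation (\<lambda>\<omega>. \<Sum>h\<in>histories N. \<Sum>vs\<in>?T. G h vs * indicator (?A h vs) \<omega>)"
  proof (rule Bochner_Integration.integral_cong[OF refl])
    fix \<omega> assume w: "\<omega> \<in> space M"
    have "(\<Sum>h\<in>histories N. \<Sum>vs\<in>?T. G h vs * indicator (?A h vs) \<omega>)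
       = (\<Sum>h\<in>histories N. if h = history V C N \<omega> then \<Sum>vs\<in>?T. G h vs * indicator {V N \<omega>} vs else 0)"
      using w by (intro sum.cong refl) (auto simp: indicator_def intro!: sum.cong sum.neutral)
    also have "\<dots> = (\<Sum>vs\<in>?T. G (history V C N \<omega>) vs * indicator {V N \<omega>} vs)"
      using history_in[OF w] finite_histories by simp
    also have "\<dots> = (\<Sum>vs\<in>?T. if vs = V N \<omega> then G (history V C N \<omega>) vs else 0)"
      by (intro sum.cong) (auto simp: indicator_def)
    also have "\<dots> = G (history V C N \<omega>) (V N \<omega>)"
      using V_tuple[OF w] finite_vertex_tuples by simp
    finally show "G (history V C N \<omega>) (V N \<omega>)
       = (\<Sum>h\<in>histories N. \<Sum>vs\<in>?T. G h vs * indicator (?A h vs) \<omega>)" ..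
  qed
  also have "\<dots> = (\<Sum>h\<in>histories N. \<Sum>vs\<in>?T. G h vs * prob (?A h vs))"
    using ev by (simp add: Bochner_Integration.integral_sum integrable_mult_right emeasure_eq_measure
        Bochner_Integration.integrable_sum)
  also have "\<dots> = (\<Sum>h\<in>histories N. (\<Sum>vs\<in>?T. G h vs) / real n ^ l * prob (history V C N -` {h} \<inter> space M))"
    by (intro sum.cong refl)
      (simp add: draw_indep prob_V sum_divide_distrib sum_distrib_right)
  also have "\<dots> = expectation (\<lambda>\<omega>. (\<Sum>vs\<in>?T. G (history V C N \<omega>) vs) / real n ^ l)"
    by (rule expectation_history[symmetric])
  finally show ?thesis .
qed

text \<open>All drift arguments use this form. The function \<open>G\<close> removes the choice of the current round, which
may depend on extra randomness, before the tuple is averaged out.\<close>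

lemma expectation_step_le:
  fixes F H :: "(nat list \<times> nat) list \<Rightarrow> real"
  assumes step: "\<And>\<omega>. \<omega> \<in> space M \<Longrightarrow> F (history V C (Suc N) \<omega>) \<le> G (history V C N \<omega>) (V N \<omega>)"
    and avg: "\<And>\<omega>. \<omega> \<in> space M \<Longrightarrow>
      (\<Sum>vs\<in>vertex_tuples l n. G (history V C N \<omega>) vs) \<le> real n ^ l * H (history V C N \<omega>)"
  shows "expectation (\<lambda>\<omega>. F (history V C (Suc N) \<omega>)) \<le> expectation (\<lambda>\<omega>. H (history V C N \<omega>))"
proof -
  have GI: "integrable M (\<lambda>\<omega>. G (history V C N \<omega>) (V N \<omega>))"
  proof -
    have "integrable M (\<lambda>\<omega>. (\<lambda>h. G (butlast h) (fst (last h))) (history V C (Suc N) \<omega>))"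
      by (rule integrable_history)
    then show ?thesis by (simp add: history_def)
  qed
  have "expectation (\<lambda>\<omega>. F (history V C (Suc N) \<omega>)) \<le> expectation (\<lambda>\<omega>. G (history V C N \<omega>) (V N \<omega>))"
    using step by (intro integral_mono integrable_history GI)
  also have "\<dots> = expectation (\<lambda>\<omega>. (\<Sum>vs\<in>vertex_tuples l n. G (history V C N \<omega>) vs) / real n ^ l)"
    by (rule expectation_draw)
  also have "\<dots> \<le> expectation (\<lambda>\<omega>. H (history V C N \<omega>))"
  proof (rule integral_mono)
    show "integrable M (\<lambda>\<omega>. (\<Sum>vs\<in>vertex_tuples l n. G (history V C N \<omega>) vs) / real n ^ l)"
      by (rule integrable_history[of "\<lambda>h. (\<Sum>vs\<in>vertex_tuples l n. G h vs) / real n ^ l"])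
  qed (use avg n_pos in \<open>auto intro: integrable_history simp: divide_le_eq mult.commute\<close>)
  finally show ?thesis .
qed

end

section \<open>Counting tuples\<close>

text \<open>Splitting off the first two entries turns pairwise conditions on a tuple into a product.\<close>

lemma card_pair_tuples:
  "card {vs. length vs = 2 * m \<and> (\<forall>i<m. (vs ! (2 * i), vs ! (2 * i + 1)) \<in> S i)} = (\<Prod>i<m. card (S i))"
proof (induction m arbitrary: S)
  case 0
  have "{vs. length vs = 2 * 0 \<and> (\<forall>i<0. (vs ! (2 * i), vs ! (2 * i + 1)) \<in> S i)} = {[]}"
    by auto
  then show ?case by simp
next
  case (Suc m)
  let ?T = "\<lambda>m S. {vs. length vs = 2 * m \<and> (\<forall>i<m. (vs ! (2 * i), vs ! (2 * i + 1)) \<in> S i)}"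
  let ?f = "\<lambda>((v, w), vs). v # w # vs"
  have "?T (Suc m) S = ?f ` (S 0 \<times> ?T m (\<lambda>i. S (Suc i)))"
  proof (intro equalityI subsetI)
    fix us assume us: "us \<in> ?T (Suc m) S"
    then have "length us = Suc (Suc (2 * m))" by simp
    then obtain v w vs where [simp]: "us = v # w # vs" and len: "length vs = 2 * m"
      by (auto simp: length_Suc_conv)
    have S: "(us ! (2 * i), us ! (2 * i + 1)) \<in> S i" if "i < Suc m" for i using us that by blast
    have "(v, w) \<in> S 0" using S[of 0] by simp
    moreover have "(vs ! (2 * i), vs ! (2 * i + 1)) \<in> S (Suc i)" if "i < m" for i
      using S[of "Suc i"] that by simp
    then have "vs \<in> ?T m (\<lambda>i. S (Suc i))" using len by simp
    ultimately have "((v, w), vs) \<in> S 0 \<times> ?T m (\<lambda>i. S (Suc i))" by simp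
    then show "us \<in> ?f ` (S 0 \<times> ?T m (\<lambda>i. S (Suc i)))" by (rule rev_image_eqI) simp
  next
    fix us assume "us \<in> ?f ` (S 0 \<times> ?T m (\<lambda>i. S (Suc i)))"
    then obtain v w vs where us: "us = v # w # vs" "(v, w) \<in> S 0" "vs \<in> ?T m (\<lambda>i. S (Suc i))" by auto
    have "(us ! (2 * i), us ! (2 * i + 1)) \<in> S i" if "i < Suc m" for i
      using us that by (cases i) auto
    then show "us \<in> ?T (Suc m) S" using us by simp
  qed
  moreover have "inj_on ?f (S 0 \<times> ?T m (\<lambda>i. S (Suc i)))" by (auto simp: inj_on_def)
  ultimately have "card (?T (Suc m) S) = card (S 0) * card (?T m (\<lambda>i. S (Suc i)))"
    by (simp only: card_image card_cartesian_product)
  then show ?case using Suc.IH[of "\<lambda>i. S (Suc i)"] by (simp add: prod.lessThan_Suc_shift del: prod.lessThan_Suc)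
qed

lemma set_subset_iff_pairs:
  assumes "length vs = 2 * m"
  shows "set vs \<subseteq> A \<longleftrightarrow> (\<forall>i<m. (vs ! (2 * i), vs ! (2 * i + 1)) \<in> A \<times> A)"
proof
  assume "set vs \<subseteq> A"
  then show "\<forall>i<m. (vs ! (2 * i), vs ! (2 * i + 1)) \<in> A \<times> A"
    using assms nth_mem[of _ vs] by (simp add: subset_iff)
next
  assume A: "\<forall>i<m. (vs ! (2 * i), vs ! (2 * i + 1)) \<in> A \<times> A"
  have "vs ! p \<in> A" if "p < 2 * m" for p
  proof (cases "even p")
    case True
    then show ?thesis using A that by (auto elim!: evenE)
  next
    case False
    then obtain i where "p = 2 * i + 1" by (elim oddE)
    then show ?thesis using A that by auto
  qed
  then show "set vs \<subseteq> A" using assms by (auto simp: set_conv_nth)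
qed

lemma card_vertex_tuples_pairs:
  assumes "even l" "\<And>i. i < l div 2 \<Longrightarrow> S i \<subseteq> {1..n} \<times> {1..n}"
  shows "card {vs \<in> vertex_tuples l n. \<forall>i<l div 2. (vs ! (2 * i), vs ! (2 * i + 1)) \<in> S i}
    = (\<Prod>i<l div 2. card (S i))"
proof -
  have l: "l = 2 * (l div 2)" using assms by simp
  have "vs \<in> vertex_tuples l n \<and> (\<forall>i<l div 2. (vs ! (2 * i), vs ! (2 * i + 1)) \<in> S i)
     \<longleftrightarrow> length vs = 2 * (l div 2) \<and> (\<forall>i<l div 2. (vs ! (2 * i), vs ! (2 * i + 1)) \<in> S i)" for vs
  proof -
    have "set vs \<subseteq> {1..n}" if "length vs = 2 * (l div 2)"
      "\<forall>i<l div 2. (vs ! (2 * i), vs ! (2 * i + 1)) \<in> S i"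
      unfolding set_subset_iff_pairs[OF that(1)] using that(2) assms(2) by blast
    then show ?thesis unfolding vertex_tuples_def using assms(1) by auto
  qed
  then show ?thesis using card_pair_tuples[of "l div 2" S] by simp
qed

lemma card_one_pair:
  assumes l: "even l" and i: "i < l div 2" and A: "A \<subseteq> {1..n} \<times> {1..n}" and D: "D \<subseteq> {1..n}"
  shows "card {vs \<in> vertex_tuples l n. \<forall>j<l div 2.
      (vs ! (2 * j), vs ! (2 * j + 1)) \<in> (if j = i then A else D \<times> D)} = card A * card D ^ (l - 2)"
proof -
  let ?S = "\<lambda>j. if j = i then A else D \<times> D"
  have "card {vs \<in> vertex_tuples l n. \<forall>j<l div 2. (vs ! (2 * j), vs ! (2 * j + 1)) \<in> ?S j}
      = (\<Prod>j<l div 2. card (?S j))"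
    using A D by (intro card_vertex_tuples_pairs l) auto
  also have "\<dots> = card (?S i) * (\<Prod>j\<in>{..<l div 2} - {i}. card (?S j))"
    using i by (subst prod.remove[of _ i]) auto
  also have "(\<Prod>j\<in>{..<l div 2} - {i}. card (?S j)) = (\<Prod>j\<in>{..<l div 2} - {i}. card D * card D)"
    by (intro prod.cong) (auto simp: card_cartesian_product)
  also have "\<dots> = card D ^ (2 * (l div 2 - 1))"
    using i by (simp add: power_mult power2_eq_square)
  also have "2 * (l div 2 - 1) = l - 2" using l by (auto elim!: evenE)
  finally show ?thesis by simp
qed

lemma card_some_pair_le:
  assumes l: "even l" and A: "A \<subseteq> {1..n} \<times> {1..n}"
  shows "card {vs \<in> vertex_tuples l n. \<exists>i<l div 2. (vs ! (2 * i), vs ! (2 * i + 1)) \<in> A}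
    \<le> l * card A * n ^ (l - 2)"
proof -
  define T where "T i = {vs \<in> vertex_tuples l n. \<forall>j<l div 2.
      (vs ! (2 * j), vs ! (2 * j + 1)) \<in> (if j = i then A else {1..n} \<times> {1..n})}" for i
  have cT: "card (T i) = card A * n ^ (l - 2)" if "i < l div 2" for i
    unfolding T_def using card_one_pair[OF l that A subset_refl] by simp
  have "{vs \<in> vertex_tuples l n. \<exists>i<l div 2. (vs ! (2 * i), vs ! (2 * i + 1)) \<in> A}
      \<subseteq> (\<Union>i<l div 2. T i)" (is "?L \<subseteq> _")
  proof
    fix vs assume "vs \<in> ?L"
    then obtain i where vs: "vs \<in> vertex_tuples l n" and i: "i < l div 2"
      and e: "(vs ! (2 * i), vs ! (2 * i + 1)) \<in> A" by blast
    have "(vs ! (2 * j), vs ! (2 * j + 1)) \<in> (if j = i then A else {1..n} \<times> {1..n})" if "j < l div 2" for j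
    proof (cases "j = i")
      case False
      have "2 * j < l" "2 * j + 1 < l" using that l by auto
      then show ?thesis using False vertex_tuples_nth[OF vs] by simp
    qed (use e in simp)
    then show "vs \<in> (\<Union>i<l div 2. T i)" using vs i unfolding T_def by blast
  qed
  then have "card ?L \<le> card (\<Union>i<l div 2. T i)"
    by (intro card_mono) (auto simp: T_def finite_vertex_tuples)
  also have "\<dots> \<le> (\<Sum>i<l div 2. card (T i))" by (rule card_UN_le) simp
  also have "\<dots> = (l div 2) * (card A * n ^ (l - 2))" using cT by simp
  also have "\<dots> \<le> l * (card A * n ^ (l - 2))" by (rule mult_right_mono) simp_all
  finally show ?thesis by (simp add: mult.assoc)
qed

section \<open>Isolated vertices\<close>

lemma isolated_add_edge:
  "isolated_vertices n (add_edge E v w)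
    = (if v = w then isolated_vertices n E else isolated_vertices n E - {v, w})"
  unfolding isolated_vertices_def add_edge_def by (auto simp: doubleton_eq_iff)

lemma isolated_subset: "isolated_vertices n E \<subseteq> {1..n}"
  by (auto simp: isolated_vertices_def)

lemma finite_isolated [simp]: "finite (isolated_vertices n E)"
  using finite_subset[OF isolated_subset] by blast

lemma card_isolated_le: "card (isolated_vertices n E) \<le> n"
  using card_mono[OF _ isolated_subset, of n E] by simp

text \<open>The largest number of isolated vertices (those in \<open>I\<close>) that some choice could remove for the tuple
\<open>vs\<close>, where a candidate loop at an isolated vertex is counted as if it removed two.
Counting loops in this way makes the law of \<open>max_drop\<close> exact.\<close>

definition max_drop :: "nat set \<Rightarrow> nat list \<Rightarrow> nat" where
  "max_drop I vs = (if \<exists>i<length vs div 2. vs ! (2 * i) \<in> I \<and> vs ! (2 * i + 1) \<in> I then 2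
     else if set vs \<inter> I \<noteq> {} then 1 else 0)"

lemma max_drop_le_2: "max_drop I vs \<le> 2"
  by (simp add: max_drop_def)

text \<open>No isolated vertex occurs in \<open>(n - Y) ^ l\<close> tuples, and no candidate edge has both ends isolated in
\<open>(n\<^sup>2 - Y\<^sup>2) ^ (l div 2)\<close> of them.\<close>

lemma card_max_drop:
  assumes l: "even l" and n: "n \<ge> 1" and I: "I \<subseteq> {1..n}" and d: "d \<le> 2"
  shows "real (card {vs \<in> vertex_tuples l n. max_drop I vs = d})
    = real (card (vertex_tuples l n)) * jump_prob l (real (card I) / real n) d"
proof -
  define T where "T = vertex_tuples l n"
  define Y where "Y = card I"
  have finI: "finite I" using I finite_subset by blast
  have Yn: "Y \<le> n" using card_mono[OF _ I] by (simp add: Y_def)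
  have finT: "finite T" unfolding T_def by (rule finite_vertex_tuples)
  define N0 where "N0 = {vs \<in> T. set vs \<inter> I = {}}"
  define N1 where "N1 = {vs \<in> T. \<forall>i<l div 2. (vs ! (2 * i), vs ! (2 * i + 1)) \<in> {1..n} \<times> {1..n} - I \<times> I}"
  have N0: "real (card N0) = real n ^ l * (1 - real Y / real n) ^ l"
  proof -
    have "N0 = {vs. set vs \<subseteq> {1..n} - I \<and> length vs = l}"
      by (auto simp: N0_def T_def vertex_tuples_def)
    then have "card N0 = card ({1..n} - I) ^ l" by (simp add: card_lists_length_eq)
    also have "card ({1..n} - I) = n - Y" using I by (simp add: card_Diff_subset finI Y_def)
    finally have "real (card N0) = (real n - real Y) ^ l" using Yn by simp
    also have "real n - real Y = real n * (1 - real Y / real n)" using n by (simp add: field_simps)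
    finally show ?thesis by (simp add: power_mult_distrib)
  qed
  have N1: "real (card N1) = real n ^ l * (1 - (real Y / real n)\<^sup>2) ^ (l div 2)"
  proof -
    have "card N1 = card ({1..n} \<times> {1..n} - I \<times> I) ^ (l div 2)"
      unfolding N1_def T_def using l by (subst card_vertex_tuples_pairs) auto
    also have "card ({1..n} \<times> {1..n} - I \<times> I) = n * n - Y * Y"
      using I finI by (subst card_Diff_subset) (auto simp: Y_def)
    finally have "real (card N1) = (real n * real n - real Y * real Y) ^ (l div 2)"
      using Yn by (simp add: of_nat_diff mult_mono)
    also have "real n * real n - real Y * real Y = (real n)\<^sup>2 * (1 - (real Y / real n)\<^sup>2)"
      using n by (simp add: power2_eq_square field_simps)
    also have "\<dots> ^ (l div 2) = real n ^ l * (1 - (real Y / real n)\<^sup>2) ^ (l div 2)"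
      using l by (simp add: power_mult_distrib flip: power_mult)
    finally show ?thesis .
  qed
  have len: "length vs div 2 = l div 2" if "vs \<in> T" for vs using that by (simp add: T_def vertex_tuples_def)
  have N01: "N0 \<subseteq> N1"
  proof
    fix vs assume vs: "vs \<in> N0"
    then have "length vs = 2 * (l div 2)" "set vs \<subseteq> {1..n} - I"
      using l by (auto simp: N0_def T_def vertex_tuples_def)
    then have "\<forall>i<l div 2. (vs ! (2 * i), vs ! (2 * i + 1)) \<in> ({1..n} - I) \<times> ({1..n} - I)"
      using set_subset_iff_pairs by metis
    then show "vs \<in> N1" using vs by (auto simp: N1_def N0_def)
  qed
  have rng: "(vs ! (2 * i), vs ! (2 * i + 1)) \<in> {1..n} \<times> {1..n}" if "vs \<in> T" "i < l div 2" for vs i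
  proof -
    have "length vs = 2 * (l div 2)" "set vs \<subseteq> {1..n}"
      using l that by (auto simp: T_def vertex_tuples_def)
    then show ?thesis using set_subset_iff_pairs that(2) by metis
  qed
  have two: "max_drop I vs = 2 \<longleftrightarrow> vs \<notin> N1" if "vs \<in> T" for vs
    using rng[OF that] that by (auto simp: max_drop_def N1_def len)
  have zero: "max_drop I vs = 0 \<longleftrightarrow> vs \<in> N0" if "vs \<in> T" for vs
  proof
    assume "max_drop I vs = 0"
    then show "vs \<in> N0" using that by (auto simp: max_drop_def N0_def split: if_splits)
  next
    assume v: "vs \<in> N0"
    then have "max_drop I vs \<noteq> 2" using N01 two[OF that] by auto
    then show "max_drop I vs = 0" using v by (auto simp: max_drop_def N0_def split: if_splits)
  qed
  have sub: "N1 \<subseteq> T" "N0 \<subseteq> T" by (auto simp: N1_def N0_def)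
  have cT: "real (card T) = real n ^ l" by (simp add: T_def card_vertex_tuples)
  consider "d = 0" | "d = 1" | "d = 2" using d by linarith
  then have "real (card {vs \<in> T. max_drop I vs = d}) = real n ^ l * jump_prob l (real Y / real n) d"
  proof cases
    case 1
    then have "{vs \<in> T. max_drop I vs = d} = N0" using zero sub by auto
    then show ?thesis using 1 N0 by (simp add: jump_prob_def)
  next
    case 3
    then have "{vs \<in> T. max_drop I vs = d} = T - N1" using two sub by auto
    then have "real (card {vs \<in> T. max_drop I vs = d}) = real (card T) - real (card N1)"
      using sub finT by (simp add: card_Diff_subset finite_subset of_nat_diff card_mono)
    then show ?thesis using 3 N1 cT by (simp add: jump_prob_def algebra_simps)
  next
    case 2
    have "max_drop I vs = 1 \<longleftrightarrow> vs \<in> N1 - N0" if "vs \<in> T" for vs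
      using zero[OF that] two[OF that] max_drop_le_2[of I vs] by auto
    then have "{vs \<in> T. max_drop I vs = d} = N1 - N0" using 2 sub by auto
    then have "real (card {vs \<in> T. max_drop I vs = d}) = real (card N1) - real (card N0)"
      using sub N01 finT by (simp add: card_Diff_subset finite_subset[OF _ finT] of_nat_diff card_mono[OF finite_subset[OF _ finT]])
    then show ?thesis using 2 N0 N1 by (simp add: jump_prob_def algebra_simps)
  qed
  then show ?thesis by (simp add: T_def Y_def card_vertex_tuples)
qed

lemma isolated_next_graph:
  fixes E :: "nat set set"
  assumes "vs \<in> vertex_tuples l n" "i < l div 2"
  defines "I \<equiv> isolated_vertices n E"
  defines "I' \<equiv> isolated_vertices n (next_graph E vs i)"
  shows "card I' \<le> card I" "card I - card I' \<le> max_drop I vs"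
proof -
  define v where "v = vs ! (2 * i)"
  define w where "w = vs ! (2 * i + 1)"
  have I': "I' = (if v = w then I else I - {v, w})"
    by (simp add: I'_def I_def next_graph_def isolated_add_edge v_def w_def)
  have fin: "finite I" by (simp add: I_def)
  show "card I' \<le> card I" unfolding I' using fin by (auto intro: card_mono)
  have len: "length vs = l" "2 * i < l" "2 * i + 1 < l" using assms by (auto simp: vertex_tuples_def)
  then have vw: "v \<in> set vs" "w \<in> set vs" by (auto simp: v_def w_def)
  show "card I - card I' \<le> max_drop I vs"
  proof (cases "v \<in> I \<and> w \<in> I")
    case True
    then have "max_drop I vs = 2" using assms len by (auto simp: max_drop_def v_def w_def)
    moreover have "card I - card (I - {v, w}) \<le> card {v, w}"
      using diff_card_le_card_Diff[of "{v, w}" I] by simp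
    moreover have "card {v, w} \<le> 2" by (cases "v = w") auto
    ultimately show ?thesis unfolding I' by auto
  next
    case False
    show ?thesis
    proof (cases "v \<in> I \<or> w \<in> I")
      case True
      then have "max_drop I vs \<ge> 1" using vw by (auto simp: max_drop_def)
      moreover have "card I - card (I - {v, w}) \<le> 1"
      proof -
        from True False obtain u where "I - {v, w} = I - {u}" "u \<in> I" by blast
        then show ?thesis using fin by simp
      qed
      ultimately show ?thesis unfolding I' by (cases "v = w") auto
    next
      case False
      then have "I - {v, w} = I" by auto
      then show ?thesis unfolding I' by simp
    qed
  qed
qed

section \<open>The lexicographic choice\<close>

lemma lex_le_total: "lex_le p q \<or> lex_le q p"
  by (auto simp: lex_le_def)

lemma lex_le_trans: "lex_le p q \<Longrightarrow> lex_le q r \<Longrightarrow> lex_le p r"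
  by (auto simp: lex_le_def)

lemma lex_le_fst: "lex_le p q \<Longrightarrow> fst p \<le> fst q"
  by (auto simp: lex_le_def)

lemma ex_lex_least: "k > 0 \<Longrightarrow> \<exists>i<k. \<forall>j<k. lex_le (f i) (f j)" for k :: nat
proof (induction k)
  case (Suc k)
  have refl: "lex_le (f k) (f k)" using lex_le_total by blast
  show ?case
  proof (cases "k = 0")
    case True
    then show ?thesis using refl by simp
  next
    case False
    then obtain i where i: "i < k" "\<forall>j<k. lex_le (f i) (f j)" using Suc.IH by auto
    show ?thesis
    proof (cases "lex_le (f i) (f k)")
      case True
      then have "\<forall>j<Suc k. lex_le (f i) (f j)" using i(2) by (simp add: less_Suc_eq)
      then show ?thesis using i(1) by (meson less_SucI)
    next
      case False
      then have ki: "lex_le (f k) (f i)" using lex_le_total by blast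
      have "lex_le (f k) (f j)" if "j < Suc k" for j
        using that i(2) refl lex_le_trans[OF ki] by (cases "j = k") (simp_all add: less_Suc_eq)
      then show ?thesis by blast
    qed
  qed
qed simp

lemma lex_rule_spec:
  assumes "length s \<ge> 2"
  shows "lex_rule s < length s div 2"
    "\<And>j. j < length s div 2 \<Longrightarrow> lex_le (sorted_pair s (lex_rule s)) (sorted_pair s j)"
    "\<And>i. i < length s div 2 \<Longrightarrow> (\<And>j. j < length s div 2 \<Longrightarrow> lex_le (sorted_pair s i) (sorted_pair s j))
       \<Longrightarrow> lex_rule s \<le> i"
proof -
  let ?P = "\<lambda>i. i < length s div 2 \<and> (\<forall>j < length s div 2. lex_le (sorted_pair s i) (sorted_pair s j))"
  have "\<exists>i. ?P i" using ex_lex_least[of "length s div 2" "sorted_pair s"] assms by auto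
  then have "?P (lex_rule s)" unfolding lex_rule_def by (rule LeastI_ex)
  then show "lex_rule s < length s div 2"
    "\<And>j. j < length s div 2 \<Longrightarrow> lex_le (sorted_pair s (lex_rule s)) (sorted_pair s j)" by auto
  show "\<And>i. i < length s div 2 \<Longrightarrow> (\<And>j. j < length s div 2 \<Longrightarrow> lex_le (sorted_pair s i) (sorted_pair s j))
       \<Longrightarrow> lex_rule s \<le> i"
    unfolding lex_rule_def by (intro Least_le) auto
qed

definition lex_choice :: "nat \<Rightarrow> nat set set \<Rightarrow> nat list \<Rightarrow> nat" where
  "lex_choice K E vs = lex_rule (map (truncated_size K E) vs)"

lemma component_subset:
  assumes "E \<in> simple_graphs n" "v \<in> {1..n}"
  shows "component E v \<subseteq> {1..n}"
proof
  fix w assume "w \<in> component E v"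
  then have "(v, w) \<in> (adj E)\<^sup>*" by (simp add: component_def)
  then show "w \<in> {1..n}"
  proof (induction rule: rtrancl_induct)
    case (step y z)
    then show ?case using assms(1) by (auto simp: adj_def simple_graphs_def doubleton_eq_iff)
  qed (use assms in auto)
qed

lemma self_in_component [simp]: "v \<in> component E v"
  by (simp add: component_def)

lemma component_isolated_iff:
  assumes "E \<in> simple_graphs n" "v \<in> {1..n}"
  shows "card (component E v) = 1 \<longleftrightarrow> v \<in> isolated_vertices n E"
proof
  assume "card (component E v) = 1"
  then have c: "component E v = {v}"
    using self_in_component[of v E] by (metis card_1_singletonE singletonD)
  have "{v, w} \<notin> E" for w
  proof
    assume e: "{v, w} \<in> E"
    then have "w \<in> component E v" by (auto simp: component_def adj_def)
    then have "w = v" unfolding c by simp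
    then have "{v} \<in> E" using e by simp
    then obtain x y where "{v} = {x, y}" "x \<noteq> y" using assms(1) unfolding simple_graphs_def by blast
    then show False by (metis insertI1 insert_commute singletonD)
  qed
  then show "v \<in> isolated_vertices n E" using assms by (simp add: isolated_vertices_def)
next
  assume "v \<in> isolated_vertices n E"
  then have i: "{v, w} \<notin> E" for w by (simp add: isolated_vertices_def)
  have "w = v" if "(v, w) \<in> (adj E)\<^sup>*" for w
    using that
  proof (induction rule: rtrancl_induct)
    case (step y z)
    then have "{v, z} \<in> E" by (simp add: adj_def)
    then show ?case using i by simp
  qed simp
  then have "component E v = {v}" by (auto simp: component_def)
  then show "card (component E v) = 1" by simp
qed

lemma card_component_pos:
  assumes "E \<in> simple_graphs n" "v \<in> {1..n}"
  shows "1 \<le> card (component E v)"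
proof -
  have "finite (component E v)" using finite_subset[OF component_subset[OF assms]] by simp
  then have "0 < card (component E v)" using self_in_component[of v E] card_gt_0_iff by blast
  then show ?thesis by simp
qed

lemma truncated_size_1_iff:
  assumes "E \<in> simple_graphs n" "v \<in> {1..n}" "K \<ge> 1"
  shows "truncated_size K E v = 1 \<longleftrightarrow> v \<in> isolated_vertices n E"
  using component_isolated_iff[OF assms(1,2)] assms(3)
  by (auto simp: truncated_size_def one_enat_def)

lemma truncated_size_ge_1:
  assumes "E \<in> simple_graphs n" "v \<in> {1..n}"
  shows "1 \<le> truncated_size K E v"
  using card_component_pos[OF assms] by (simp add: truncated_size_def one_enat_def)

lemma sorted_pair_map:
  "2 * i + 1 < length vs \<Longrightarrow> sorted_pair (map f vs) i
    = (min (f (vs ! (2 * i))) (f (vs ! (2 * i + 1))), max (f (vs ! (2 * i))) (f (vs ! (2 * i + 1))))"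
  by (simp add: sorted_pair_def)

lemma lex_choice_spec:
  fixes E :: "nat set set" and K :: nat
  assumes "length vs = l" "l \<ge> 2" "even l"
  defines "f \<equiv> truncated_size K E" and "i \<equiv> lex_choice K E vs"
  defines "P \<equiv> \<lambda>j. (min (f (vs ! (2 * j))) (f (vs ! (2 * j + 1))), max (f (vs ! (2 * j))) (f (vs ! (2 * j + 1))))"
  shows "i < l div 2" "\<And>j. j < l div 2 \<Longrightarrow> lex_le (P i) (P j)"
    "\<And>k. k < l div 2 \<Longrightarrow> (\<And>j. j < l div 2 \<Longrightarrow> lex_le (P k) (P j)) \<Longrightarrow> i \<le> k"
proof -
  have len: "length (map f vs) = l" using assms by simp
  have P: "sorted_pair (map f vs) j = P j" if "j < l div 2" for j
    unfolding P_def using that assms by (intro sorted_pair_map) linarith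
  note spec = lex_rule_spec[of "map f vs", unfolded len, OF \<open>l \<ge> 2\<close>]
  have i: "i = lex_rule (map f vs)" by (simp add: i_def lex_choice_def f_def)
  show il: "i < l div 2" using spec(1) i by simp
  show "lex_le (P i) (P j)" if "j < l div 2" for j using spec(2)[OF that] P that il i by simp
  show "i \<le> k" if "k < l div 2" "\<And>j. j < l div 2 \<Longrightarrow> lex_le (P k) (P j)" for k
    using spec(3)[OF that(1)] P that i by simp
qed

text \<open>Isolated vertices have the smallest possible size 1. A candidate edge with two isolated ends has
the minimal pair \<open>(1, 1)\<close>; failing that, the smaller entry of the chosen pair is 1 as soon as some
isolated vertex occurs. Only a loop at an isolated vertex can waste the draw.\<close>

lemma lex_choice_max_drop:
  fixes E :: "nat set set"
  assumes E: "E \<in> simple_graphs n" and vs: "vs \<in> vertex_tuples l n" and l: "l \<ge> 2" "even l"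
    and K: "K \<ge> 1"
  defines "I \<equiv> isolated_vertices n E" and "i \<equiv> lex_choice K E vs"
  assumes no_loop: "\<And>j. j < l div 2 \<Longrightarrow> \<not> (vs ! (2 * j) = vs ! (2 * j + 1) \<and> vs ! (2 * j) \<in> I)"
  shows "card I - card (isolated_vertices n (next_graph E vs i)) = max_drop I vs"
proof -
  have len: "length vs = l" using vs by (simp add: vertex_tuples_def)
  note spec = lex_choice_spec[OF len l, where K = K and E = E, folded i_def]
  define f where "f = truncated_size K E"
  have rng: "vs ! p \<in> {1..n}" if "p < l" for p
    using vertex_tuples_nth[OF vs that] .
  have pl: "2 * j < l" "2 * j + 1 < l" if "j < l div 2" for j using that l by auto
  have f1: "f (vs ! p) = 1 \<longleftrightarrow> vs ! p \<in> I" if "p < l" for p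
    unfolding f_def I_def using truncated_size_1_iff[OF E rng[OF that] K] .
  have fge: "1 \<le> f (vs ! p)" if "p < l" for p
    unfolding f_def using truncated_size_ge_1[OF E rng[OF that]] .
  define v where "v = vs ! (2 * i)"
  define w where "w = vs ! (2 * i + 1)"
  have il: "i < l div 2" using spec(1) .
  have I': "isolated_vertices n (next_graph E vs i) = (if v = w then I else I - {v, w})"
    by (simp add: I_def next_graph_def isolated_add_edge v_def w_def)
  have fin: "finite I" by (simp add: I_def)
  have fvw: "f v = 1 \<longleftrightarrow> v \<in> I" "f w = 1 \<longleftrightarrow> w \<in> I" "1 \<le> f v" "1 \<le> f w"
    using f1 fge pl[OF il] by (auto simp: v_def w_def)
  have loop: "\<not> (v = w \<and> v \<in> I)" using no_loop[OF il] by (simp add: v_def w_def)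
  have vwset: "v \<in> set vs" "w \<in> set vs" using pl[OF il] len by (auto simp: v_def w_def)
  show ?thesis
  proof (cases "\<exists>j<l div 2. vs ! (2 * j) \<in> I \<and> vs ! (2 * j + 1) \<in> I")
    case True
    then obtain j where j: "j < l div 2" "vs ! (2 * j) \<in> I" "vs ! (2 * j + 1) \<in> I" by blast
    then have "f (vs ! (2 * j)) = 1" "f (vs ! (2 * j + 1)) = 1" using f1 pl by auto
    then have "f v = 1" "f w = 1"
      using spec(2)[OF j(1)] fvw(3,4) unfolding f_def[symmetric] v_def[symmetric] w_def[symmetric] lex_le_def
      by (auto simp: min_def max_def split: if_splits)
    then have vw: "v \<in> I" "w \<in> I" using fvw by auto
    then have "v \<noteq> w" using loop by auto
    then have "card (I - {v, w}) = card I - 2" using vw by (simp add: card_Diff_subset)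
    moreover have "card {v, w} \<le> card I" using vw fin by (intro card_mono) auto
    moreover have "max_drop I vs = 2" using True len by (simp add: max_drop_def)
    ultimately show ?thesis using \<open>v \<noteq> w\<close> unfolding I' by simp
  next
    case no2: False
    then have notboth: "\<not> (v \<in> I \<and> w \<in> I)" using il by (auto simp: v_def w_def)
    show ?thesis
    proof (cases "set vs \<inter> I = {}")
      case True
      then have "max_drop I vs = 0" using no2 len by (simp add: max_drop_def)
      moreover have "I - {v, w} = I" using True vwset by auto
      ultimately show ?thesis unfolding I' by simp
    next
      case False
      then obtain p where p: "p < l" "vs ! p \<in> I" using len by (auto simp: set_conv_nth)
      define j where "j = p div 2"
      have j: "j < l div 2" using p l by (auto simp: j_def elim!: evenE)
      have "p = 2 * j \<or> p = 2 * j + 1" unfolding j_def by linarith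
      then have "f (vs ! (2 * j)) = 1 \<or> f (vs ! (2 * j + 1)) = 1" using p f1 by auto
      then have "min (f (vs ! (2 * j))) (f (vs ! (2 * j + 1))) = 1"
        using fge[of "2 * j"] fge[of "2 * j + 1"] pl[OF j] by (auto simp: min_def)
      then have "min (f v) (f w) \<le> 1"
        using lex_le_fst[OF spec(2)[OF j]] unfolding f_def[symmetric] v_def[symmetric] w_def[symmetric] fst_conv
        by metis
      then have "f v \<le> 1 \<or> f w \<le> 1" by (simp add: min_le_iff_disj)
      then have "v \<in> I \<or> w \<in> I" using fvw by (metis order_antisym)
      then obtain u where u: "I - {v, w} = I - {u}" "u \<in> I" "v \<noteq> w"
      proof
        assume "v \<in> I"
        then show thesis using that[of v] notboth loop by auto
      next
        assume "w \<in> I"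
        then show thesis using that[of w] notboth loop by auto
      qed
      have "card (I - {u}) = card I - 1" using u by simp
      moreover have "card I \<noteq> 0" using u fin by auto
      moreover have "max_drop I vs = 1" using no2 False len by (simp add: max_drop_def)
      ultimately show ?thesis using u unfolding I' by simp
    qed
  qed
qed

lemma card_isolated_loops:
  assumes l: "l \<ge> 2" "even l" and n: "n \<ge> 1" and I: "I \<subseteq> {1..n}"
  shows "real (card {vs \<in> vertex_tuples l n. \<exists>i<l div 2. vs ! (2 * i) = vs ! (2 * i + 1) \<and> vs ! (2 * i) \<in> I})
    \<le> real (card (vertex_tuples l n)) * (real l * (real (card I) / real n) / real n)"
proof -
  define A where "A = (\<lambda>x. (x, x)) ` I"
  have A: "A \<subseteq> {1..n} \<times> {1..n}" "card A = card I" using I by (auto simp: A_def card_image inj_on_def)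
  have "(v, w) \<in> A \<longleftrightarrow> v = w \<and> v \<in> I" for v w by (auto simp: A_def)
  then have "card {vs \<in> vertex_tuples l n. \<exists>i<l div 2. vs ! (2 * i) = vs ! (2 * i + 1) \<and> vs ! (2 * i) \<in> I}
      \<le> l * card I * n ^ (l - 2)"
    using card_some_pair_le[OF l(2) A(1)] A(2) by simp
  then have "real (card {vs \<in> vertex_tuples l n. \<exists>i<l div 2. vs ! (2 * i) = vs ! (2 * i + 1) \<and> vs ! (2 * i) \<in> I})
      \<le> real (l * card I * n ^ (l - 2))" by (rule of_nat_mono)
  also have "\<dots> = real n ^ l * (real l * (real (card I) / real n) / real n)"
  proof -
    obtain k where "l = Suc (Suc k)" using l(1) by (metis add_2_eq_Suc le_Suc_ex)
    then show ?thesis using n by (simp add: field_simps)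
  qed
  finally show ?thesis by (simp add: card_vertex_tuples)
qed


section \<open>The law of the number of isolated vertices\<close>

text \<open>One round as seen from a fixed graph: the first bound holds for every way of choosing edges, the
second one for the lexicographic choice.\<close>

lemma (in survival_estimates) survival_graph_average:
  fixes E :: "nat set set" and n :: nat
  assumes n: "n \<ge> 1" and t: "0 \<le> t" "t < 1" "- ln (1 - t) \<le> S"
  defines "I \<equiv> isolated_vertices n E" and "T \<equiv> vertex_tuples l n"
  shows "(\<And>vs. vs \<in> T \<Longrightarrow> c vs < l div 2) \<Longrightarrow>
      (\<Sum>vs\<in>T. survival l n t (card (isolated_vertices n (next_graph E vs (c vs)))))
        \<le> real n ^ l * (survival l n (discount l n t) (card I) + step_const / (real n)\<^sup>2)"
    and "K \<ge> 1 \<Longrightarrow> E \<in> simple_graphs n \<Longrightarrow>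
      real n ^ l * (survival l n (discount l n t) (card I) - step_const / (real n)\<^sup>2)
        \<le> (\<Sum>vs\<in>T. survival l n t (card (isolated_vertices n (next_graph E vs (lex_choice K E vs)))))"
proof -
  have I: "I \<subseteq> {1..n}" unfolding I_def by (rule isolated_subset)
  have cT: "real (card T) = real n ^ l" by (simp add: T_def card_vertex_tuples)
  define D where "D c vs = card I - card (isolated_vertices n (next_graph E vs (c vs)))" for c vs
  have D: "card (isolated_vertices n (next_graph E vs (c vs))) = card I - D c vs"
    "D c vs \<le> max_drop I vs \<and> D c vs \<le> card I \<and> max_drop I vs \<le> 2"
    if "vs \<in> T" "c vs < l div 2" for c vs
    using isolated_next_graph[of vs l n "c vs" E] that max_drop_le_2 by (simp_all add: D_def I_def T_def)
  note average = survival_average[OF n _ t, where \<Omega> = T and Dh = "max_drop I" and Y = "card I", unfolded cT]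
  have card: "real (card {vs \<in> T. max_drop I vs = d}) = real n ^ l * jump_prob l (real (card I) / real n) d"
    if "d \<le> 2" for d
    using card_max_drop[OF l(2) n I that] by (simp add: T_def card_vertex_tuples)
  have pre: "card I \<le> n" "finite T" using card_isolated_le[of n E] by (simp_all add: I_def T_def finite_vertex_tuples)
  show "(\<Sum>vs\<in>T. survival l n t (card (isolated_vertices n (next_graph E vs (c vs)))))
        \<le> real n ^ l * (survival l n (discount l n t) (card I) + step_const / (real n)\<^sup>2)"
    if "\<And>vs. vs \<in> T \<Longrightarrow> c vs < l div 2"
    using average(1)[OF pre, where D = "D c"] D[where c = c] that card by simp
  assume K: "K \<ge> 1" and E: "E \<in> simple_graphs n"
  have l2: "l \<ge> 2" using l by (cases "l = 1") auto
  have c: "lex_choice K E vs < l div 2" if "vs \<in> T" for vs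
    using lex_choice_spec(1)[OF _ l2 l(2)] that by (simp add: vertex_tuples_def T_def)
  let ?L = "{vs \<in> T. \<exists>i<l div 2. vs ! (2 * i) = vs ! (2 * i + 1) \<and> vs ! (2 * i) \<in> I}"
  have "{vs \<in> T. D (lex_choice K E) vs \<noteq> max_drop I vs} \<subseteq> ?L"
    using lex_choice_max_drop[OF E _ l2 l(2) K] unfolding I_def D_def T_def by blast
  then have "card {vs \<in> T. D (lex_choice K E) vs \<noteq> max_drop I vs} \<le> card ?L"
    using pre(2) by (intro card_mono) simp_all
  then have "real (card {vs \<in> T. D (lex_choice K E) vs \<noteq> max_drop I vs}) \<le> real (card ?L)" by simp
  also have "\<dots> \<le> real n ^ l * (real l * (real (card I) / real n) / real n)"
    using card_isolated_loops[OF l2 l(2) n I] by (simp add: T_def card_vertex_tuples)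
  finally show "real n ^ l * (survival l n (discount l n t) (card I) - step_const / (real n)\<^sup>2)
      \<le> (\<Sum>vs\<in>T. survival l n t (card (isolated_vertices n (next_graph E vs (lex_choice K E vs)))))"
    using average(2)[OF pre, where D = "D (lex_choice K E)"] D[where c = "lex_choice K E"] c card by simp
qed

lemma (in achlioptas) integrable_survival: "integrable M (\<lambda>\<omega>. survival l' n' t (Y1 n V C N \<omega>))"
  unfolding Y1_def by (rule integrable_graph)

lemma lex_process_choice:
  assumes "lex_process K l n M V C" "\<omega> \<in> space M"
  shows "C N \<omega> = lex_choice K (graph_after V C N \<omega>) (V N \<omega>)"
  using assms by (simp add: lex_process_def lex_choice_def)

text \<open>For an arbitrary process the chosen edge is not a function of history and tuple. It is
replaced by the choice that makes \<open>survival\<close> largest in the next round.\<close>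

lemma (in survival_estimates) expectation_survival_step:
  fixes M :: "'a measure"
  assumes A: "achlioptas M l n V C" and t: "0 \<le> t" "t < 1" "- ln (1 - t) \<le> S"
  defines "e \<equiv> \<lambda>t N. integral\<^sup>L M (\<lambda>\<omega>. survival l n t (Y1 n V C N \<omega>))"
  shows "e t (Suc N) \<le> e (discount l n t) N + step_const / (real n)\<^sup>2"
    and "lex_process K l n M V C \<Longrightarrow> K \<ge> 1 \<Longrightarrow> e (discount l n t) N - step_const / (real n)\<^sup>2 \<le> e t (Suc N)"
proof -
  interpret achlioptas M l n V C by fact
  define f where "f E vs i = survival l n t (card (isolated_vertices n (next_graph E vs i)))" for E vs i
  define g where "g E = survival l n (discount l n t) (card (isolated_vertices n E))" for E
  have e: "e t (Suc N) = expectation (\<lambda>\<omega>. f (graph_of (history V C N \<omega>)) (V N \<omega>) (C N \<omega>))"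
    "e (discount l n t) N = expectation (\<lambda>\<omega>. g (graph_of (history V C N \<omega>)))"
    by (simp_all add: e_def f_def g_def Y1_def graph_after_Suc graph_after_eq'[symmetric])
  have e': "e t (Suc N) = expectation (\<lambda>\<omega>. survival l n t (card (isolated_vertices n (graph_of (history V C (Suc N) \<omega>)))))"
    by (simp add: e_def Y1_def graph_after_eq'[symmetric])
  have step: "survival l n t (card (isolated_vertices n (graph_of (history V C (Suc N) \<omega>))))
      = f (graph_of (history V C N \<omega>)) (V N \<omega>) (C N \<omega>)" for \<omega>
    by (simp add: f_def graph_after_Suc graph_after_eq'[symmetric])
  have int: "integrable M (\<lambda>\<omega>. g (graph_of (history V C N \<omega>)))" by (rule integrable_history)
  \<comment> \<open>the choice that is worst for the upper bound\<close>
  define c where "c E vs = (SOME i. i < l div 2 \<and> (\<forall>j<l div 2. f E vs j \<le> f E vs i))" for E vs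
  have c: "c E vs < l div 2" "\<forall>j<l div 2. f E vs j \<le> f E vs (c E vs)" for E vs
  proof -
    have "0 < l div 2" using l_ge_2 by auto
    then have fin: "finite (f E vs ` {..<l div 2})" "f E vs ` {..<l div 2} \<noteq> {}" by blast+
    obtain i where "i < l div 2" "f E vs i = Max (f E vs ` {..<l div 2})"
      using Max_in[OF fin] by (metis imageE lessThan_iff)
    then have "\<exists>i. i < l div 2 \<and> (\<forall>j<l div 2. f E vs j \<le> f E vs i)"
      using Max_ge[OF fin(1)] by (intro exI[of _ i]) auto
    from someI_ex[OF this] show "c E vs < l div 2" "\<forall>j<l div 2. f E vs j \<le> f E vs (c E vs)"
      by (auto simp: c_def)
  qed
  have "e t (Suc N) \<le> expectation (\<lambda>\<omega>. g (graph_of (history V C N \<omega>)) + step_const / (real n)\<^sup>2)"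
    unfolding e'
  proof (rule expectation_step_le[where G = "\<lambda>h vs. f (graph_of h) vs (c (graph_of h) vs)"])
    fix \<omega> assume w: "\<omega> \<in> space M"
    show "survival l n t (card (isolated_vertices n (graph_of (history V C (Suc N) \<omega>))))
       \<le> f (graph_of (history V C N \<omega>)) (V N \<omega>) (c (graph_of (history V C N \<omega>)) (V N \<omega>))"
      unfolding step using c(2) C_less[OF w] by blast
    show "(\<Sum>vs\<in>vertex_tuples l n. f (graph_of (history V C N \<omega>)) vs (c (graph_of (history V C N \<omega>)) vs))
      \<le> real n ^ l * (g (graph_of (history V C N \<omega>)) + step_const / (real n)\<^sup>2)"
      unfolding f_def g_def by (intro survival_graph_average(1) n_pos t c)
  qed
  then show "e t (Suc N) \<le> e (discount l n t) N + step_const / (real n)\<^sup>2"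
    using int unfolding e(2) by (simp add: prob_space)
  assume lex: "lex_process K l n M V C" and K: "K \<ge> 1"
  have "expectation (\<lambda>\<omega>. - survival l n t (card (isolated_vertices n (graph_of (history V C (Suc N) \<omega>)))))
     \<le> expectation (\<lambda>\<omega>. - (g (graph_of (history V C N \<omega>)) - step_const / (real n)\<^sup>2))"
  proof (rule expectation_step_le[where G = "\<lambda>h vs. - f (graph_of h) vs (lex_choice K (graph_of h) vs)"])
    fix \<omega> assume w: "\<omega> \<in> space M"
    show "- survival l n t (card (isolated_vertices n (graph_of (history V C (Suc N) \<omega>))))
       \<le> - f (graph_of (history V C N \<omega>)) (V N \<omega>) (lex_choice K (graph_of (history V C N \<omega>)) (V N \<omega>))"
      unfolding step by (simp add: lex_process_choice[OF lex w] graph_after_eq'[symmetric])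
    have "graph_of (history V C N \<omega>) \<in> simple_graphs n"
      using graph_after_simple[OF w] by (simp add: graph_after_eq')
    from survival_graph_average(2)[OF n_pos t K this]
    show "(\<Sum>vs\<in>vertex_tuples l n. - f (graph_of (history V C N \<omega>)) vs (lex_choice K (graph_of (history V C N \<omega>)) vs))
      \<le> real n ^ l * - (g (graph_of (history V C N \<omega>)) - step_const / (real n)\<^sup>2)"
      unfolding sum_negf g_def f_def by linarith
  qed
  then show "e (discount l n t) N - step_const / (real n)\<^sup>2 \<le> e t (Suc N)"
    using int unfolding e(2) e' by (simp add: prob_space)
qed

lemma Y1_0: "Y1 n V C 0 \<omega> = n"
proof -
  have "isolated_vertices n {} = {1..n}" by (auto simp: isolated_vertices_def)
  then show ?thesis by (simp add: Y1_def graph_after_0)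
qed

text \<open>The discounted parameter \<open>\<theta>\<close> grows by the factor \<open>exp (l / n)\<close> in each round, from \<open>a / n\<close> at the
start, where all \<open>n\<close> vertices are isolated.\<close>

lemma (in survival_estimates) expectation_survival:
  fixes M :: "'a measure" and n :: nat and a :: real
  defines "\<theta> \<equiv> \<lambda>N. a / real n * exp (real l * real N / real n)"
  assumes A: "achlioptas M l n V C" and a: "0 \<le> a" and t: "\<theta> N < 1" "- ln (1 - \<theta> N) \<le> S"
  defines "e \<equiv> \<lambda>N. integral\<^sup>L M (\<lambda>\<omega>. survival l n (\<theta> N) (Y1 n V C N \<omega>))"
  shows "e N \<le> survival l n (a / real n) n + real N * (step_const / (real n)\<^sup>2)"
    and "lex_process K l n M V C \<Longrightarrow> K \<ge> 1 \<Longrightarrow>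
      survival l n (a / real n) n - real N * (step_const / (real n)\<^sup>2) \<le> e N"
proof -
  interpret achlioptas M l n V C by fact
  have \<theta>_Suc: "discount l n (\<theta> (Suc N)) = \<theta> N" for N
    by (simp add: \<theta>_def mult.assoc distrib_left add_divide_distrib flip: exp_add)
  have \<theta>_mono: "\<theta> k \<le> \<theta> N" if "k \<le> N" for k
    using that a unfolding \<theta>_def by (intro mult_left_mono) (auto intro!: divide_right_mono mult_left_mono)
  have \<theta>: "0 \<le> \<theta> k" "\<theta> k < 1" "- ln (1 - \<theta> k) \<le> S" if "k \<le> N" for k
  proof -
    show "0 \<le> \<theta> k" using a by (simp add: \<theta>_def)
    show "\<theta> k < 1" using \<theta>_mono[OF that] t by simp
    have "ln (1 - \<theta> N) \<le> ln (1 - \<theta> k)" using \<theta>_mono[OF that] t by simp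
    then show "- ln (1 - \<theta> k) \<le> S" using t by simp
  qed
  have e0: "e 0 = survival l n (a / real n) n" by (simp add: e_def Y1_0 \<theta>_def prob_space)
  have step1: "e (Suc k) \<le> e k + step_const / (real n)\<^sup>2" if "Suc k \<le> N" for k
    using expectation_survival_step(1)[OF A \<theta>[OF that], of k] unfolding \<theta>_Suc e_def .
  have up: "e k \<le> survival l n (a / real n) n + real k * (step_const / (real n)\<^sup>2)" if "k \<le> N" for k
    using that
  proof (induction k)
    case (Suc k)
    then show ?case using step1[OF Suc.prems] Suc.IH by (simp add: algebra_simps add_divide_distrib)
  qed (simp add: e0)
  then show "e N \<le> survival l n (a / real n) n + real N * (step_const / (real n)\<^sup>2)" by simp
  assume lex: "lex_process K l n M V C" "K \<ge> 1"
  have step2: "e k - step_const / (real n)\<^sup>2 \<le> e (Suc k)" if "Suc k \<le> N" for k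
    using expectation_survival_step(2)[OF A \<theta>[OF that] lex, of k] unfolding \<theta>_Suc e_def .
  have "survival l n (a / real n) n - real k * (step_const / (real n)\<^sup>2) \<le> e k" if "k \<le> N" for k
    using that
  proof (induction k)
    case (Suc k)
    then show ?case using step2[OF Suc.prems] Suc.IH by (simp add: algebra_simps add_divide_distrib)
  qed (simp add: e0)
  then show "survival l n (a / real n) n - real N * (step_const / (real n)\<^sup>2) \<le> e N" by simp
qed

definition rounds :: "nat \<Rightarrow> real \<Rightarrow> nat \<Rightarrow> nat" where
  "rounds l c n = nat \<lfloor>time_bound l c n\<rfloor>"

lemma eventually_time_bound_nonneg:
  assumes "l \<ge> 1"
  shows "\<forall>\<^sub>F n in sequentially. n \<ge> 1 \<and> time_bound l c n \<ge> 0"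
proof -
  have "\<forall>\<^sub>F n::nat in sequentially. ln (real n) + c \<ge> 0" by real_asymp
  moreover have "\<forall>\<^sub>F n::nat in sequentially. n \<ge> 1" by (rule eventually_ge_at_top)
  ultimately show ?thesis
  proof eventually_elim
    case (elim n)
    have "time_bound l c n = real n * (ln (real n) + c) / real l"
      by (simp add: time_bound_def algebra_simps)
    then show ?case using elim by simp
  qed
qed

lemma rounds_bounds:
  assumes "time_bound l c n \<ge> 0"
  shows "real (rounds l c n) \<le> time_bound l c n" "time_bound l c n - 1 \<le> real (rounds l c n)"
  using assms by (simp_all add: rounds_def)

lemma exp_rounds:
  assumes "l \<ge> 1" "n \<ge> 1" "time_bound l c n \<ge> 0"
  shows "exp (real l * real (rounds l c n) / real n) \<le> real n * exp c"
    "exp (real l * real (rounds l c n) / real n) \<ge> real n * exp c * exp (- real l / real n)"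
proof -
  have e: "real l * time_bound l c n / real n = ln (real n) + c"
    using assms(1,2) by (simp add: time_bound_def field_simps)
  have "real l * real (rounds l c n) / real n \<le> real l * time_bound l c n / real n"
    using rounds_bounds(1)[OF assms(3)] by (intro divide_right_mono mult_left_mono) auto
  then have "exp (real l * real (rounds l c n) / real n) \<le> exp (ln (real n) + c)" unfolding e by simp
  then show "exp (real l * real (rounds l c n) / real n) \<le> real n * exp c"
    using assms by (simp add: exp_add)
  have "real l * (time_bound l c n - 1) / real n \<le> real l * real (rounds l c n) / real n"
    using rounds_bounds(2)[OF assms(3)] by (intro divide_right_mono mult_left_mono) auto
  moreover have "real l * (time_bound l c n - 1) / real n = ln (real n) + c + - real l / real n"
    using e by (simp add: right_diff_distrib diff_divide_distrib)
  ultimately have "exp (ln (real n) + c + - real l / real n) \<le> exp (real l * real (rounds l c n) / real n)"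
    unfolding exp_le_cancel_iff by linarith
  moreover have "exp (ln (real n) + c + - real l / real n) = real n * exp c * exp (- real l / real n)"
    unfolding exp_add using assms(2) by simp
  ultimately show "exp (real l * real (rounds l c n) / real n) \<ge> real n * exp c * exp (- real l / real n)"
    by argo
qed

lemma rounds_error_tendsto:
  assumes "l \<ge> 1"
  shows "(\<lambda>n. real (rounds l c n) * (Cst / (real n)\<^sup>2)) \<longlonglongrightarrow> 0"
proof (rule Lim_null_comparison)
  show "\<forall>\<^sub>F n in sequentially. norm (real (rounds l c n) * (Cst / (real n)\<^sup>2))
      \<le> \<bar>Cst\<bar> * (ln (real n) + \<bar>c\<bar>) / real n"
    using eventually_time_bound_nonneg[OF assms, of c]
  proof eventually_elim
    case (elim n)
    have n: "n \<ge> 1" and tb: "time_bound l c n \<ge> 0" using elim by auto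
    have "real (rounds l c n) \<le> time_bound l c n" using rounds_bounds(1)[OF tb] .
    also have "\<dots> \<le> real n * ln (real n) + c * real n"
    proof -
      have "time_bound l c n * 1 \<le> time_bound l c n * real l" using tb assms by (intro mult_left_mono) auto
      then show ?thesis using assms by (simp add: time_bound_def)
    qed
    also have "\<dots> \<le> real n * (ln (real n) + \<bar>c\<bar>)"
      using mult_left_mono[of c "\<bar>c\<bar>" "real n"] by (simp add: algebra_simps)
    finally have "real (rounds l c n) * (\<bar>Cst\<bar> / (real n)\<^sup>2) \<le> real n * (ln (real n) + \<bar>c\<bar>) * (\<bar>Cst\<bar> / (real n)\<^sup>2)"
      by (intro mult_right_mono) auto
    then show ?case using n by (simp add: abs_mult power2_eq_square field_simps)
  qed
  show "(\<lambda>n. \<bar>Cst\<bar> * (ln (real n) + \<bar>c\<bar>) / real n) \<longlonglongrightarrow> 0" by real_asymp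
qed

lemma survival_start_tendsto:
  assumes "l \<ge> 1"
  shows "(\<lambda>n. survival l n (a / real n) n) \<longlonglongrightarrow> exp (- a * d1 l)"
proof -
  have "(\<lambda>n. ln (1 - a / real n) * real n) \<longlonglongrightarrow> - a" by real_asymp
  then have "(\<lambda>n. exp (ln (1 - a / real n) * real n * d1 l)) \<longlonglongrightarrow> exp (- a * d1 l)"
    by (intro tendsto_intros)
  moreover have "\<forall>\<^sub>F n in sequentially. exp (ln (1 - a / real n) * real n * d1 l) = survival l n (a / real n) n"
    using eventually_ge_at_top[of 1]
    by eventually_elim (simp add: survival_def potential_1[OF assms] mult.assoc)
  ultimately show ?thesis by (rule Lim_transform_eventually)
qed

text \<open>With \<open>a = (1 - \<delta>) * exp (- c)\<close> the parameter \<open>\<theta>\<close> ends just below \<open>1 - \<delta>\<close>; the loss of at most the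
factor \<open>exp (- l / n)\<close> comes from rounding the number of rounds down to an integer.\<close>

lemma final_discount:
  assumes l: "l \<ge> 1" and n: "n \<ge> 1" and tb: "time_bound l c n \<ge> 0" and \<delta>: "0 < \<delta>" "\<delta> < 1"
  defines "t \<equiv> ((1 - \<delta>) * exp (- c)) / real n * exp (real l * real (rounds l c n) / real n)"
  shows "t \<le> 1 - \<delta>" "(1 - \<delta>) * exp (- real l / real n) \<le> t"
proof -
  define a where "a = (1 - \<delta>) * exp (- c)"
  have a: "0 \<le> a" using \<delta> by (simp add: a_def)
  have "t \<le> a / real n * (real n * exp c)"
    unfolding t_def a_def[symmetric] using exp_rounds(1)[OF l n tb] a by (intro mult_left_mono) auto
  also have "\<dots> = 1 - \<delta>" using n by (simp add: a_def flip: exp_add)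
  finally show "t \<le> 1 - \<delta>" .
  have "(1 - \<delta>) * exp (- real l / real n) = a / real n * (real n * exp c * exp (- real l / real n))"
    using n by (simp add: a_def flip: exp_add)
  also have "\<dots> \<le> t"
    unfolding t_def a_def[symmetric] using exp_rounds(2)[OF l n tb] a by (intro mult_left_mono) auto
  finally show "(1 - \<delta>) * exp (- real l / real n) \<le> t" .
qed

lemma (in survival_estimates) survival_small:
  assumes Y: "1 \<le> Y" "Y \<le> n" and t: "0 \<le> t" "t < 1" "1 - t \<le> r"
  shows "survival l n t Y \<le> r powr b"
proof -
  have n: "n \<ge> 1" using Y by simp
  have "b * (real Y / real n) \<le> potential l (real Y / real n)"
    using Y n by (intro b) (auto simp: divide_simps)
  then have "real n * (b * (real Y / real n)) \<le> real n * potential l (real Y / real n)"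
    by (intro mult_left_mono) auto
  then have "b * real Y \<le> real n * potential l (real Y / real n)" using n by simp
  moreover have "b * 1 \<le> b * real Y" using Y b by (intro mult_left_mono) auto
  ultimately have "b \<le> real n * potential l (real Y / real n)" by simp
  then have "ln (1 - t) * (real n * potential l (real Y / real n)) \<le> ln (1 - t) * b"
    using t by (intro mult_left_mono_neg) auto
  also have "\<dots> \<le> ln r * b" using b t by (intro mult_right_mono) auto
  finally show ?thesis using t by (simp add: survival_def powr_def mult.commute)
qed

lemma le_from_limit_at_0:
  fixes f :: "real \<Rightarrow> real" and x :: ereal
  assumes "(f \<longlongrightarrow> L) (at_right 0)"
  shows "(\<And>\<delta>. 0 < \<delta> \<Longrightarrow> \<delta> < 1 \<Longrightarrow> x \<le> ereal (f \<delta>)) \<Longrightarrow> x \<le> ereal L"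
    and "(\<And>\<delta>. 0 < \<delta> \<Longrightarrow> \<delta> < 1 \<Longrightarrow> ereal (f \<delta>) \<le> x) \<Longrightarrow> ereal L \<le> x"
proof -
  have lim: "((\<lambda>\<delta>. ereal (f \<delta>)) \<longlongrightarrow> ereal L) (at_right 0)" using assms by (intro tendsto_intros)
  have ev: "\<forall>\<^sub>F \<delta> in at_right 0. \<delta> \<in> {0<..<1::real}" by (rule eventually_at_right_real) simp
  show "x \<le> ereal L" if "\<And>\<delta>. 0 < \<delta> \<Longrightarrow> \<delta> < 1 \<Longrightarrow> x \<le> ereal (f \<delta>)"
  proof (rule tendsto_lowerbound[OF lim])
    show "\<forall>\<^sub>F \<delta> in at_right 0. x \<le> ereal (f \<delta>)" using ev by eventually_elim (use that in auto)
  qed simp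
  show "ereal L \<le> x" if "\<And>\<delta>. 0 < \<delta> \<Longrightarrow> \<delta> < 1 \<Longrightarrow> ereal (f \<delta>) \<le> x"
  proof (rule tendsto_upperbound[OF lim])
    show "\<forall>\<^sub>F \<delta> in at_right 0. ereal (f \<delta>) \<le> x" using ev by eventually_elim (use that in auto)
  qed simp
qed

text \<open>\<open>survival\<close> dominates the indicator of having no isolated vertex.\<close>

lemma isolated_limsup:
  fixes M :: "nat \<Rightarrow> 'a measure"
  assumes l: "l \<ge> 2" "even l" and A: "\<And>n. n \<ge> 1 \<Longrightarrow> achlioptas (M n) l n (V n) (C n)"
  shows "limsup (\<lambda>n. ereal (\<P>(\<omega> in M n. Y1 n (V n) (C n) (rounds l c n) \<omega> = 0)))
    \<le> ereal (exp (- d1 l * exp (- c)))" (is "limsup (\<lambda>n. ereal (?P n)) \<le> _")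
proof (rule le_from_limit_at_0(1))
  have l1: "l \<ge> 1" using l by simp
  show "((\<lambda>\<delta>. exp (- ((1 - \<delta>) * exp (- c)) * d1 l)) \<longlongrightarrow> exp (- d1 l * exp (- c))) (at_right 0)"
    by (auto intro!: tendsto_eq_intros simp: mult.commute)
  fix \<delta> :: real assume \<delta>: "0 < \<delta>" "\<delta> < 1"
  define a where "a = (1 - \<delta>) * exp (- c)"
  have a: "0 \<le> a" using \<delta> by (simp add: a_def)
  obtain U b where "survival_estimates l U b" using survival_estimates_exist[OF l1 l(2)] .
  then interpret survival_estimates l U b "- ln \<delta>" .
  have "\<forall>\<^sub>F n in sequentially. ereal (?P n)
      \<le> ereal (survival l n (a / real n) n + real (rounds l c n) * (step_const / (real n)\<^sup>2))"
    using eventually_time_bound_nonneg[OF l1, of c]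
  proof eventually_elim
    case (elim n)
    then have n: "n \<ge> 1" and tb: "time_bound l c n \<ge> 0" by auto
    interpret achlioptas "M n" l n "V n" "C n" using A[OF n] .
    define N where "N = rounds l c n"
    define t where "t = a / real n * exp (real l * real N / real n)"
    have t1: "t \<le> 1 - \<delta>"
      using final_discount(1)[OF l1 n tb \<delta>] by (simp add: t_def a_def N_def)
    have "?P n = expectation (\<lambda>\<omega>. of_bool (Y1 n (V n) (C n) N \<omega> = 0))"
      by (simp only: expectation_of_bool N_def)
    also have "\<dots> \<le> expectation (\<lambda>\<omega>. survival l n t (Y1 n (V n) (C n) N \<omega>))"
    proof (rule integral_mono)
      show "integrable (M n) (\<lambda>\<omega>. of_bool (Y1 n (V n) (C n) N \<omega> = 0) :: real)"
        unfolding Y1_def by (rule integrable_graph)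
    qed (rule integrable_survival, simp add: survival_def)
    also have "\<dots> \<le> survival l n (a / real n) n + real N * (step_const / (real n)\<^sup>2)"
      unfolding t_def using A[OF n] a t1 \<delta> by (intro expectation_survival(1)) (auto simp: t_def)
    finally show ?case by (simp add: N_def)
  qed
  then have "limsup (\<lambda>n. ereal (?P n))
    \<le> limsup (\<lambda>n. ereal (survival l n (a / real n) n + real (rounds l c n) * (step_const / (real n)\<^sup>2)))"
    by (rule Limsup_mono)
  also have "\<dots> = ereal (exp (- a * d1 l) + 0)"
    by (intro lim_imp_Limsup tendsto_intros survival_start_tendsto rounds_error_tendsto l1) simp
  finally show "limsup (\<lambda>n. ereal (?P n)) \<le> ereal (exp (- ((1 - \<delta>) * exp (- c)) * d1 l))" by (simp add: a_def)
qed

text \<open>If an isolated vertex is left, then the final value of \<open>survival\<close> is at most about \<open>\<delta> powr b\<close>, and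
this vanishes as \<open>\<delta>\<close> tends to 0.\<close>

lemma isolated_lex_liminf:
  fixes M :: "nat \<Rightarrow> 'a measure"
  assumes l: "l \<ge> 2" "even l" and A: "\<And>n. n \<ge> 1 \<Longrightarrow> achlioptas (M n) l n (V n) (C n)"
    and lex: "\<And>n. n \<ge> 1 \<Longrightarrow> lex_process K l n (M n) (V n) (C n)" and K: "K \<ge> 1"
  shows "ereal (exp (- d1 l * exp (- c)))
    \<le> liminf (\<lambda>n. ereal (\<P>(\<omega> in M n. Y1 n (V n) (C n) (rounds l c n) \<omega> = 0)))"
    (is "_ \<le> liminf (\<lambda>n. ereal (?P n))")
proof -
  have l1: "l \<ge> 1" using l by simp
  obtain U b where SE: "survival_estimates l U b" using survival_estimates_exist[OF l1 l(2)] .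
  then have b: "b > 0" by (simp add: survival_estimates_def)
  show ?thesis
  proof (rule le_from_limit_at_0(2))
    have "((\<lambda>\<delta>. \<delta> powr b) \<longlongrightarrow> 0) (at_right 0)" using b by real_asymp
    moreover have "((\<lambda>\<delta>. exp (- ((1 - \<delta>) * exp (- c)) * d1 l)) \<longlongrightarrow> exp (- d1 l * exp (- c))) (at_right 0)"
      by (auto intro!: tendsto_eq_intros simp: mult.commute)
    ultimately show "((\<lambda>\<delta>. exp (- ((1 - \<delta>) * exp (- c)) * d1 l) - \<delta> powr b) \<longlongrightarrow> exp (- d1 l * exp (- c))) (at_right 0)"
      using tendsto_diff by fastforce
    fix \<delta> :: real assume \<delta>: "0 < \<delta>" "\<delta> < 1"
    define a where "a = (1 - \<delta>) * exp (- c)"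
    have a: "0 \<le> a" using \<delta> by (simp add: a_def)
    interpret survival_estimates l U b "- ln \<delta>" by (rule SE)
    define r where "r n = 1 - (1 - \<delta>) * exp (- real l / real n)" for n :: nat
    have "\<forall>\<^sub>F n in sequentially. ereal (survival l n (a / real n) n
        - real (rounds l c n) * (step_const / (real n)\<^sup>2) - r n powr b) \<le> ereal (?P n)"
      using eventually_time_bound_nonneg[OF l1, of c]
    proof eventually_elim
      case (elim n)
      then have n: "n \<ge> 1" and tb: "time_bound l c n \<ge> 0" by auto
      interpret achlioptas "M n" l n "V n" "C n" using A[OF n] .
      define N where "N = rounds l c n"
      define t where "t = a / real n * exp (real l * real N / real n)"
      have t1: "t \<le> 1 - \<delta>" and tr: "1 - t \<le> r n"
        using final_discount[OF l1 n tb \<delta>] by (simp_all add: t_def a_def N_def r_def)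
      have t0: "0 \<le> t" using a by (simp add: t_def)
      have int: "integrable (M n) (\<lambda>\<omega>. of_bool (Y1 n (V n) (C n) N \<omega> = 0) :: real)"
        unfolding Y1_def by (rule integrable_graph)
      have "survival l n (a / real n) n - real N * (step_const / (real n)\<^sup>2)
        \<le> expectation (\<lambda>\<omega>. survival l n t (Y1 n (V n) (C n) N \<omega>))"
        unfolding t_def using A[OF n] lex[OF n] K a t1 \<delta> by (intro expectation_survival(2)) (auto simp: t_def)
      also have "\<dots> \<le> expectation (\<lambda>\<omega>. of_bool (Y1 n (V n) (C n) N \<omega> = 0) + r n powr b)"
      proof (rule integral_mono)
        show "integrable (M n) (\<lambda>\<omega>. of_bool (Y1 n (V n) (C n) N \<omega> = 0) + r n powr b)" using int by simp
        fix \<omega>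
        show "survival l n t (Y1 n (V n) (C n) N \<omega>) \<le> of_bool (Y1 n (V n) (C n) N \<omega> = 0) + r n powr b"
        proof (cases "Y1 n (V n) (C n) N \<omega> = 0")
          case True
          then show ?thesis by (simp add: survival_def)
        next
          case False
          then have "1 \<le> Y1 n (V n) (C n) N \<omega>" "Y1 n (V n) (C n) N \<omega> \<le> n"
            using card_isolated_le by (simp_all add: Y1_def Suc_le_eq card_gt_0_iff)
          then show ?thesis using survival_small[OF _ _ t0 _ tr] t1 \<delta> False by simp
        qed
      qed (rule integrable_survival)
      also have "\<dots> = ?P n + r n powr b"
        using int by (simp add: prob_space expectation_of_bool N_def)
      finally show ?case by (simp add: N_def)
    qed
    then have "liminf (\<lambda>n. ereal (survival l n (a / real n) n - real (rounds l c n) * (step_const / (real n)\<^sup>2) - r n powr b))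
      \<le> liminf (\<lambda>n. ereal (?P n))"
      by (rule Liminf_mono)
    moreover have "(\<lambda>n. exp (- real l / real n)) \<longlonglongrightarrow> 1" by real_asymp
    then have "r \<longlonglongrightarrow> \<delta>" unfolding r_def by (auto intro!: tendsto_eq_intros)
    then have "(\<lambda>n. ereal (survival l n (a / real n) n - real (rounds l c n) * (step_const / (real n)\<^sup>2) - r n powr b))
       \<longlonglongrightarrow> ereal (exp (- a * d1 l) - 0 - \<delta> powr b)"
      using \<delta> by (intro tendsto_intros survival_start_tendsto rounds_error_tendsto l1) auto
    then have "liminf (\<lambda>n. ereal (survival l n (a / real n) n - real (rounds l c n) * (step_const / (real n)\<^sup>2) - r n powr b))
       = ereal (exp (- a * d1 l) - 0 - \<delta> powr b)"
      by (intro lim_imp_Liminf) simp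
    ultimately show "ereal (exp (- ((1 - \<delta>) * exp (- c)) * d1 l) - \<delta> powr b) \<le> liminf (\<lambda>n. ereal (?P n))"
      by (simp add: a_def)
  qed
qed

lemma isolated_lex_tendsto:
  fixes M :: "nat \<Rightarrow> 'a measure"
  assumes l: "l \<ge> 2" "even l" and A: "\<And>n. n \<ge> 1 \<Longrightarrow> achlioptas (M n) l n (V n) (C n)"
    and lex: "\<And>n. n \<ge> 1 \<Longrightarrow> lex_process K l n (M n) (V n) (C n)" and K: "K \<ge> 1"
  shows "(\<lambda>n. \<P>(\<omega> in M n. Y1 n (V n) (C n) (rounds l c n) \<omega> = 0)) \<longlonglongrightarrow> exp (- d1 l * exp (- c))"
  using isolated_limsup[OF l A, of c] isolated_lex_liminf[OF l A lex K, of c]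
  by (intro limsup_le_liminf_real) auto


section \<open>Merging components\<close>

definition components :: "nat \<Rightarrow> nat set set \<Rightarrow> nat set set" where
  "components n E = component E ` {1..n}"

lemma adj_sym: "(v, w) \<in> (adj E)\<^sup>* \<longleftrightarrow> (w, v) \<in> (adj E)\<^sup>*"
proof -
  have "sym (adj E)" by (auto simp: sym_def adj_def insert_commute)
  then have "sym ((adj E)\<^sup>*)" by (rule sym_rtrancl)
  then show ?thesis by (auto dest: symD)
qed

lemma component_eq_iff: "component E v = component E w \<longleftrightarrow> (v, w) \<in> (adj E)\<^sup>*"
proof
  assume "component E v = component E w"
  then have "w \<in> component E v" using self_in_component by metis
  then show "(v, w) \<in> (adj E)\<^sup>*" by (simp add: component_def)
next
  assume vw: "(v, w) \<in> (adj E)\<^sup>*"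
  then have wv: "(w, v) \<in> (adj E)\<^sup>*" by (simp add: adj_sym)
  show "component E v = component E w"
    unfolding component_def using rtrancl_trans[OF vw] rtrancl_trans[OF wv] by blast
qed

lemma in_component_iff: "w \<in> component E v \<longleftrightarrow> component E w = component E v"
  unfolding component_eq_iff adj_sym[of w v] by (simp add: component_def)

lemma component_insert_edge:
  "component (insert {v, w} E) x = (if x \<in> component E v \<union> component E w
     then component E v \<union> component E w else component E x)"
proof -
  have adj: "adj (insert {v, w} E) = insert (v, w) (insert (w, v) (adj E))"
    by (auto simp: adj_def doubleton_eq_iff)
  have iff: "(x, y) \<in> (adj (insert {v, w} E))\<^sup>* \<longleftrightarrow> y \<in> component E x \<or>
      (component E x = component E w \<and> y \<in> component E v) \<or>
      ((component E x = component E v \<or> component E x = component E w) \<and>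
       (y \<in> component E w \<or> y \<in> component E v))" for y
    unfolding adj rtrancl_insert component_eq_iff by (simp add: component_def)
  show ?thesis
    unfolding component_def[of "insert {v, w} E"] iff Un_iff in_component_iff[of x]
    by (cases "component E x = component E v"; cases "component E x = component E w") auto
qed

lemma components_add_edge:
  assumes "v \<in> {1..n}" "w \<in> {1..n}"
  shows "components n (add_edge E v w)
    = insert (component E v \<union> component E w) (components n E - {component E v, component E w})"
proof (cases "v = w")
  case True
  then show ?thesis using assms by (auto simp: add_edge_def components_def)
next
  case False
  have c: "component (add_edge E v w) x = (if component E x = component E v \<or> component E x = component E w
     then component E v \<union> component E w else component E x)" for x
    using False by (simp add: add_edge_def component_insert_edge in_component_iff)
  show ?thesis
  proof (intro equalityI subsetI)
    fix A assume "A \<in> components n (add_edge E v w)"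
    then show "A \<in> insert (component E v \<union> component E w) (components n E - {component E v, component E w})"
      unfolding components_def c by auto
  next
    fix A assume "A \<in> insert (component E v \<union> component E w) (components n E - {component E v, component E w})"
    then consider "A = component E v \<union> component E w"
      | x where "x \<in> {1..n}" "A = component E x" "A \<noteq> component E v" "A \<noteq> component E w"
      unfolding components_def by blast
    then show "A \<in> components n (add_edge E v w)"
    proof cases
      case 1
      then have "A = component (add_edge E v w) v" by (simp add: c)
      then show ?thesis unfolding components_def using assms by blast
    next
      case 2
      then have "A = component (add_edge E v w) x" by (simp add: c)
      then show ?thesis unfolding components_def using 2 by blast
    qed
  qed
qed

lemma finite_components [simp]: "finite (components n E)"
  by (simp add: components_def)

lemma component_in_components: "v \<in> {1..n} \<Longrightarrow> component E v \<in> components n E"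
  by (simp add: components_def)

lemma card_remove_two:
  assumes "finite C" "a \<in> C" "b \<in> C" "a \<noteq> b"
  shows "Suc (Suc (card (C - {a, b}))) = card C"
proof -
  have "Suc (card (C - {a} - {b})) = card (C - {a})" using assms by (intro card_Suc_Diff1) auto
  moreover have "C - {a, b} = C - {a} - {b}" by blast
  ultimately show ?thesis using card_Suc_Diff1[OF assms(1,2)] by simp
qed

lemma card_components_add_edge:
  assumes "v \<in> {1..n}" "w \<in> {1..n}"
  shows "card (components n (add_edge E v w)) \<le> card (components n E)"
    "component E v \<noteq> component E w \<Longrightarrow> Suc (card (components n (add_edge E v w))) \<le> card (components n E)"
proof -
  let ?V = "component E v" and ?W = "component E w" and ?C = "components n E"
  have m: "?V \<in> ?C" "?W \<in> ?C" using assms component_in_components by auto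
  have le: "card (components n (add_edge E v w)) \<le> Suc (card (?C - {?V, ?W}))"
    unfolding components_add_edge[OF assms] by (rule card_insert_le_m1) simp_all
  have "card (?C - {?V, ?W}) \<le> card (?C - {?V})" by (intro card_mono) auto
  then show "card (components n (add_edge E v w)) \<le> card ?C"
    using le m card_Suc_Diff1[of ?C ?V] by simp
  assume "?V \<noteq> ?W"
  then show "Suc (card (components n (add_edge E v w))) \<le> card ?C"
    using le card_remove_two[OF _ m] by simp
qed

definition nontrivial_components :: "nat \<Rightarrow> nat set set \<Rightarrow> nat set set" where
  "nontrivial_components n E = {A \<in> components n E. 2 \<le> card A}"

lemma finite_nontrivial [simp]: "finite (nontrivial_components n E)"
  by (simp add: nontrivial_components_def)

lemma card_nontrivial_add_edge:
  fixes E :: "nat set set"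
  assumes vw: "v \<in> {1..n}" "w \<in> {1..n}"
  defines "B \<equiv> nontrivial_components n E" and "B' \<equiv> nontrivial_components n (add_edge E v w)"
  shows "card B' \<le> Suc (card B)"
    "v = w \<or> component E v \<in> B \<or> component E w \<in> B \<Longrightarrow> card B' \<le> card B"
    "component E v \<in> B \<Longrightarrow> component E w \<in> B \<Longrightarrow> component E v \<noteq> component E w \<Longrightarrow> Suc (card B') \<le> card B"
proof -
  let ?V = "component E v" and ?W = "component E w"
  have fin: "finite B" by (simp add: B_def)
  have sub: "B' \<subseteq> insert (?V \<union> ?W) (B - {?V, ?W})"
    unfolding B_def B'_def nontrivial_components_def components_add_edge[OF vw] by auto
  have "card B' \<le> card (insert (?V \<union> ?W) (B - {?V, ?W}))"
    using sub fin by (intro card_mono) auto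
  also have "\<dots> \<le> Suc (card (B - {?V, ?W}))" by (simp add: card_insert_if fin)
  finally have le: "card B' \<le> Suc (card (B - {?V, ?W}))" .
  have le1: "card (B - {?V, ?W}) \<le> card (B - {?V})" "card (B - {?V, ?W}) \<le> card (B - {?W})"
    "card (B - {?V, ?W}) \<le> card B"
    using fin by (auto intro!: card_mono)
  show "card B' \<le> Suc (card B)" using le le1 by simp
  show "card B' \<le> card B" if "v = w \<or> ?V \<in> B \<or> ?W \<in> B"
    using that
  proof (elim disjE)
    assume "v = w"
    then show ?thesis by (simp add: B_def B'_def add_edge_def)
  next
    assume "?V \<in> B"
    then show ?thesis using le le1(1) card_Suc_Diff1[OF fin, of ?V] by simp
  next
    assume "?W \<in> B"
    then show ?thesis using le le1(2) card_Suc_Diff1[OF fin, of ?W] by simp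
  qed
  assume "?V \<in> B" "?W \<in> B" "?V \<noteq> ?W"
  then show "Suc (card B') \<le> card B" using le card_remove_two[OF fin] by fastforce
qed

lemma sum_over_components:
  fixes f :: "nat set \<Rightarrow> nat"
  assumes E: "E \<in> simple_graphs n"
  shows "(\<Sum>v\<in>{v \<in> {1..n}. P (component E v)}. f (component E v))
    = (\<Sum>A\<in>{A \<in> components n E. P A}. card A * f A)"
proof -
  have "(\<Sum>v\<in>{v \<in> {1..n}. P (component E v)}. f (component E v))
      = (\<Sum>A\<in>{A \<in> components n E. P A}.
          \<Sum>v\<in>{v \<in> {v \<in> {1..n}. P (component E v)}. component E v = A}. f (component E v))"
    by (rule sum.group[symmetric]) (auto simp: components_def)
  also have "\<dots> = (\<Sum>A\<in>{A \<in> components n E. P A}. card A * f A)"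
  proof (rule sum.cong[OF refl])
    fix A assume A: "A \<in> {A \<in> components n E. P A}"
    then obtain x where x: "x \<in> {1..n}" "A = component E x" "P A" by (auto simp: components_def)
    have "{v \<in> {v \<in> {1..n}. P (component E v)}. component E v = A} = A"
      using x component_subset[OF E x(1)] in_component_iff[of _ E x] by auto
    then have "(\<Sum>v\<in>{v \<in> {v \<in> {1..n}. P (component E v)}. component E v = A}. f (component E v))
        = (\<Sum>v\<in>A. f (component E v))" by simp
    also have "\<dots> = (\<Sum>v\<in>A. f A)" using x in_component_iff by (intro sum.cong) auto
    finally show "(\<Sum>v\<in>{v \<in> {v \<in> {1..n}. P (component E v)}. component E v = A}. f (component E v))
        = card A * f A" by simp
  qed
  finally show ?thesis .
qed

lemma card_by_components:
  "E \<in> simple_graphs n \<Longrightarrow>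
    card {v \<in> {1..n}. P (component E v)} = (\<Sum>A\<in>{A \<in> components n E. P A}. card A)"
  using sum_over_components[where P = P and f = "\<lambda>_. 1"] by simp

text \<open>For each \<open>a\<close>, every component other than that of \<open>a\<close> contributes at least one \<open>b\<close>.\<close>

lemma cross_pairs_ge:
  assumes E: "E \<in> simple_graphs n"
  shows "n * (card (components n E) - 1)
    \<le> card {(a, b). a \<in> {1..n} \<and> b \<in> {1..n} \<and> component E a \<noteq> component E b}"
proof -
  have "{(a, b). a \<in> {1..n} \<and> b \<in> {1..n} \<and> component E a \<noteq> component E b}
     = (SIGMA a:{1..n}. {b \<in> {1..n}. component E a \<noteq> component E b})" by auto
  moreover have "card (components n E) - 1 \<le> card {b \<in> {1..n}. component E a \<noteq> component E b}"
    if a: "a \<in> {1..n}" for a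
  proof -
    have "card (components n E) - 1 = card (components n E - {component E a})"
      using component_in_components[OF a] by simp
    also have "components n E - {component E a} = component E ` {b \<in> {1..n}. component E a \<noteq> component E b}"
      unfolding components_def by auto
    also have "card \<dots> \<le> card {b \<in> {1..n}. component E a \<noteq> component E b}"
      by (intro card_image_le) simp
    finally show ?thesis .
  qed
  then have "(\<Sum>a\<in>{1..n}. card (components n E) - 1)
     \<le> (\<Sum>a\<in>{1..n}. card {b \<in> {1..n}. component E a \<noteq> component E b})"
    by (intro sum_mono) auto
  ultimately show ?thesis by simp
qed

text \<open>The worst case is one part of size \<open>b = w - (card Q - 1) * a\<close> and all others of the minimal size
\<open>a\<close>. Every part lies between \<open>a\<close> and \<open>b\<close>, so \<open>(s A - a) * (b - s A) \<ge> 0\<close>, which bounds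
\<open>s A * (w - s A)\<close> below by a linear function of \<open>s A\<close> with equality at both extremes.\<close>

lemma sum_products_ge:
  fixes s :: "'b \<Rightarrow> real"
  assumes fin: "finite Q" and s: "\<And>A. A \<in> Q \<Longrightarrow> a \<le> s A" and w: "w = (\<Sum>A\<in>Q. s A)"
  shows "a * (real (card Q) - 1) * (2 * w - real (card Q) * a) \<le> (\<Sum>A\<in>Q. s A * (w - s A))"
proof -
  define q where "q = real (card Q)"
  define b where "b = w - (q - 1) * a"
  have "s A * (w - s A) \<ge> s A * ((q - 2) * a) + a * b" if A: "A \<in> Q" for A
  proof -
    have "(\<Sum>B\<in>Q - {A}. a) \<le> (\<Sum>B\<in>Q - {A}. s B)" using s by (intro sum_mono) auto
    moreover have "w = s A + (\<Sum>B\<in>Q - {A}. s B)" unfolding w using fin A by (rule sum.remove)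
    moreover have "real (card (Q - {A})) = q - 1"
      using A fin card_gt_0_iff[of Q] by (subst card_Diff_singleton) (auto simp: q_def of_nat_diff Suc_leI)
    ultimately have "s A \<le> b" by (simp add: b_def)
    then have "0 \<le> (s A - a) * (b - s A)" using s[OF A] by simp
    moreover have "s A * (w - s A) - (s A * ((q - 2) * a) + a * b) = (s A - a) * (b - s A)"
      by (simp add: b_def algebra_simps)
    ultimately show ?thesis by linarith
  qed
  then have "(\<Sum>A\<in>Q. s A * ((q - 2) * a) + a * b) \<le> (\<Sum>A\<in>Q. s A * (w - s A))" by (rule sum_mono)
  moreover have "(\<Sum>A\<in>Q. s A * ((q - 2) * a) + a * b) = w * ((q - 2) * a) + q * (a * b)"
    by (simp add: sum.distrib w q_def flip: sum_distrib_right)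
  moreover have "w * ((q - 2) * a) + q * (a * b) = a * (q - 1) * (2 * w - q * a)"
    by (simp add: b_def algebra_simps)
  ultimately show ?thesis by (simp add: q_def)
qed

section \<open>Exceptional positions in a tuple\<close>

text \<open>Since \<open>A\<close> and \<open>D\<close> are disjoint, the exceptional position \<open>q\<close> is determined by the tuple.\<close>

lemma card_one_special:
  assumes l: "even l" "l \<ge> 2" and A: "A \<subseteq> {1..n}" and D: "D \<subseteq> {1..n}" and AD: "A \<inter> D = {}"
  shows "card {vs \<in> vertex_tuples l n. \<exists>q<l. vs ! q \<in> A \<and> (\<forall>p<l. p \<noteq> q \<longrightarrow> vs ! p \<in> D)}
    = l * (card A * card D ^ (l - 1))"
proof -
  define S where "S q = (if even q then A \<times> D else D \<times> A)" for q :: nat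
  define T where "T q = {vs \<in> vertex_tuples l n. \<forall>j<l div 2.
      (vs ! (2 * j), vs ! (2 * j + 1)) \<in> (if j = q div 2 then S q else D \<times> D)}" for q
  have T: "T q = {vs \<in> vertex_tuples l n. vs ! q \<in> A \<and> (\<forall>p<l. p \<noteq> q \<longrightarrow> vs ! p \<in> D)}" if q: "q < l" for q
  proof -
    have "(\<forall>j<l div 2. (vs ! (2 * j), vs ! (2 * j + 1)) \<in> (if j = q div 2 then S q else D \<times> D))
       \<longleftrightarrow> vs ! q \<in> A \<and> (\<forall>p<l. p \<noteq> q \<longrightarrow> vs ! p \<in> D)" for vs :: "nat list"
    proof (intro iffI conjI allI impI)
      assume H: "\<forall>j<l div 2. (vs ! (2 * j), vs ! (2 * j + 1)) \<in> (if j = q div 2 then S q else D \<times> D)"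
      have K: "(p = q \<longrightarrow> vs ! p \<in> A) \<and> (p \<noteq> q \<longrightarrow> vs ! p \<in> D)" if p: "p < l" for p
      proof -
        have "p div 2 < l div 2" using p l by auto
        then have *: "(vs ! (2 * (p div 2)), vs ! (2 * (p div 2) + 1))
            \<in> (if p div 2 = q div 2 then S q else D \<times> D)" using H by blast
        have "p = 2 * (p div 2) \<or> p = 2 * (p div 2) + 1" by linarith
        moreover have "p = q \<or> p div 2 \<noteq> q div 2 \<or> even p \<noteq> even q" by presburger
        ultimately show ?thesis using * unfolding S_def by (auto split: if_splits)
      qed
      show "vs ! q \<in> A" using K[OF q] by simp
      show "vs ! p \<in> D" if "p < l" "p \<noteq> q" for p using K that by simp
    next
      fix j assume H: "vs ! q \<in> A \<and> (\<forall>p<l. p \<noteq> q \<longrightarrow> vs ! p \<in> D)" and "j < l div 2"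
      then have j: "2 * j < l" "2 * j + 1 < l" using l by auto
      have D: "p < l \<Longrightarrow> p \<noteq> q \<Longrightarrow> vs ! p \<in> D" for p using H by blast
      have "q = 2 * j \<or> q = 2 * j + 1 \<or> j \<noteq> q div 2" by linarith
      then show "(vs ! (2 * j), vs ! (2 * j + 1)) \<in> (if j = q div 2 then S q else D \<times> D)"
        using H D[OF j(1)] D[OF j(2)] unfolding S_def by auto
    qed
    then show ?thesis unfolding T_def by simp
  qed
  have cT: "card (T q) = card A * card D ^ (l - 1)" if q: "q < l" for q
  proof -
    have "q div 2 < l div 2" using q l by auto
    then have "card (T q) = card (S q) * card D ^ (l - 2)"
      unfolding T_def using A D by (intro card_one_pair l) (auto simp: S_def)
    moreover have "card (S q) = card A * card D" by (simp add: S_def card_cartesian_product)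
    moreover obtain k where "l = Suc (Suc k)" using l(2) by (metis add_2_eq_Suc le_Suc_ex)
    ultimately show ?thesis by simp
  qed
  have "{vs \<in> vertex_tuples l n. \<exists>q<l. vs ! q \<in> A \<and> (\<forall>p<l. p \<noteq> q \<longrightarrow> vs ! p \<in> D)} = (\<Union>q<l. T q)"
    using T by auto
  moreover have "card (\<Union>q<l. T q) = (\<Sum>q<l. card (T q))"
  proof (rule card_UN_disjoint)
    show "\<forall>q\<in>{..<l}. finite (T q)" by (simp add: T_def finite_vertex_tuples)
    show "\<forall>i\<in>{..<l}. \<forall>j\<in>{..<l}. i \<noteq> j \<longrightarrow> T i \<inter> T j = {}"
    proof (intro ballI impI)
      fix i j assume ij: "i \<in> {..<l}" "j \<in> {..<l}" "i \<noteq> j"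
      have "vs ! i \<in> A \<and> vs ! i \<in> D" if "vs \<in> T i" "vs \<in> T j" for vs
        using that ij T[of i] T[of j] by auto
      then show "T i \<inter> T j = {}" using AD by blast
    qed
  qed simp
  ultimately show ?thesis using cT by simp
qed

lemma card_first_pair:
  assumes l: "even l" "l \<ge> 2" and D: "D \<subseteq> {1..n}" and X: "X \<subseteq> D \<times> D"
  shows "card {vs \<in> vertex_tuples l n. set vs \<subseteq> D \<and> (vs ! 0, vs ! 1) \<in> X} = card X * card D ^ (l - 2)"
proof -
  have l0: "0 < l div 2" using l by auto
  have "{vs \<in> vertex_tuples l n. set vs \<subseteq> D \<and> (vs ! 0, vs ! 1) \<in> X} = {vs \<in> vertex_tuples l n.
      \<forall>i<l div 2. (vs ! (2 * i), vs ! (2 * i + 1)) \<in> (if i = 0 then X else D \<times> D)}"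
  proof (rule Collect_cong, rule conj_cong[OF refl])
    fix vs assume "vs \<in> vertex_tuples l n"
    then have len: "length vs = 2 * (l div 2)" using l by (simp add: vertex_tuples_def)
    show "set vs \<subseteq> D \<and> (vs ! 0, vs ! 1) \<in> X
       \<longleftrightarrow> (\<forall>i<l div 2. (vs ! (2 * i), vs ! (2 * i + 1)) \<in> (if i = 0 then X else D \<times> D))"
      unfolding set_subset_iff_pairs[OF len] using X l0 by (force split: if_splits)
  qed
  then show ?thesis using card_one_pair[OF l(1) l0 _ D, of X] X D by (simp add: subset_iff)
qed

lemma card_isolated_pairs_le:
  assumes l: "even l" and I: "I \<subseteq> {1..n}"
  shows "card {vs \<in> vertex_tuples l n. \<exists>i<l div 2. vs ! (2 * i) \<in> I \<and> vs ! (2 * i + 1) \<in> I \<and> vs ! (2 * i) \<noteq> vs ! (2 * i + 1)}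
    \<le> l * (card I * (card I - 1)) * n ^ (l - 2)"
proof -
  define Z where "Z = I \<times> I - (\<lambda>x. (x, x)) ` I"
  have finI: "finite I" using I finite_subset by blast
  have "card Z = card (I \<times> I) - card ((\<lambda>x. (x, x)) ` I)"
    unfolding Z_def using finI by (intro card_Diff_subset) auto
  also have "\<dots> = card I * (card I - 1)"
    by (simp add: card_cartesian_product card_image inj_on_def diff_mult_distrib2)
  finally have cZ: "card Z = card I * (card I - 1)" .
  have "Z \<subseteq> {1..n} \<times> {1..n}" using I by (auto simp: Z_def)
  moreover have "(v, w) \<in> Z \<longleftrightarrow> v \<in> I \<and> w \<in> I \<and> v \<noteq> w" for v w by (auto simp: Z_def)
  ultimately show ?thesis using card_some_pair_le[OF l, of Z n] cZ by simp
qed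


section \<open>The drift of the merging potential\<close>

text \<open>All other candidate edges have type \<open>(\<infinity>, \<infinity>)\<close>.\<close>

lemma lex_choice_one_small:
  fixes E :: "nat set set"
  assumes len: "length vs = l" "l \<ge> 2" "even l" and q: "q < l" "card (component E (vs ! q)) \<le> K"
    and large: "\<And>p. p < l \<Longrightarrow> p \<noteq> q \<Longrightarrow> K < card (component E (vs ! p))"
  shows "lex_choice K E vs = q div 2"
proof (rule ccontr)
  define f where "f = truncated_size K E"
  define i where "i = lex_choice K E vs"
  assume "lex_choice K E vs \<noteq> q div 2"
  then have ne: "i \<noteq> q div 2" by (simp add: i_def)
  note spec = lex_choice_spec[OF len, where K = K and E = E, folded i_def f_def]
  have i: "2 * i < l" "2 * i + 1 < l" using spec(1) len(3) by auto
  have "2 * i \<noteq> q" "2 * i + 1 \<noteq> q" using ne by auto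
  then have inf: "f (vs ! (2 * i)) = \<infinity>" "f (vs ! (2 * i + 1)) = \<infinity>"
    using large[OF i(1)] large[OF i(2)] by (simp_all add: f_def truncated_size_def)
  have fq: "f (vs ! q) \<noteq> \<infinity>" using q by (simp add: f_def truncated_size_def)
  define k where "k = q div 2"
  have k: "k < l div 2" using q len(3) by (auto simp: k_def elim!: evenE)
  have "q = 2 * k \<or> q = 2 * k + 1" unfolding k_def by linarith
  then have "min (f (vs ! (2 * k))) (f (vs ! (2 * k + 1))) \<le> f (vs ! q)" by auto
  moreover have "f (vs ! q) < \<infinity>" using fq by simp
  ultimately have "min (f (vs ! (2 * k))) (f (vs ! (2 * k + 1))) < \<infinity>" by (rule le_less_trans)
  moreover have "min (f (vs ! (2 * i))) (f (vs ! (2 * i + 1))) \<le> min (f (vs ! (2 * k))) (f (vs ! (2 * k + 1)))"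
    using lex_le_fst[OF spec(2)[OF k]] by simp
  ultimately show False unfolding inf by simp
qed

text \<open>All candidate edges have type \<open>(\<infinity>, \<infinity>)\<close>, and ties are broken in favour of the first one.\<close>

lemma lex_choice_all_large:
  fixes E :: "nat set set"
  assumes len: "length vs = l" "l \<ge> 2" "even l"
    and large: "\<And>p. p < l \<Longrightarrow> K < card (component E (vs ! p))"
  shows "lex_choice K E vs = 0"
proof -
  note spec = lex_choice_spec[OF len, where K = K and E = E]
  have inf: "truncated_size K E (vs ! p) = \<infinity>" if "p < l" for p
    using large[OF that] by (simp add: truncated_size_def)
  have pl: "2 * j < l" "2 * j + 1 < l" if "j < l div 2" for j using that len(3) by auto
  have l0: "0 < l div 2" using len(2) by auto
  have "lex_choice K E vs \<le> 0"
    by (rule spec(3)[OF l0]) (simp add: inf pl pl[OF l0] pl(2)[OF l0, simplified] lex_le_def)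
  then show ?thesis by simp
qed

lemma sum_of_bool_mem:
  "finite T \<Longrightarrow> A \<subseteq> T \<Longrightarrow> (\<Sum>x\<in>T. of_bool (x \<in> A)) = real (card A)"
  by (simp add: sum_of_bool_eq Int_absorb1)

text \<open>Two disjoint sets of tuples certainly merge two nontrivial components: exactly one entry in
a component of medium size (in \<open>R\<close>) and all others in large components (in \<open>W\<close>), or all entries in
large components with the first pair crossing. A new nontrivial component needs a candidate edge
that joins two distinct isolated vertices.\<close>

lemma nontrivial_components_drift:
  fixes E :: "nat set set" and n l K :: nat
  assumes E: "E \<in> simple_graphs n" and l: "even l" "l \<ge> 2" and K: "K \<ge> 1"
  defines "W \<equiv> {v \<in> {1..n}. K < card (component E v)}"
    and "R \<equiv> {v \<in> {1..n}. 2 \<le> card (component E v) \<and> card (component E v) \<le> K}"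
    and "Y \<equiv> card (isolated_vertices n E)"
  defines "X \<equiv> {(a, b). a \<in> W \<and> b \<in> W \<and> component E a \<noteq> component E b}"
  shows "(\<Sum>vs\<in>vertex_tuples l n. real (card (nontrivial_components n (next_graph E vs (lex_choice K E vs)))))
    \<le> real n ^ l * real (card (nontrivial_components n E))
      - (real l * (real (card R) * real (card W) ^ (l - 1)) + real (card X) * real (card W) ^ (l - 2))
      + real l * real (Y * (Y - 1)) * real n ^ (l - 2)"
proof -
  define T where "T = vertex_tuples l n"
  define I where "I = isolated_vertices n E"
  define B where "B = nontrivial_components n E"
  define B' where "B' vs = nontrivial_components n (next_graph E vs (lex_choice K E vs))" for vs
  define T1 where "T1 = {vs \<in> T. \<exists>q<l. vs ! q \<in> R \<and> (\<forall>p<l. p \<noteq> q \<longrightarrow> vs ! p \<in> W)}"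
  define T2 where "T2 = {vs \<in> T. set vs \<subseteq> W \<and> (vs ! 0, vs ! 1) \<in> X}"
  define U where "U = {vs \<in> T. \<exists>i<l div 2. vs ! (2 * i) \<in> I \<and> vs ! (2 * i + 1) \<in> I \<and> vs ! (2 * i) \<noteq> vs ! (2 * i + 1)}"
  have fin: "finite T" by (simp add: T_def finite_vertex_tuples)
  have RW: "R \<inter> W = {}" by (auto simp: R_def W_def)
  have sub: "R \<subseteq> {1..n}" "W \<subseteq> {1..n}" "I \<subseteq> {1..n}" "X \<subseteq> W \<times> W"
    by (auto simp: R_def W_def I_def isolated_vertices_def X_def)
  have T12: "T1 \<inter> T2 = {}"
  proof -
    have "vs \<notin> T2" if v1: "vs \<in> T1" for vs
    proof
      assume v2: "vs \<in> T2"
      obtain q where "q < l" "vs ! q \<in> R" using v1 by (auto simp: T1_def)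
      moreover have "length vs = l" using v1 by (simp add: T1_def T_def vertex_tuples_def)
      ultimately have "vs ! q \<in> W" using v2 nth_mem by (auto simp: T2_def)
      then show False using \<open>vs ! q \<in> R\<close> RW by auto
    qed
    then show ?thesis by blast
  qed
  have big: "component E v \<in> B" if "v \<in> R \<union> W" for v
    using that K component_in_components by (auto simp: B_def nontrivial_components_def R_def W_def)
  have pointwise: "real (card (B' vs)) \<le> real (card B) - of_bool (vs \<in> T1) - of_bool (vs \<in> T2) + of_bool (vs \<in> U)"
    if vs: "vs \<in> T" for vs
  proof -
    have len: "length vs = l" using vs by (simp add: T_def vertex_tuples_def)
    define i where "i = lex_choice K E vs"
    have i: "i < l div 2" unfolding i_def by (rule lex_choice_spec(1)[OF len l(2,1)])
    then have il: "2 * i < l" "2 * i + 1 < l" using l by auto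
    define v where "v = vs ! (2 * i)"
    define w where "w = vs ! (2 * i + 1)"
    have vw: "v \<in> {1..n}" "w \<in> {1..n}"
      using vertex_tuples_nth[of vs l n] vs il unfolding T_def v_def w_def by auto
    have B': "B' vs = nontrivial_components n (add_edge E v w)"
      by (simp add: B'_def next_graph_def i_def v_def w_def)
    note add = card_nontrivial_add_edge[OF vw, where E = E, folded B_def B']
    consider (one) "vs \<in> T1" "vs \<notin> T2" | (two) "vs \<in> T2" "vs \<notin> T1" | (up) "vs \<notin> T1" "vs \<notin> T2" "vs \<in> U"
      | (rest) "vs \<notin> T1" "vs \<notin> T2" "vs \<notin> U" using T12 by blast
    then show ?thesis
    proof cases
      case one
      then obtain q where q: "q < l" "vs ! q \<in> R" "\<And>p. p < l \<Longrightarrow> p \<noteq> q \<Longrightarrow> vs ! p \<in> W"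
        by (auto simp: T1_def)
      have "i = q div 2" unfolding i_def
        using q by (intro lex_choice_one_small[OF len l(2,1)]) (auto simp: R_def W_def)
      then have "q = 2 * i \<or> q = 2 * i + 1" by linarith
      then have "v \<in> R \<and> w \<in> W \<or> v \<in> W \<and> w \<in> R"
      proof
        assume e: "q = 2 * i"
        then have "w \<in> W" unfolding w_def using q(3)[OF il(2)] by simp
        then show ?thesis using q(2) e by (simp add: v_def)
      next
        assume e: "q = 2 * i + 1"
        then have "v \<in> W" unfolding v_def using q(3)[OF il(1)] by simp
        then show ?thesis using q(2) e by (simp add: w_def)
      qed
      moreover from this have "component E v \<noteq> component E w" by (auto simp: R_def W_def)
      ultimately have "Suc (card (B' vs)) \<le> card B" using big by (intro add(3)) auto
      then show ?thesis using one by simp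
    next
      case two
      then have W: "vs ! p \<in> W" if "p < l" for p using that len nth_mem by (auto simp: T2_def)
      have "i = 0" unfolding i_def using W by (intro lex_choice_all_large[OF len l(2,1)]) (auto simp: W_def)
      then have "(v, w) \<in> X" using two by (simp add: T2_def v_def w_def)
      then have "Suc (card (B' vs)) \<le> card B" using big by (intro add(3)) (auto simp: X_def)
      then show ?thesis using two by simp
    next
      case up
      then show ?thesis using add(1) by simp
    next
      case rest
      have "v = w \<or> component E v \<in> B \<or> component E w \<in> B"
      proof (rule ccontr)
        assume H: "\<not> (v = w \<or> component E v \<in> B \<or> component E w \<in> B)"
        have "x \<in> I" if "x \<in> {1..n}" "component E x \<notin> B" for x
        proof -
          have "\<not> 2 \<le> card (component E x)"
            using that component_in_components by (auto simp: B_def nontrivial_components_def)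
          then have "card (component E x) = 1" using card_component_pos[OF E that(1)] by linarith
          then show ?thesis using component_isolated_iff[OF E that(1)] by (simp add: I_def)
        qed
        then have "v \<in> I" "w \<in> I" "v \<noteq> w" using H vw by auto
        then have "vs \<in> U" using vs i unfolding U_def v_def w_def by blast
        then show False using rest by simp
      qed
      then show ?thesis using add(2) rest by simp
    qed
  qed
  have cT1: "real (card T1) = real l * (real (card R) * real (card W) ^ (l - 1))"
    unfolding T1_def T_def using card_one_special[OF l sub(1,2) RW] by simp
  have cT2: "real (card T2) = real (card X) * real (card W) ^ (l - 2)"
    unfolding T2_def T_def using card_first_pair[OF l sub(2,4)] by simp
  have "card U \<le> l * (card I * (card I - 1)) * n ^ (l - 2)"
    unfolding U_def T_def by (rule card_isolated_pairs_le[OF l(1) sub(3)])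
  then have "real (card U) \<le> real (l * (card I * (card I - 1)) * n ^ (l - 2))" by (rule of_nat_mono)
  also have "\<dots> = real l * real (Y * (Y - 1)) * real n ^ (l - 2)" by (simp add: Y_def I_def)
  finally have cU: "real (card U) \<le> real l * real (Y * (Y - 1)) * real n ^ (l - 2)" .
  have "(\<Sum>vs\<in>T. real (card (B' vs)))
     \<le> (\<Sum>vs\<in>T. real (card B) - of_bool (vs \<in> T1) - of_bool (vs \<in> T2) + of_bool (vs \<in> U))"
    by (intro sum_mono pointwise)
  also have "\<dots> = real (card T) * real (card B) - real (card T1) - real (card T2) + real (card U)"
  proof -
    have "T1 \<subseteq> T" "T2 \<subseteq> T" "U \<subseteq> T" by (auto simp: T1_def T2_def U_def)
    then show ?thesis by (simp only: sum.distrib sum_subtractf sum_of_bool_mem[OF fin] sum_constant)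
  qed
  finally show ?thesis using cT1 cT2 cU by (simp add: T_def B'_def B_def card_vertex_tuples)
qed

text \<open>The falling factorial \<open>Y * (Y - 1)\<close> is used because it counts exactly the ordered pairs that can
create a nontrivial component; it drops by \<open>2 * (Y - 1)\<close> when \<open>Y\<close> drops by 1. It suffices to
consider tuples with exactly one isolated entry, for which the lexicographic choice takes it.\<close>

lemma isolated_pairs_drift:
  fixes E :: "nat set set" and n l K :: nat
  assumes E: "E \<in> simple_graphs n" and l: "even l" "l \<ge> 2" and K: "K \<ge> 1"
  defines "Y \<equiv> card (isolated_vertices n E)"
    and "Y' \<equiv> \<lambda>vs. card (isolated_vertices n (next_graph E vs (lex_choice K E vs)))"
  shows "(\<Sum>vs\<in>vertex_tuples l n. real (Y' vs * (Y' vs - 1)))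
    \<le> real n ^ l * real (Y * (Y - 1)) - 2 * real l * real (Y * (Y - 1)) * real (n - Y) ^ (l - 1)"
proof -
  define T where "T = vertex_tuples l n"
  define I where "I = isolated_vertices n E"
  define P where "P = {vs \<in> T. \<exists>q<l. vs ! q \<in> I \<and> (\<forall>p<l. p \<noteq> q \<longrightarrow> vs ! p \<in> {1..n} - I)}"
  have fin: "finite T" by (simp add: T_def finite_vertex_tuples)
  have I: "I \<subseteq> {1..n}" by (auto simp: I_def isolated_vertices_def)
  have le: "Y' vs \<le> Y" if "vs \<in> T" for vs
  proof -
    have "lex_choice K E vs < l div 2"
      using that lex_choice_spec(1)[OF _ l(2,1)] by (simp add: T_def vertex_tuples_def)
    then show ?thesis using that isolated_next_graph(1)[of vs l n _ E] by (simp add: T_def Y_def Y'_def)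
  qed
  have drop: "Y = Suc (Y' vs)" if vsP: "vs \<in> P" for vs
  proof -
    obtain q where q: "q < l" "vs ! q \<in> I" "\<And>p. p < l \<Longrightarrow> p \<noteq> q \<Longrightarrow> vs ! p \<notin> I" and vs: "vs \<in> T"
      using vsP by (auto simp: P_def)
    have len: "length vs = l" using vs by (simp add: T_def vertex_tuples_def)
    have nopair: "\<not> (vs ! (2 * j) \<in> I \<and> vs ! (2 * j + 1) \<in> I)" if "j < l div 2" for j
    proof -
      have "2 * j < l" "2 * j + 1 < l" using that l by auto
      then show ?thesis using q(3)[of "2 * j"] q(3)[of "2 * j + 1"] by (cases "q = 2 * j") auto
    qed
    have "vs ! q \<in> set vs \<inter> I" using q len by auto
    then have "max_drop I vs = 1" using nopair len by (auto simp: max_drop_def)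
    moreover have "Y - Y' vs = max_drop I vs"
      unfolding Y_def Y'_def I_def
    proof (rule lex_choice_max_drop[OF E _ l(2,1) K])
      show "vs \<in> vertex_tuples l n" using vs by (simp add: T_def)
      fix j assume "j < l div 2"
      then show "\<not> (vs ! (2 * j) = vs ! (2 * j + 1) \<and> vs ! (2 * j) \<in> isolated_vertices n E)"
        using nopair[of j] by (auto simp: I_def)
    qed
    ultimately show ?thesis by simp
  qed
  have pointwise: "real (Y' vs * (Y' vs - 1)) \<le> real (Y * (Y - 1)) - 2 * real (Y - 1) * of_bool (vs \<in> P)"
    if vs: "vs \<in> T" for vs
  proof (cases "vs \<in> P")
    case True
    have "Y * (Y - 1) = Y' vs * (Y' vs - 1) + 2 * (Y - 1)"
      unfolding drop[OF True] by (cases "Y' vs") auto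
    then have "real (Y * (Y - 1)) = real (Y' vs * (Y' vs - 1) + 2 * (Y - 1))" by (rule arg_cong)
    then show ?thesis using True by simp
  next
    case False
    have "Y' vs * (Y' vs - 1) \<le> Y * (Y - 1)" using le[OF vs] by (intro mult_le_mono diff_le_mono) auto
    then have "real (Y' vs * (Y' vs - 1)) \<le> real (Y * (Y - 1))" by (rule of_nat_mono)
    then show ?thesis using False by simp
  qed
  have "card P = l * (card I * card ({1..n} - I) ^ (l - 1))"
    unfolding P_def T_def using I by (intro card_one_special l) auto
  also have "card ({1..n} - I) = n - Y"
    using I finite_subset[OF I] by (simp add: card_Diff_subset Y_def I_def)
  finally have cP: "real (card P) = real l * (real Y * real (n - Y) ^ (l - 1))" by (simp add: Y_def I_def)
  have "(\<Sum>vs\<in>T. real (Y' vs * (Y' vs - 1)))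
     \<le> (\<Sum>vs\<in>T. real (Y * (Y - 1)) - 2 * real (Y - 1) * of_bool (vs \<in> P))"
    by (intro sum_mono pointwise)
  also have "\<dots> = real (card T) * real (Y * (Y - 1)) - 2 * real (Y - 1) * real (card P)"
  proof -
    have "P \<subseteq> T" by (auto simp: P_def)
    then show ?thesis
      by (simp only: sum_subtractf sum_of_bool_mem[OF fin] sum_constant flip: sum_distrib_left)
  qed
  also have "2 * real (Y - 1) * real (card P) = 2 * real l * real (Y * (Y - 1)) * real (n - Y) ^ (l - 1)"
    unfolding cP by (simp add: mult_ac)
  finally show ?thesis by (simp add: T_def card_vertex_tuples)
qed

text \<open>With at most \<open>\<delta> * n\<close> components, at most \<open>K * \<delta> * n\<close> vertices lie in components of at most \<open>K\<close>
vertices, so up to the factor \<open>\<gamma>\<close> all vertices lie in large components. \<open>Bs\<close> and \<open>Q\<close> count the nontrivial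
components with at most and with more than \<open>K\<close> vertices.\<close>

lemma few_components_bounds:
  fixes E :: "nat set set" and n K :: nat and \<delta> :: real
  assumes E: "E \<in> simple_graphs n" and n: "n \<ge> 1" and K: "K \<ge> 1"
    and few: "real (card (components n E)) \<le> \<delta> * real n" and \<delta>: "\<delta> > 0" "2 * (real K + 1) * \<delta> < 1"
  defines "\<gamma> \<equiv> 1 - 2 * (real K + 1) * \<delta>"
  defines "W \<equiv> {v \<in> {1..n}. K < card (component E v)}"
    and "R \<equiv> {v \<in> {1..n}. 2 \<le> card (component E v) \<and> card (component E v) \<le> K}"
  defines "X \<equiv> {(a, b). a \<in> W \<and> b \<in> W \<and> component E a \<noteq> component E b}"
  obtains Bs Q where "card (nontrivial_components n E) = Bs + Q" "Q \<ge> 1" "2 * Bs \<le> card R"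
    "real n * \<gamma> \<le> real (card W)" "real n * \<gamma> \<le> real (n - card (isolated_vertices n E))"
    "2 * (real K + 1) * (real Q - 1) * (real n * \<gamma>) \<le> real (card X)"
proof -
  let ?C = "components n E"
  define \<B> where "\<B> = {A \<in> ?C. 2 \<le> card A \<and> card A \<le> K}"
  define \<Q> where "\<Q> = {A \<in> ?C. K < card A}"
  have fin: "finite \<B>" "finite \<Q>" by (simp_all add: \<B>_def \<Q>_def)
  have "nontrivial_components n E = \<B> \<union> \<Q>"
    using K by (auto simp: nontrivial_components_def \<B>_def \<Q>_def)
  then have 1: "card (nontrivial_components n E) = card \<B> + card \<Q>"
    using fin by (simp add: card_Un_disjoint disjoint_iff \<B>_def \<Q>_def)
  have cR: "card R = (\<Sum>A\<in>\<B>. card A)"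
    unfolding R_def \<B>_def by (rule card_by_components[OF E])
  have "(\<Sum>A\<in>\<B>. 2) \<le> (\<Sum>A\<in>\<B>. card A)" by (intro sum_mono) (simp add: \<B>_def)
  then have 3: "2 * card \<B> \<le> card R" using cR by simp
  have cW: "card W = (\<Sum>A\<in>\<Q>. card A)"
    unfolding W_def \<Q>_def by (rule card_by_components[OF E])
  have nW: "real n - real K * (\<delta> * real n) \<le> real (card W)"
  proof -
    define Z where "Z = {v \<in> {1..n}. card (component E v) \<le> K}"
    have "{1..n} = W \<union> Z" "W \<inter> Z = {}" "finite W" "finite Z" by (auto simp: W_def Z_def)
    then have "card {1..n} = card W + card Z" by (metis card_Un_disjoint)
    also have "card Z = card {v \<in> {1..n}. card (component E v) \<le> K}" by (simp add: Z_def)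
    also have "card {v \<in> {1..n}. card (component E v) \<le> K} = (\<Sum>A\<in>{A \<in> ?C. card A \<le> K}. card A)"
      by (rule card_by_components[OF E])
    also have "\<dots> \<le> (\<Sum>A\<in>{A \<in> ?C. card A \<le> K}. K)" by (intro sum_mono) simp
    also have "\<dots> \<le> K * card ?C" by (simp add: mult.commute card_mono)
    finally have "n \<le> card W + K * card ?C" by simp
    then have "real n \<le> real (card W + K * card ?C)" by (rule of_nat_mono)
    moreover have "real K * real (card ?C) \<le> real K * (\<delta> * real n)" using few by (intro mult_left_mono) auto
    ultimately show ?thesis by simp
  qed
  have dn: "0 \<le> \<delta> * real n" using \<delta> by simp
  have \<gamma>n: "real n * \<gamma> = real n - 2 * (real K * (\<delta> * real n)) - 2 * (\<delta> * real n)"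
    by (simp add: \<gamma>_def algebra_simps)
  have Kdn: "0 \<le> real K * (\<delta> * real n)" using \<delta> by simp
  have 4: "real n * \<gamma> \<le> real (card W)" using nW \<gamma>n dn Kdn by linarith
  have \<gamma>pos: "0 < real n * \<gamma>" using n \<delta> by (simp add: \<gamma>_def)
  have 2: "card \<Q> \<ge> 1"
  proof (rule ccontr)
    assume "\<not> 1 \<le> card \<Q>"
    then have "\<Q> = {}" using fin by (simp add: not_le)
    then show False using 4 \<gamma>pos cW by simp
  qed
  have 5: "real n * \<gamma> \<le> real (n - card (isolated_vertices n E))"
  proof -
    have "isolated_vertices n E = {v \<in> {1..n}. card (component E v) = 1}"
      using component_isolated_iff[OF E] by (auto simp: isolated_vertices_def)
    then have "card (isolated_vertices n E) = (\<Sum>A\<in>{A \<in> ?C. card A = 1}. card A)"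
      using card_by_components[OF E, of "\<lambda>A. card A = 1"] by simp
    also have "\<dots> = card {A \<in> ?C. card A = 1}" by simp
    also have "\<dots> \<le> card ?C" by (intro card_mono) auto
    finally have "real (card (isolated_vertices n E)) \<le> \<delta> * real n" using few by simp
    moreover have "real (n - card (isolated_vertices n E)) = real n - real (card (isolated_vertices n E))"
      using card_isolated_le[of n E] by (rule of_nat_diff)
    ultimately show ?thesis using \<gamma>n dn Kdn by linarith
  qed
  have cX: "real (card X) = (\<Sum>A\<in>\<Q>. real (card A) * (real (card W) - real (card A)))"
  proof -
    have "X = (SIGMA a:W. {b \<in> W. component E a \<noteq> component E b})" by (auto simp: X_def)
    then have "card X = (\<Sum>a\<in>W. card {b \<in> W. component E a \<noteq> component E b})"
      by (simp add: W_def)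
    also have "\<dots> = (\<Sum>a\<in>W. card W - card (component E a))"
    proof (rule sum.cong[OF refl])
      fix a assume a: "a \<in> W"
      then have a1: "a \<in> {1..n}" "K < card (component E a)" by (auto simp: W_def)
      have sub: "component E a \<subseteq> W"
        using a1 component_subset[OF E a1(1)] in_component_iff[of _ E a] by (auto simp: W_def)
      have "{b \<in> W. component E a \<noteq> component E b} = W - component E a"
        using in_component_iff[of _ E a] by auto
      then show "card {b \<in> W. component E a \<noteq> component E b} = card W - card (component E a)"
        using sub by (simp add: card_Diff_subset finite_subset W_def)
    qed
    also have "\<dots> = (\<Sum>A\<in>\<Q>. card A * (card W - card A))"
      unfolding \<Q>_def using sum_over_components[OF E, where P = "\<lambda>A. K < card A" and f = "\<lambda>A. card W - card A"]
      by (simp add: W_def)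
    finally have "real (card X) = (\<Sum>A\<in>\<Q>. real (card A * (card W - card A)))" by simp
    also have "\<dots> = (\<Sum>A\<in>\<Q>. real (card A) * (real (card W) - real (card A)))"
    proof (rule sum.cong[OF refl])
      fix A assume "A \<in> \<Q>"
      then have "card A \<le> card W" unfolding cW using fin by (intro member_le_sum) auto
      then show "real (card A * (card W - card A)) = real (card A) * (real (card W) - real (card A))"
        by (simp add: of_nat_diff)
    qed
    finally show ?thesis .
  qed
  have "(real K + 1) * (real (card \<Q>) - 1) * (2 * real (card W) - real (card \<Q>) * (real K + 1)) \<le> real (card X)"
    unfolding cX using fin cW by (intro sum_products_ge) (auto simp: \<Q>_def)
  moreover have "(real K + 1) * (real (card \<Q>) - 1) * (2 * (real n * \<gamma>))
     \<le> (real K + 1) * (real (card \<Q>) - 1) * (2 * real (card W) - real (card \<Q>) * (real K + 1))"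
  proof (rule mult_left_mono)
    have "card \<Q> \<le> card ?C" unfolding \<Q>_def by (intro card_mono) auto
    then have "real (card \<Q>) \<le> \<delta> * real n" using few by simp
    then have "real (card \<Q>) * (real K + 1) \<le> (\<delta> * real n) * (real K + 1)" by (intro mult_right_mono) auto
    also have "\<dots> = real K * (\<delta> * real n) + \<delta> * real n" by (simp add: algebra_simps)
    finally show "2 * (real n * \<gamma>) \<le> 2 * real (card W) - real (card \<Q>) * (real K + 1)"
      using nW \<gamma>n dn Kdn by linarith
    show "0 \<le> (real K + 1) * (real (card \<Q>) - 1)" using 2 by simp
  qed
  moreover have "2 * (real K + 1) * (real (card \<Q>) - 1) * (real n * \<gamma>)
     = (real K + 1) * (real (card \<Q>) - 1) * (2 * (real n * \<gamma>))" by simp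
  ultimately have 6: "2 * (real K + 1) * (real (card \<Q>) - 1) * (real n * \<gamma>) \<le> real (card X)" by linarith
  show thesis by (rule that[OF 1 2 3 4 5 6])
qed

text \<open>The coefficient \<open>2 * l\<close> is large enough for the decay of \<open>Y * (Y - 1)\<close>, at a rate of about \<open>2 * l / n\<close>,
to pay for the nontrivial components created by isolated vertices and still leave a decay rate of
almost \<open>(l + 1) / n\<close>.\<close>

definition merge_potential :: "nat \<Rightarrow> nat \<Rightarrow> nat set set \<Rightarrow> real" where
  "merge_potential l n E = real (card (nontrivial_components n E)) - 1
     + 2 * real l * (real (card (isolated_vertices n E) * (card (isolated_vertices n E) - 1)) / real n)"

text \<open>What matters is that the rate \<open>(l + 1) / n\<close> exceeds \<open>l / n\<close>: over \<open>n * log n / l\<close> rounds it turns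
\<open>O(n)\<close> into \<open>o(1)\<close>. Medium components have rate \<open>2 * l\<close>, large ones \<open>2 * (K + 1)\<close>, and both are at
least \<open>l + 2\<close>.\<close>

lemma merge_potential_drift:
  fixes E :: "nat set set" and n l K :: nat and \<delta> :: real
  assumes E: "E \<in> simple_graphs n" and n: "n \<ge> 1" and l: "even l" "l \<ge> 2" and K: "K \<ge> l div 2"
    and few: "real (card (components n E)) \<le> \<delta> * real n" and \<delta>: "\<delta> > 0" "2 * (real K + 1) * \<delta> < 1"
    and \<beta>: "\<beta> = (1 - 2 * (real K + 1) * \<delta>) ^ l" "1 / 2 \<le> \<beta>"
  shows "(\<Sum>vs\<in>vertex_tuples l n. merge_potential l n (next_graph E vs (lex_choice K E vs)))
    \<le> real n ^ l * ((1 - \<beta> * (real l + 1) / real n) * merge_potential l n E)"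
    and "0 \<le> merge_potential l n E"
proof -
  define \<gamma> where "\<gamma> = 1 - 2 * (real K + 1) * \<delta>"
  define W where "W = {v \<in> {1..n}. K < card (component E v)}"
  define R where "R = {v \<in> {1..n}. 2 \<le> card (component E v) \<and> card (component E v) \<le> K}"
  define X where "X = {(a, b). a \<in> W \<and> b \<in> W \<and> component E a \<noteq> component E b}"
  define Y where "Y = card (isolated_vertices n E)"
  define y where "y = real (Y * (Y - 1))"
  have K1: "K \<ge> 1" using K l by auto
  have lK: "real l + 2 \<le> 2 * (real K + 1)"
  proof -
    have "l \<le> 2 * K" using K l by auto
    then have "real l \<le> real (2 * K)" by (rule of_nat_mono)
    then show ?thesis by simp
  qed
  obtain Bs Q where BQ: "card (nontrivial_components n E) = Bs + Q" "Q \<ge> 1" and R: "2 * Bs \<le> card R"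
    and W: "real n * \<gamma> \<le> real (card W)" and nY: "real n * \<gamma> \<le> real (n - Y)"
    and X: "2 * (real K + 1) * (real Q - 1) * (real n * \<gamma>) \<le> real (card X)"
    unfolding \<gamma>_def W_def R_def X_def Y_def
    by (rule few_components_bounds[OF E n K1 few \<delta>])
  have \<gamma>: "0 < \<gamma>" "\<gamma> \<le> 1" using \<delta> by (simp_all add: \<gamma>_def)
  define b where "b = real n ^ (l - 1)"
  have b0: "0 \<le> b" by (simp add: b_def)
  obtain k where k: "l = Suc (Suc k)" using l(2) by (metis add_2_eq_Suc le_Suc_ex)
  have nb: "real n ^ l = real n * b" unfolding b_def k by simp
  have bn: "real n ^ (l - 2) * real n = b" unfolding b_def k by simp
  have \<gamma>l: "\<beta> \<le> \<gamma> ^ (l - 1)" unfolding \<beta>(1) \<gamma>_def[symmetric] using \<gamma> by (intro power_decreasing) auto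
  have \<gamma>b: "\<beta> * b \<le> (real n * \<gamma>) ^ (l - 1)"
    using \<gamma>l b0 by (simp add: power_mult_distrib b_def mult.commute mult_right_mono)
  have \<beta>b: "0 \<le> \<beta> * b" using \<beta>(2) b0 by simp
  have n\<gamma>: "0 \<le> real n * \<gamma>" using \<gamma> by simp
  have y0: "0 \<le> y" by (simp add: y_def)
  have d1: "2 * real l * real Bs * (\<beta> * b) \<le> real l * (real (card R) * real (card W) ^ (l - 1))"
  proof -
    have "(real n * \<gamma>) ^ (l - 1) \<le> real (card W) ^ (l - 1)" using W n\<gamma> by (intro power_mono)
    then have "\<beta> * b \<le> real (card W) ^ (l - 1)" using \<gamma>b by linarith
    moreover have "2 * real Bs \<le> real (card R)" using R of_nat_mono[OF R] by simp
    ultimately have "(2 * real Bs) * (\<beta> * b) \<le> real (card R) * real (card W) ^ (l - 1)"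
      using \<beta>b by (intro mult_mono) auto
    then have "real l * ((2 * real Bs) * (\<beta> * b)) \<le> real l * (real (card R) * real (card W) ^ (l - 1))"
      by (intro mult_left_mono) auto
    then show ?thesis by (simp add: mult_ac)
  qed
  have Q0: "0 \<le> real Q - 1" using BQ by simp
  have d2: "(real l + 2) * (real Q - 1) * (\<beta> * b) \<le> real (card X) * real (card W) ^ (l - 2)"
  proof -
    have "(real l + 2) * (real Q - 1) * (\<beta> * b) \<le> 2 * (real K + 1) * (real Q - 1) * (real n * \<gamma>) ^ (l - 1)"
    proof (rule mult_mono[OF _ \<gamma>b _ \<beta>b])
      show "(real l + 2) * (real Q - 1) \<le> 2 * (real K + 1) * (real Q - 1)"
        using lK Q0 by (rule mult_right_mono)
      show "0 \<le> 2 * (real K + 1) * (real Q - 1)" using Q0 by simp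
    qed
    also have "(real n * \<gamma>) ^ (l - 1) = (real n * \<gamma>) * (real n * \<gamma>) ^ (l - 2)"
      unfolding k by simp
    also have "2 * (real K + 1) * (real Q - 1) * ((real n * \<gamma>) * (real n * \<gamma>) ^ (l - 2))
        = (2 * (real K + 1) * (real Q - 1) * (real n * \<gamma>)) * (real n * \<gamma>) ^ (l - 2)" by simp
    also have "\<dots> \<le> real (card X) * real (card W) ^ (l - 2)"
      using X W n\<gamma> by (intro mult_mono power_mono) auto
    finally show ?thesis .
  qed
  have d3: "2 * real l * y * (\<beta> * b) \<le> 2 * real l * y * real (n - Y) ^ (l - 1)"
  proof -
    have "(real n * \<gamma>) ^ (l - 1) \<le> real (n - Y) ^ (l - 1)" using nY n\<gamma> by (intro power_mono)
    then show ?thesis using \<gamma>b y0 by (intro mult_left_mono) auto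
  qed
  define S1 where "S1 = (\<Sum>vs\<in>vertex_tuples l n. real (card (nontrivial_components n (next_graph E vs (lex_choice K E vs)))))"
  define S2 where "S2 = (\<Sum>vs\<in>vertex_tuples l n. real (card (isolated_vertices n (next_graph E vs (lex_choice K E vs)))
      * (card (isolated_vertices n (next_graph E vs (lex_choice K E vs))) - 1)))"
  have S1: "S1 \<le> real n ^ l * (real Bs + real Q)
      - (2 * real l * real Bs * (\<beta> * b) + (real l + 2) * (real Q - 1) * (\<beta> * b))
      + real l * y * real n ^ (l - 2)"
    using nontrivial_components_drift[OF E l K1] d1 d2
    unfolding S1_def BQ(1) W_def[symmetric] R_def[symmetric] X_def[symmetric] Y_def[symmetric] y_def by simp
  have S2: "S2 \<le> real n ^ l * y - 2 * real l * y * (\<beta> * b)"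
    using isolated_pairs_drift[OF E l K1] d3
    unfolding S2_def Y_def[symmetric] y_def by linarith
  define p where "p = merge_potential l n E"
  define B where "B = real Bs + (real Q - 1)"
  define z where "z = y / real n"
  have z0: "0 \<le> z" using y0 by (simp add: z_def)
  have p: "p = B + 2 * real l * z"
    by (simp add: p_def merge_potential_def BQ Y_def[symmetric] y_def B_def z_def)
  then show "0 \<le> merge_potential l n E" using z0 Q0 by (simp add: p_def B_def)
  have ny: "y = real n * z" using n by (simp add: z_def)
  have yb: "y * real n ^ (l - 2) = z * b" unfolding ny bn[symmetric] by simp
  have "(\<Sum>vs\<in>vertex_tuples l n. merge_potential l n (next_graph E vs (lex_choice K E vs)))
     = S1 - real n ^ l + 2 * real l * (S2 / real n)"
    unfolding merge_potential_def S1_def S2_def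
    by (simp add: sum.distrib sum_subtractf card_vertex_tuples sum_distrib_left sum_divide_distrib)
  also have "\<dots> \<le> real n ^ l * p - (2 * real l * real Bs * (\<beta> * b) + (real l + 2) * (real Q - 1) * (\<beta> * b))
      + real l * z * b - 2 * real l * (2 * real l * z * (\<beta> * b))"
  proof -
    have "S2 / real n \<le> (real n ^ l * y - 2 * real l * y * (\<beta> * b)) / real n"
      using S2 by (intro divide_right_mono) auto
    also have "\<dots> = real n ^ l * z - 2 * real l * z * (\<beta> * b)" using n by (simp add: z_def diff_divide_distrib)
    finally have "2 * real l * (S2 / real n) \<le> 2 * real l * (real n ^ l * z - 2 * real l * z * (\<beta> * b))"
      by (intro mult_left_mono) auto
    moreover have "2 * real l * (real n ^ l * z - 2 * real l * z * (\<beta> * b))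
       = 2 * real l * (real n ^ l * z) - 2 * real l * (2 * real l * z * (\<beta> * b))"
      by (rule right_diff_distrib)
    moreover have "real l * y * real n ^ (l - 2) = real l * z * b" using yb by (simp add: mult.assoc)
    moreover have "real n ^ l * p = real n ^ l * (real Bs + real Q) - real n ^ l + 2 * real l * (real n ^ l * z)"
      by (simp add: p B_def algebra_simps)
    ultimately show ?thesis using S1 by linarith
  qed
  also have "\<dots> \<le> real n ^ l * p - (\<beta> * b) * ((real l + 1) * p)"
  proof -
    have "(real l + 1) * B * (\<beta> * b) \<le> 2 * real l * real Bs * (\<beta> * b) + (real l + 2) * (real Q - 1) * (\<beta> * b)"
    proof -
      have "(real l + 1) * B \<le> 2 * real l * real Bs + (real l + 2) * (real Q - 1)"
      proof -
        have "(real l + 1) * real Bs \<le> (2 * real l) * real Bs" using l by (intro mult_right_mono) auto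
        moreover have "(real l + 1) * (real Q - 1) \<le> (real l + 2) * (real Q - 1)"
          using Q0 by (intro mult_right_mono) auto
        ultimately show ?thesis by (simp add: B_def algebra_simps)
      qed
      from mult_right_mono[OF this \<beta>b] show ?thesis by (simp add: algebra_simps)
    qed
    moreover have "real l * z * b + (\<beta> * b) * ((real l + 1) * (2 * real l * z)) \<le> 2 * real l * (2 * real l * z * (\<beta> * b))"
    proof -
      have "1 \<le> 2 * \<beta> * (real l - 1)"
        using mult_mono[of 1 "2 * \<beta>" 1 "real l - 1"] \<beta>(2) l by simp
      then have "real l * z * b * 1 \<le> real l * z * b * (2 * \<beta> * (real l - 1))"
        using z0 b0 by (intro mult_left_mono) auto
      then show ?thesis by (simp add: algebra_simps)
    qed
    ultimately show ?thesis by (simp add: p algebra_simps)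
  qed
  also have "\<dots> = real n ^ l * ((1 - \<beta> * (real l + 1) / real n) * p)"
    using n unfolding nb by (simp add: field_simps)
  finally show "(\<Sum>vs\<in>vertex_tuples l n. merge_potential l n (next_graph E vs (lex_choice K E vs)))
    \<le> real n ^ l * ((1 - \<beta> * (real l + 1) / real n) * merge_potential l n E)" by (simp add: p_def)
qed


section \<open>Connectivity\<close>

lemma graph_connected_mono:
  assumes "graph_connected n E" "E \<subseteq> E'"
  shows "graph_connected n E'"
proof -
  have "(adj E)\<^sup>* \<subseteq> (adj E')\<^sup>*" using assms(2) by (intro rtrancl_mono) (auto simp: adj_def)
  then show ?thesis using assms(1) unfolding graph_connected_def by blast
qed

lemma graph_connected_imp_no_isolated:
  assumes E: "E \<in> simple_graphs n" and n: "n \<ge> 2" and c: "graph_connected n E"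
  shows "isolated_vertices n E = {}"
proof (rule ccontr)
  assume "isolated_vertices n E \<noteq> {}"
  then obtain v where v: "v \<in> isolated_vertices n E" by blast
  then have v1: "v \<in> {1..n}" by (simp add: isolated_vertices_def)
  have "card (component E v) = 1" using component_isolated_iff[OF E v1] v by simp
  moreover have "{1..n} \<subseteq> component E v" using c v1 by (auto simp: graph_connected_def component_def)
  then have "card {1..n} \<le> card (component E v)"
    using component_subset[OF E v1] by (intro card_mono) (auto intro: finite_subset)
  ultimately show False using n by simp
qed

lemma graph_connected_if:
  assumes E: "E \<in> simple_graphs n" and I: "isolated_vertices n E = {}"
    and B: "card (nontrivial_components n E) \<le> 1"
  shows "graph_connected n E"
proof -
  have "component E v \<in> nontrivial_components n E" if v: "v \<in> {1..n}" for v
  proof -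
    have "card (component E v) \<noteq> 1" using component_isolated_iff[OF E v] I by simp
    then show ?thesis using card_component_pos[OF E v] component_in_components[OF v]
      by (simp add: nontrivial_components_def)
  qed
  then have "component E v = component E w" if "v \<in> {1..n}" "w \<in> {1..n}" for v w
    using that B card_le_Suc0_iff_eq[OF finite_nontrivial, of n E] by simp
  then show ?thesis unfolding graph_connected_def component_eq_iff by blast
qed

text \<open>Connectivity persists when edges are added, so it is enough to look at the last round allowed.\<close>

lemma Tcon_le_iff:
  assumes t: "t \<ge> 0"
  shows "ereal_of_enat (Tcon n V C \<omega>) \<le> ereal t \<longleftrightarrow> graph_connected n (graph_after V C (nat \<lfloor>t\<rfloor>) \<omega>)"
proof -
  define S where "S = {enat N | N. graph_connected n (graph_after V C N \<omega>)}"
  have T: "Tcon n V C \<omega> = Inf S" by (simp add: Tcon_def S_def)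
  show ?thesis
  proof
    assume le: "ereal_of_enat (Tcon n V C \<omega>) \<le> ereal t"
    have "S \<noteq> {}"
    proof
      assume "S = {}"
      then have "Tcon n V C \<omega> = \<infinity>" unfolding T by (simp add: Inf_enat_def)
      then show False using le by simp
    qed
    then have "Inf S \<in> S" unfolding Inf_enat_def by (auto intro: LeastI)
    then obtain N where N: "Inf S = enat N" "graph_connected n (graph_after V C N \<omega>)" by (auto simp: S_def)
    then have "real N \<le> t" using le T by simp
    then have "N \<le> nat \<lfloor>t\<rfloor>" using t by (simp add: le_nat_floor)
    then show "graph_connected n (graph_after V C (nat \<lfloor>t\<rfloor>) \<omega>)"
      by (intro graph_connected_mono[OF N(2)] graph_after_mono)
  next
    assume "graph_connected n (graph_after V C (nat \<lfloor>t\<rfloor>) \<omega>)"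
    then have "Inf S \<le> enat (nat \<lfloor>t\<rfloor>)" by (intro Inf_lower) (auto simp: S_def)
    then have "ereal_of_enat (Inf S) \<le> ereal_of_enat (enat (nat \<lfloor>t\<rfloor>))" by (simp only: ereal_of_enat_le_iff)
    also have "\<dots> \<le> ereal t" using t by simp
    finally show "ereal_of_enat (Tcon n V C \<omega>) \<le> ereal t" by (simp add: T)
  qed
qed

context achlioptas
begin

lemma card_components_antimono:
  assumes w: "\<omega> \<in> space M" and "N \<le> N'"
  shows "card (components n (graph_after V C N' \<omega>)) \<le> card (components n (graph_after V C N \<omega>))"
  using assms(2)
proof (induction rule: dec_induct)
  case (step k)
  have "2 * C k \<omega> < l" "2 * C k \<omega> + 1 < l" using C_less[OF w, of k] l_even by auto
  then have "V k \<omega> ! (2 * C k \<omega>) \<in> {1..n}" "V k \<omega> ! (2 * C k \<omega> + 1) \<in> {1..n}"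
    using vertex_tuples_nth[OF V_tuple[OF w]] by blast+
  then have "card (components n (graph_after V C (Suc k) \<omega>)) \<le> card (components n (graph_after V C k \<omega>))"
    unfolding graph_after_Suc next_graph_def by (rule card_components_add_edge(1))
  then show ?case using step.IH by simp
qed simp

text \<open>If all candidate edges join different components, then every choice merges two of them. This has
probability at least \<open>(\<delta> / 2) ^ (l div 2)\<close> while there are more than \<open>\<delta> * n\<close> components.\<close>

lemma expectation_components_step:
  fixes \<delta> :: real
  assumes \<delta>: "\<delta> > 0" "real n * \<delta> \<ge> 2"
  shows "expectation (\<lambda>\<omega>. real (card (components n (graph_after V C (Suc N) \<omega>))))
    \<le> expectation (\<lambda>\<omega>. real (card (components n (graph_after V C N \<omega>))))
      - (\<delta> / 2) ^ (l div 2) * \<P>(\<omega> in M. real (card (components n (graph_after V C N \<omega>))) > \<delta> * real n)"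
proof -
  define X where "X E = {(a, b). a \<in> {1..n} \<and> b \<in> {1..n} \<and> component E a \<noteq> component E b}" for E
  define Cr where "Cr E = {vs \<in> vertex_tuples l n. \<forall>i<l div 2. (vs ! (2 * i), vs ! (2 * i + 1)) \<in> X E}" for E
  define q where "q = (\<delta> / 2) ^ (l div 2)"
  define c where "c E = real (card (components n E))" for E
  have fin: "finite (vertex_tuples l n)" by (rule finite_vertex_tuples)
  have avg: "(\<Sum>vs\<in>vertex_tuples l n. c E - of_bool (vs \<in> Cr E)) \<le> real n ^ l * (c E - q * of_bool (c E > \<delta> * real n))"
    if E: "E \<in> simple_graphs n" for E
  proof -
    have "(\<Sum>vs\<in>vertex_tuples l n. c E - of_bool (vs \<in> Cr E)) = real n ^ l * c E - real (card (Cr E))"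
    proof -
      have "Cr E \<subseteq> vertex_tuples l n" by (auto simp: Cr_def)
      then show ?thesis by (simp only: sum_subtractf sum_of_bool_mem[OF fin] sum_constant card_vertex_tuples of_nat_power)
    qed
    moreover have "real n ^ l * q \<le> real (card (Cr E))" if big: "c E > \<delta> * real n"
    proof -
      have "X E \<subseteq> {1..n} \<times> {1..n}" by (auto simp: X_def)
      then have cr: "card (Cr E) = card (X E) ^ (l div 2)"
        unfolding Cr_def using l_even by (subst card_vertex_tuples_pairs) auto
      have "real n * (\<delta> * real n / 2) \<le> real n * (c E - 1)"
        using big \<delta> by (intro mult_left_mono) (auto simp: mult.commute)
      also have "\<dots> \<le> real (n * (card (components n E) - 1))"
      proof -
        have "c E - 1 \<le> real (card (components n E) - 1)" by (simp add: c_def)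
        then show ?thesis unfolding of_nat_mult by (intro mult_left_mono) auto
      qed
      also have "\<dots> \<le> real (card (X E))"
        unfolding X_def using cross_pairs_ge[OF E] by (rule of_nat_mono)
      finally have "(real n * (\<delta> * real n / 2)) ^ (l div 2) \<le> real (card (X E)) ^ (l div 2)"
        using \<delta> by (intro power_mono) auto
      moreover have "real n * (\<delta> * real n / 2) = (real n)\<^sup>2 * (\<delta> / 2)" by (simp add: power2_eq_square)
      then have "(real n * (\<delta> * real n / 2)) ^ (l div 2) = ((real n)\<^sup>2) ^ (l div 2) * q"
        by (simp only: power_mult_distrib q_def)
      moreover have "((real n)\<^sup>2) ^ (l div 2) = real n ^ l" using l_even by (simp flip: power_mult)
      ultimately show ?thesis by (simp add: cr)
    qed
    ultimately show ?thesis by (cases "c E > \<delta> * real n") (simp_all add: right_diff_distrib)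
  qed
  have "expectation (\<lambda>\<omega>. c (graph_of (history V C (Suc N) \<omega>)))
     \<le> expectation (\<lambda>\<omega>. c (graph_of (history V C N \<omega>)) - q * of_bool (c (graph_of (history V C N \<omega>)) > \<delta> * real n))"
  proof (rule expectation_step_le[where G = "\<lambda>h vs. c (graph_of h) - of_bool (vs \<in> Cr (graph_of h))"])
    fix \<omega> assume w: "\<omega> \<in> space M"
    show "(\<Sum>vs\<in>vertex_tuples l n. c (graph_of (history V C N \<omega>)) - of_bool (vs \<in> Cr (graph_of (history V C N \<omega>))))
        \<le> real n ^ l * (c (graph_of (history V C N \<omega>)) - q * of_bool (c (graph_of (history V C N \<omega>)) > \<delta> * real n))"
      unfolding graph_after_eq'[symmetric] by (rule avg[OF graph_after_simple[OF w]])
    define E where "E = graph_after V C N \<omega>"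
    define v where "v = V N \<omega> ! (2 * C N \<omega>)"
    define u where "u = V N \<omega> ! (2 * C N \<omega> + 1)"
    have "2 * C N \<omega> < l" "2 * C N \<omega> + 1 < l" using C_less[OF w, of N] l_even by auto
    then have vu: "v \<in> {1..n}" "u \<in> {1..n}"
      unfolding v_def u_def using vertex_tuples_nth[OF V_tuple[OF w]] by blast+
    have "c (add_edge E v u) \<le> c E - of_bool (V N \<omega> \<in> Cr E)"
    proof (cases "V N \<omega> \<in> Cr E")
      case True
      then have "component E v \<noteq> component E u" using C_less[OF w, of N] by (auto simp: Cr_def X_def v_def u_def)
      then have "Suc (card (components n (add_edge E v u))) \<le> card (components n E)"
        by (rule card_components_add_edge(2)[OF vu])
      then show ?thesis using True by (simp add: c_def)
    qed (use card_components_add_edge(1)[OF vu, of E] in \<open>simp add: c_def\<close>)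
    then show "c (graph_of (history V C (Suc N) \<omega>))
        \<le> c (graph_of (history V C N \<omega>)) - of_bool (V N \<omega> \<in> Cr (graph_of (history V C N \<omega>)))"
      unfolding graph_after_eq'[symmetric] graph_after_Suc next_graph_def E_def v_def u_def .
  qed
  also have "\<dots> = expectation (\<lambda>\<omega>. c (graph_of (history V C N \<omega>)))
      - q * expectation (\<lambda>\<omega>. of_bool (c (graph_of (history V C N \<omega>)) > \<delta> * real n))"
    using integrable_history[where F = "\<lambda>h. c (graph_of h)"]
      integrable_history[where F = "\<lambda>h. of_bool (c (graph_of h) > \<delta> * real n)"]
    by simp
  finally show ?thesis
    unfolding graph_after_eq'[symmetric] expectation_of_bool by (simp add: c_def q_def)
qed

text \<open>The number of components never increases. If it still exceeds \<open>\<delta> * n\<close> in round \<open>N1\<close>, it did so in all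
earlier rounds, and it cannot drop by more than \<open>n\<close> in total.\<close>

lemma prob_many_components:
  fixes \<delta> :: real
  assumes \<delta>: "\<delta> > 0" "real n * \<delta> \<ge> 2"
  shows "real N1 * ((\<delta> / 2) ^ (l div 2) * \<P>(\<omega> in M. real (card (components n (graph_after V C N1 \<omega>))) > \<delta> * real n)) \<le> real n"
proof -
  define P where "P N = \<P>(\<omega> in M. real (card (components n (graph_after V C N \<omega>))) > \<delta> * real n)" for N
  define q where "q = (\<delta> / 2) ^ (l div 2)"
  have q: "0 \<le> q" using \<delta> by (simp add: q_def)
  have mono: "P N1 \<le> P N" if "N \<le> N1" for N
    unfolding P_def
  proof (rule finite_measure_mono)
    show "{\<omega> \<in> space M. real (card (components n (graph_after V C N1 \<omega>))) > \<delta> * real n}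
       \<subseteq> {\<omega> \<in> space M. real (card (components n (graph_after V C N \<omega>))) > \<delta> * real n}"
      using card_components_antimono[OF _ that] by (auto intro: less_le_trans)
  qed (rule graph_event)
  have "expectation (\<lambda>\<omega>. real (card (components n (graph_after V C N \<omega>)))) \<le> real n - real N * (q * P N1)" (is "?E N \<le> _")
    if "N \<le> N1" for N
    using that
  proof (induction N)
    case 0
    have "card (components n {}) \<le> n" unfolding components_def using card_image_le[of "{1..n}"] by fastforce
    then show ?case by (simp add: graph_after_0 prob_space)
  next
    case (Suc N)
    have "q * P N1 \<le> q * P N" using q mono[of N] Suc.prems by (intro mult_left_mono) auto
    then show ?case
      using expectation_components_step[OF \<delta>, of N] Suc unfolding P_def[symmetric] q_def[symmetric]
      by (simp add: distrib_right)
  qed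
  from this[OF order_refl] have "?E N1 \<le> real n - real N1 * (q * P N1)" .
  moreover have "0 \<le> ?E N1" by (intro Bochner_Integration.integral_nonneg) simp
  ultimately have "real N1 * (q * P N1) \<le> real n" by linarith
  then show ?thesis by (simp add: P_def q_def)
qed

text \<open>Having few components in round \<open>N1\<close> is an event of the past that persists, so multiplying by its
indicator keeps the drift estimate available in every later round.\<close>

lemma expectation_merge_potential:
  fixes \<delta> \<kappa> :: real
  assumes lex: "lex_process K l n M V C" and K: "K \<ge> l div 2"
    and \<delta>: "\<delta> > 0" "2 * (real K + 1) * \<delta> < 1"
    and \<beta>: "1 / 2 \<le> (1 - 2 * (real K + 1) * \<delta>) ^ l" "\<kappa> \<le> (1 - 2 * (real K + 1) * \<delta>) ^ l * (real l + 1)"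
  defines "few \<equiv> \<lambda>N \<omega>. real (card (components n (graph_after V C N \<omega>))) \<le> \<delta> * real n"
  shows "expectation (\<lambda>\<omega>. of_bool (few N1 \<omega>) * merge_potential l n (graph_after V C (N1 + k) \<omega>))
    \<le> exp (- \<kappa> * real k / real n) * ((2 * real l + 1) * real n)"
proof (induction k)
  case 0
  have "merge_potential l n E \<le> (2 * real l + 1) * real n" for E
  proof -
    define Y where "Y = card (isolated_vertices n E)"
    have Y: "Y \<le> n" using card_isolated_le by (simp add: Y_def)
    then have "Y * (Y - 1) \<le> n * n" by (intro mult_le_mono) auto
    then have "real (Y * (Y - 1)) \<le> real (n * n)" by (rule of_nat_mono)
    then have "real (Y * (Y - 1)) / real n \<le> real (n * n) / real n" by (intro divide_right_mono) auto
    also have "\<dots> = real n" using n_pos by simp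
    finally have "2 * real l * (real (Y * (Y - 1)) / real n) \<le> 2 * real l * real n" by (intro mult_left_mono) auto
    moreover have "card (nontrivial_components n E) \<le> n"
    proof -
      have "card (nontrivial_components n E) \<le> card (components n E)"
        by (intro card_mono) (auto simp: nontrivial_components_def)
      also have "\<dots> \<le> card {1..n}" unfolding components_def by (rule card_image_le) simp
      finally show ?thesis by simp
    qed
    ultimately show ?thesis unfolding merge_potential_def Y_def by (simp add: distrib_right)
  qed
  then have "of_bool b * merge_potential l n E \<le> (2 * real l + 1) * real n" for b E
    by (cases b) simp_all
  then have "expectation (\<lambda>\<omega>. of_bool (few N1 \<omega>) * merge_potential l n (graph_after V C (N1 + 0) \<omega>))
    \<le> expectation (\<lambda>\<omega>. (2 * real l + 1) * real n)"
    unfolding few_def add_0_right by (intro integral_mono integrable_graph integrable_const)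
  then show ?case by (simp add: prob_space)
next
  case (Suc k)
  define b where "b h = (of_bool (real (card (components n (graph_of (take N1 h)))) \<le> \<delta> * real n) :: real)" for h
  have bw: "b (history V C N \<omega>) = of_bool (few N1 \<omega>)" if "N1 \<le> N" for N \<omega>
    using graph_after_eq[OF that, of V C \<omega>] by (simp add: b_def few_def)
  define \<beta>' where "\<beta>' = (1 - 2 * (real K + 1) * \<delta>) ^ l"
  have "expectation (\<lambda>\<omega>. b (history V C (Suc (N1 + k)) \<omega>) * merge_potential l n (graph_of (history V C (Suc (N1 + k)) \<omega>)))
    \<le> expectation (\<lambda>\<omega>. exp (- \<kappa> / real n) * (b (history V C (N1 + k) \<omega>) * merge_potential l n (graph_of (history V C (N1 + k) \<omega>))))"
  proof (rule expectation_step_le[where F = "\<lambda>h. b h * merge_potential l n (graph_of h)"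
        and H = "\<lambda>h. exp (- \<kappa> / real n) * (b h * merge_potential l n (graph_of h))"
        and G = "\<lambda>h vs. b h * merge_potential l n (next_graph (graph_of h) vs (lex_choice K (graph_of h) vs))"])
    fix \<omega> assume w: "\<omega> \<in> space M"
    show "b (history V C (Suc (N1 + k)) \<omega>) * merge_potential l n (graph_of (history V C (Suc (N1 + k)) \<omega>))
      \<le> b (history V C (N1 + k) \<omega>) * merge_potential l n (next_graph (graph_of (history V C (N1 + k) \<omega>))
           (V (N1 + k) \<omega>) (lex_choice K (graph_of (history V C (N1 + k) \<omega>)) (V (N1 + k) \<omega>)))"
      unfolding graph_after_eq'[symmetric] graph_after_Suc lex_process_choice[OF lex w] by (simp add: bw)
    define E where "E = graph_after V C (N1 + k) \<omega>"
    have E: "E \<in> simple_graphs n" unfolding E_def by (rule graph_after_simple[OF w])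
    have "(\<Sum>vs\<in>vertex_tuples l n. of_bool (few N1 \<omega>) * merge_potential l n (next_graph E vs (lex_choice K E vs)))
      \<le> real n ^ l * (exp (- \<kappa> / real n) * (of_bool (few N1 \<omega>) * merge_potential l n E))"
    proof (cases "few N1 \<omega>")
      case True
      have "card (components n E) \<le> card (components n (graph_after V C N1 \<omega>))"
        unfolding E_def by (intro card_components_antimono[OF w]) simp
      then have fewE: "real (card (components n E)) \<le> \<delta> * real n" using True by (simp add: few_def)
      note drift = merge_potential_drift[OF E n_pos l_even l_ge_2 K fewE \<delta> refl \<beta>(1)]
      have "1 - \<beta>' * (real l + 1) / real n \<le> 1 - \<kappa> / real n"
        using \<beta>(2) by (simp add: \<beta>'_def divide_right_mono)
      also have "\<dots> \<le> exp (- \<kappa> / real n)" using exp_ge_add_one_self[of "- \<kappa> / real n"] by simp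
      finally have "(1 - \<beta>' * (real l + 1) / real n) * merge_potential l n E \<le> exp (- \<kappa> / real n) * merge_potential l n E"
        using drift(2) by (intro mult_right_mono)
      then have "real n ^ l * ((1 - \<beta>' * (real l + 1) / real n) * merge_potential l n E)
        \<le> real n ^ l * (exp (- \<kappa> / real n) * merge_potential l n E)" by (intro mult_left_mono) auto
      then show ?thesis using drift(1) True unfolding \<beta>'_def by simp
    qed simp
    then show "(\<Sum>vs\<in>vertex_tuples l n. b (history V C (N1 + k) \<omega>) * merge_potential l n
         (next_graph (graph_of (history V C (N1 + k) \<omega>)) vs (lex_choice K (graph_of (history V C (N1 + k) \<omega>)) vs)))
       \<le> real n ^ l * (exp (- \<kappa> / real n) * (b (history V C (N1 + k) \<omega>) * merge_potential l n (graph_of (history V C (N1 + k) \<omega>))))"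
      unfolding graph_after_eq'[symmetric] E_def[symmetric] by (simp only: bw le_add1)
  qed
  also have "\<dots> = exp (- \<kappa> / real n) * expectation (\<lambda>\<omega>. b (history V C (N1 + k) \<omega>) * merge_potential l n (graph_of (history V C (N1 + k) \<omega>)))"
    by simp
  also have "\<dots> \<le> exp (- \<kappa> / real n) * (exp (- \<kappa> * real k / real n) * ((2 * real l + 1) * real n))"
    using Suc.IH by (intro mult_left_mono) (simp_all add: bw graph_after_eq')
  also have "\<dots> = exp (- \<kappa> * real (Suc k) / real n) * ((2 * real l + 1) * real n)"
  proof -
    have "- \<kappa> * real (Suc k) / real n = - \<kappa> / real n + - \<kappa> * real k / real n"
      by (simp add: distrib_left diff_divide_distrib)
    then show ?thesis by (simp only: exp_add mult.assoc)
  qed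
  finally show ?case by (simp add: bw graph_after_eq')
qed

lemma prob_disconnected_without_isolated:
  fixes \<delta> \<kappa> :: real
  assumes lex: "lex_process K l n M V C" and K: "K \<ge> l div 2"
    and \<delta>: "\<delta> > 0" "2 * (real K + 1) * \<delta> < 1"
    and \<beta>: "1 / 2 \<le> (1 - 2 * (real K + 1) * \<delta>) ^ l" "\<kappa> \<le> (1 - 2 * (real K + 1) * \<delta>) ^ l * (real l + 1)"
    and N: "N1 \<le> N"
  shows "\<P>(\<omega> in M. Y1 n V C N \<omega> = 0 \<and> \<not> graph_connected n (graph_after V C N \<omega>))
    \<le> \<P>(\<omega> in M. real (card (components n (graph_after V C N1 \<omega>))) > \<delta> * real n)
      + exp (- \<kappa> * real (N - N1) / real n) * ((2 * real l + 1) * real n)"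
proof -
  define few where "few \<omega> \<longleftrightarrow> real (card (components n (graph_after V C N1 \<omega>))) \<le> \<delta> * real n" for \<omega>
  define bad where "bad \<omega> \<longleftrightarrow> Y1 n V C N \<omega> = 0 \<and> \<not> graph_connected n (graph_after V C N \<omega>)" for \<omega>
  have int: "integrable M (\<lambda>\<omega>. of_bool (\<not> few \<omega>) :: real)" "integrable M (\<lambda>\<omega>. of_bool (bad \<omega>) :: real)"
    unfolding few_def bad_def Y1_def by (rule integrable_graph)+
  have int2: "integrable M (\<lambda>\<omega>. of_bool (few \<omega>) * merge_potential l n (graph_after V C N \<omega>))"
  proof -
    have "integrable M (\<lambda>\<omega>. (\<lambda>h. of_bool (real (card (components n (graph_of (take N1 h)))) \<le> \<delta> * real n)
        * merge_potential l n (graph_of h)) (history V C N \<omega>))" by (rule integrable_history)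
    then show ?thesis
      by (simp add: few_def graph_after_eq[OF N, of V C] graph_after_eq'[of V C N])
  qed
  have "expectation (\<lambda>\<omega>. of_bool (bad \<omega>))
     \<le> expectation (\<lambda>\<omega>. of_bool (\<not> few \<omega>) + of_bool (few \<omega>) * merge_potential l n (graph_after V C N \<omega>))"
  proof (intro integral_mono int Bochner_Integration.integrable_add int2)
    fix \<omega> assume w: "\<omega> \<in> space M"
    define E where "E = graph_after V C N \<omega>"
    have E: "E \<in> simple_graphs n" unfolding E_def by (rule graph_after_simple[OF w])
    show "of_bool (bad \<omega>) \<le> of_bool (\<not> few \<omega>) + of_bool (few \<omega>) * merge_potential l n (graph_after V C N \<omega>)"
    proof (cases "few \<omega>")
      case True
      have "card (components n E) \<le> card (components n (graph_after V C N1 \<omega>))"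
        unfolding E_def by (intro card_components_antimono[OF w N])
      then have fewE: "real (card (components n E)) \<le> \<delta> * real n" using True by (simp add: few_def)
      have nonneg: "0 \<le> merge_potential l n E"
        by (rule merge_potential_drift(2)[OF E n_pos l_even l_ge_2 K fewE \<delta> refl \<beta>(1)])
      have "1 \<le> merge_potential l n E" if "bad \<omega>"
      proof -
        have "isolated_vertices n E = {}" "\<not> graph_connected n E"
          using that by (simp_all add: bad_def Y1_def E_def)
        then have "\<not> card (nontrivial_components n E) \<le> 1" "isolated_vertices n E = {}"
          using graph_connected_if[OF E] by auto
        then show ?thesis by (simp add: merge_potential_def)
      qed
      then show ?thesis using True nonneg by (simp add: E_def)
    qed simp
  qed
  also have "\<dots> = expectation (\<lambda>\<omega>. of_bool (\<not> few \<omega>)) + expectation (\<lambda>\<omega>. of_bool (few \<omega>) * merge_potential l n (graph_after V C N \<omega>))"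
    by (intro Bochner_Integration.integral_add int int2)
  also have "expectation (\<lambda>\<omega>. of_bool (few \<omega>) * merge_potential l n (graph_after V C N \<omega>))
     \<le> exp (- \<kappa> * real (N - N1) / real n) * ((2 * real l + 1) * real n)"
    using expectation_merge_potential[OF lex K \<delta> \<beta>, of N1 "N - N1"] N by (simp add: few_def)
  finally show ?thesis unfolding expectation_of_bool by (simp add: bad_def few_def not_le)
qed

end

text \<open>The first \<open>n * sqrt (ln n)\<close> rounds are enough for the number of components to become small, yet
negligible compared with the \<open>n * log n / l\<close> rounds in which \<open>merge_potential\<close> decays.\<close>

lemma disconnected_without_isolated_tendsto:
  fixes M :: "nat \<Rightarrow> 'a measure"
  assumes l: "l \<ge> 2" "even l" and A: "\<And>n. n \<ge> 1 \<Longrightarrow> achlioptas (M n) l n (V n) (C n)"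
    and lex: "\<And>n. n \<ge> 1 \<Longrightarrow> lex_process K l n (M n) (V n) (C n)" and K: "K \<ge> l div 2"
  shows "(\<lambda>n. \<P>(\<omega> in M n. Y1 n (V n) (C n) (rounds l c n) \<omega> = 0
      \<and> \<not> graph_connected n (graph_after (V n) (C n) (rounds l c n) \<omega>))) \<longlonglongrightarrow> 0"
proof -
  have l1: "l \<ge> 1" using l by simp
  define L where "L = real l"
  have L: "L \<ge> 2" using l by (simp add: L_def)
  \<comment> \<open>by the Bernoulli inequality the loss factor is then at least \<open>1 - 1 / (2 * (L + 1))\<close>, which leaves the rate \<open>\<kappa> = L + 1 / 2 > L\<close>\<close>
  define \<delta> where "\<delta> = 1 / (4 * (real K + 1) * L * (L + 1))"
  define \<kappa> where "\<kappa> = L + 1 / 2"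
  have \<delta>0: "\<delta> > 0" using L by (simp add: \<delta>_def)
  have K\<delta>: "2 * (real K + 1) * \<delta> = 1 / (2 * L * (L + 1))"
    using L by (simp add: \<delta>_def divide_simps) (simp add: algebra_simps)
  have "1 * 1 < 2 * L * (L + 1)" using L by (intro mult_strict_mono) auto
  then have \<delta>1: "2 * (real K + 1) * \<delta> < 1" unfolding K\<delta> using L by (simp add: divide_simps)
  have "1 + real l * (- (2 * (real K + 1) * \<delta>)) \<le> (1 + - (2 * (real K + 1) * \<delta>)) ^ l"
    using \<delta>1 by (intro Bernoulli_inequality) simp
  also have "real l * (- (2 * (real K + 1) * \<delta>)) = - (1 / (2 * (L + 1)))"
    unfolding K\<delta> L_def[symmetric] using L by (simp add: divide_simps)
  finally have \<gamma>: "1 - 1 / (2 * (L + 1)) \<le> (1 - 2 * (real K + 1) * \<delta>) ^ l" by simp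
  have "1 / (2 * (L + 1)) \<le> 1 / 2" using L by (simp add: divide_simps)
  then have \<beta>1: "1 / 2 \<le> (1 - 2 * (real K + 1) * \<delta>) ^ l" using \<gamma> by simp
  have "(1 - 1 / (2 * (L + 1))) * (L + 1) \<le> (1 - 2 * (real K + 1) * \<delta>) ^ l * (L + 1)"
    using \<gamma> L by (intro mult_right_mono) auto
  moreover have "(1 - 1 / (2 * (L + 1))) * (L + 1) = \<kappa>" using L by (simp add: \<kappa>_def field_simps)
  ultimately have \<beta>2: "\<kappa> \<le> (1 - 2 * (real K + 1) * \<delta>) ^ l * (real l + 1)"
    unfolding L_def[symmetric] by linarith
  define q where "q = (\<delta> / 2) ^ (l div 2)"
  have q: "q > 0" using \<delta>0 by (simp add: q_def)
  define N1 where "N1 n = nat \<lfloor>real n * sqrt (ln (real n))\<rfloor>" for n :: nat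
  define d where "d = 1 / L"
  have d: "d > 0" using L by (simp add: d_def)
  define bnd where "bnd n = 1 / (q * (sqrt (ln (real n)) - 1))
    + (2 * L + 1) * (real n * exp (- (1 + d / 2) * (ln (real n) + c) + \<kappa> * (1 + sqrt (ln (real n)))))" for n :: nat
  have "(\<lambda>n. 1 / (q * (sqrt (ln (real n)) - 1))) \<longlonglongrightarrow> 0"
    using q by real_asymp
  moreover have "(\<lambda>n. real n * exp (- (1 + d / 2) * (ln (real n) + c) + \<kappa> * (1 + sqrt (ln (real n))))) \<longlonglongrightarrow> 0"
  proof -
    define g where "g n = (d / 2) * ln (real n) - \<kappa> * (1 + sqrt (ln (real n))) + (1 + d / 2) * c" for n
    have "filterlim g at_top sequentially" unfolding g_def using d by real_asymp
    then have "filterlim (\<lambda>n. - g n) at_bot sequentially" by (simp add: filterlim_uminus_at_bot)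
    then have "(\<lambda>n. exp (- g n)) \<longlonglongrightarrow> 0" by (rule filterlim_compose[OF exp_at_bot])
    moreover have "\<forall>\<^sub>F n in sequentially. exp (- g n)
       = real n * exp (- (1 + d / 2) * (ln (real n) + c) + \<kappa> * (1 + sqrt (ln (real n))))"
      using eventually_ge_at_top[of "1::nat"]
    proof eventually_elim
      case (elim n)
      have "real n * exp (- (1 + d / 2) * (ln (real n) + c) + \<kappa> * (1 + sqrt (ln (real n))))
        = exp (ln (real n) + (- (1 + d / 2) * (ln (real n) + c) + \<kappa> * (1 + sqrt (ln (real n)))))"
        using elim by (simp add: exp_add[of "ln (real n)"])
      also have "ln (real n) + (- (1 + d / 2) * (ln (real n) + c) + \<kappa> * (1 + sqrt (ln (real n))))
        = - g n" by (simp add: g_def algebra_simps)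
      finally show ?case ..
    qed
    ultimately show ?thesis by (rule Lim_transform_eventually)
  qed
  ultimately have "bnd \<longlonglongrightarrow> 0 + (2 * L + 1) * 0" unfolding bnd_def by (intro tendsto_intros)
  then have bnd: "bnd \<longlonglongrightarrow> 0" by simp
  have e1: "\<forall>\<^sub>F n::nat in sequentially. sqrt (ln (real n)) > 1" by real_asymp
  have e2: "\<forall>\<^sub>F n::nat in sequentially. d * (ln (real n) + c) - sqrt (ln (real n)) \<ge> 1" using d by real_asymp
  have e3: "\<forall>\<^sub>F n::nat in sequentially. real n * \<delta> \<ge> 2" using \<delta>0 by real_asymp
  have ev: "\<forall>\<^sub>F n in sequentially. norm (\<P>(\<omega> in M n. Y1 n (V n) (C n) (rounds l c n) \<omega> = 0
      \<and> \<not> graph_connected n (graph_after (V n) (C n) (rounds l c n) \<omega>))) \<le> bnd n"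
    using e1 e2 e3 eventually_time_bound_nonneg[OF l1, of c]
  proof eventually_elim
    case (elim n)
    then have n: "n \<ge> 1" and tb: "time_bound l c n \<ge> 0" by auto
    interpret achlioptas "M n" l n "V n" "C n" using A[OF n] .
    define N where "N = rounds l c n"
    define s where "s = sqrt (ln (real n))"
    have s: "s > 1" using elim by (simp add: s_def)
    have tbe: "time_bound l c n = real n * (d * (ln (real n) + c))"
      by (simp add: time_bound_def d_def L_def algebra_simps add_divide_distrib)
    have "s \<ge> 0" using s by simp
    then have N1: "real (N1 n) \<le> real n * s" "real n * s - 1 \<le> real (N1 n)"
      by (simp_all add: N1_def s_def)
    have Nlo: "time_bound l c n - 1 \<le> real N" using rounds_bounds(2)[OF tb] by (simp add: N_def)
    have "real n * 1 \<le> real n * (d * (ln (real n) + c) - s)"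
      using elim by (intro mult_left_mono) (auto simp: s_def)
    then have "real n * s + 1 \<le> time_bound l c n" using n by (simp add: tbe right_diff_distrib)
    then have N1N: "N1 n \<le> N" using N1 Nlo by linarith
    have "\<P>(\<omega> in M n. real (card (components n (graph_after (V n) (C n) (N1 n) \<omega>))) > \<delta> * real n)
       \<le> 1 / (q * (s - 1))" (is "?P \<le> _")
    proof -
      have "real (N1 n) * (q * ?P) \<le> real n"
        using prob_many_components[OF \<delta>0, of "N1 n"] elim by (simp add: q_def)
      moreover have "real n * (s - 1) \<le> real (N1 n)" using N1 n by (simp add: right_diff_distrib)
      then have "(real n * (s - 1)) * (q * ?P) \<le> real (N1 n) * (q * ?P)"
        using q by (intro mult_right_mono) auto
      ultimately have "real n * ((s - 1) * (q * ?P)) \<le> real n * 1" by (simp add: mult.assoc)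
      then have "(s - 1) * (q * ?P) \<le> 1" using n by simp
      then show ?thesis using q s by (simp add: pos_le_divide_eq mult_ac)
    qed
    moreover have "exp (- \<kappa> * real (N - N1 n) / real n) * ((2 * real l + 1) * real n)
      \<le> (2 * L + 1) * (real n * exp (- (1 + d / 2) * (ln (real n) + c) + \<kappa> * (1 + s)))"
    proof -
      have "real n * (d * (ln (real n) + c)) - real n * (1 + s) \<le> real (N - N1 n)"
        using Nlo N1 N1N n by (simp add: tbe of_nat_diff distrib_left)
      then have "real n * (d * (ln (real n) + c) - (1 + s)) \<le> real (N - N1 n)"
        by (simp add: right_diff_distrib)
      then have "d * (ln (real n) + c) - (1 + s) \<le> real (N - N1 n) / real n"
        using n by (simp add: pos_le_divide_eq mult.commute)
      then have "\<kappa> * (d * (ln (real n) + c) - (1 + s)) \<le> \<kappa> * (real (N - N1 n) / real n)"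
        using L by (intro mult_left_mono) (auto simp: \<kappa>_def)
      moreover have "\<kappa> * d = 1 + d / 2" using L by (simp add: \<kappa>_def d_def field_simps)
      then have "\<kappa> * (d * (ln (real n) + c) - (1 + s)) = (1 + d / 2) * (ln (real n) + c) - \<kappa> * (1 + s)"
        by (simp add: right_diff_distrib flip: mult.assoc)
      moreover have "- \<kappa> * real (N - N1 n) / real n = - (\<kappa> * (real (N - N1 n) / real n))"
        "- (1 + d / 2) * (ln (real n) + c) = - ((1 + d / 2) * (ln (real n) + c))"
        by (simp_all only: mult_minus_left times_divide_eq_right minus_divide_left)
      ultimately have "- \<kappa> * real (N - N1 n) / real n \<le> - (1 + d / 2) * (ln (real n) + c) + \<kappa> * (1 + s)" by linarith
      then have "exp (- \<kappa> * real (N - N1 n) / real n) * ((2 * real l + 1) * real n)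
         \<le> exp (- (1 + d / 2) * (ln (real n) + c) + \<kappa> * (1 + s)) * ((2 * real l + 1) * real n)"
        by (intro mult_right_mono) auto
      then show ?thesis by (simp add: L_def mult_ac)
    qed
    moreover have "\<P>(\<omega> in M n. Y1 n (V n) (C n) N \<omega> = 0 \<and> \<not> graph_connected n (graph_after (V n) (C n) N \<omega>))
      \<le> ?P + exp (- \<kappa> * real (N - N1 n) / real n) * ((2 * real l + 1) * real n)"
      by (rule prob_disconnected_without_isolated[OF lex[OF n] K \<delta>0 \<delta>1 \<beta>1 \<beta>2 N1N])
    ultimately show ?case by (simp add: bnd_def N_def s_def)
  qed
  show ?thesis by (rule Lim_null_comparison[OF ev bnd])
qed

section \<open>The limit law of the connectivity time\<close>

lemma prob_Tcon_eq:
  "time_bound l c n \<ge> 0 \<Longrightarrow> \<P>(\<omega> in M. ereal_of_enat (Tcon n V C \<omega>) \<le> ereal (time_bound l c n))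
    = \<P>(\<omega> in M. graph_connected n (graph_after V C (rounds l c n) \<omega>))"
  by (simp add: Tcon_le_iff rounds_def)

lemma (in achlioptas) prob_no_isolated_split:
  assumes "n \<ge> 2"
  shows "\<P>(\<omega> in M. Y1 n V C N \<omega> = 0) = \<P>(\<omega> in M. graph_connected n (graph_after V C N \<omega>))
    + \<P>(\<omega> in M. Y1 n V C N \<omega> = 0 \<and> \<not> graph_connected n (graph_after V C N \<omega>))"
proof -
  let ?c = "\<lambda>\<omega>. graph_connected n (graph_after V C N \<omega>)"
  have "{\<omega> \<in> space M. Y1 n V C N \<omega> = 0} = {\<omega> \<in> space M. ?c \<omega>} \<union> {\<omega> \<in> space M. Y1 n V C N \<omega> = 0 \<and> \<not> ?c \<omega>}"
    using graph_connected_imp_no_isolated[OF graph_after_simple assms] by (auto simp: Y1_def)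
  moreover have "prob ({\<omega> \<in> space M. ?c \<omega>} \<union> {\<omega> \<in> space M. Y1 n V C N \<omega> = 0 \<and> \<not> ?c \<omega>})
     = prob {\<omega> \<in> space M. ?c \<omega>} + prob {\<omega> \<in> space M. Y1 n V C N \<omega> = 0 \<and> \<not> ?c \<omega>}"
    unfolding Y1_def by (intro finite_measure_Union graph_event) auto
  ultimately show ?thesis by simp
qed

theorem mainTheorem3:
  fixes l K :: nat
    and M :: "nat \<Rightarrow> 'a measure"
    and V :: "nat \<Rightarrow> nat \<Rightarrow> 'a \<Rightarrow> nat list"
    and C :: "nat \<Rightarrow> nat \<Rightarrow> 'a \<Rightarrow> nat"
  assumes "l \<ge> 2" and "even l" and "K \<ge> l div 2"
    and lex: "\<And>n. n \<ge> 1 \<Longrightarrow> lex_process K l n (M n) (V n) (C n)"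
  shows "(c1_fun l \<longlongrightarrow> c1 l) (at_right 0) \<and>
    (\<forall>c::real.
       (\<lambda>n. \<P>(\<omega> in M n. ereal_of_enat (Tcon n (V n) (C n) \<omega>) \<le> ereal (time_bound l c n)))
         \<longlonglongrightarrow> exp (- d1 l * exp (- c)) \<and>
       (\<lambda>n. \<P>(\<omega> in M n. Y1 n (V n) (C n) (nat \<lfloor>time_bound l c n\<rfloor>) \<omega> = 0))
         \<longlonglongrightarrow> exp (- d1 l * exp (- c))) \<and>
    (\<forall>(M' :: nat \<Rightarrow> 'b measure) V' C'.
       (\<forall>n\<ge>1. achlioptas_process l n (M' n) (V' n) (C' n)) \<longrightarrow>
       (\<forall>c::real.
          limsup (\<lambda>n. ereal (\<P>(\<omega> in M' n.
              ereal_of_enat (Tcon n (V' n) (C' n) \<omega>) \<le> ereal (time_bound l c n))))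
            \<le> limsup (\<lambda>n. ereal (\<P>(\<omega> in M' n.
              Y1 n (V' n) (C' n) (nat \<lfloor>time_bound l c n\<rfloor>) \<omega> = 0))) \<and>
          limsup (\<lambda>n. ereal (\<P>(\<omega> in M' n.
              Y1 n (V' n) (C' n) (nat \<lfloor>time_bound l c n\<rfloor>) \<omega> = 0)))
            \<le> ereal (lim (\<lambda>n. \<P>(\<omega> in M n.
              Y1 n (V n) (C n) (nat \<lfloor>time_bound l c n\<rfloor>) \<omega> = 0)))))"
proof -
  note l = assms(1,2)
  have l1: "l \<ge> 1" and K1: "K \<ge> 1" using assms(1-3) by auto
  have A: "achlioptas (M n) l n (V n) (C n)" if "n \<ge> 1" for n
    using lex[OF that] that l by (intro achlioptas_intro) (simp_all add: lex_process_def)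
  have Y: "(\<lambda>n. \<P>(\<omega> in M n. Y1 n (V n) (C n) (nat \<lfloor>time_bound l c n\<rfloor>) \<omega> = 0))
      \<longlonglongrightarrow> exp (- d1 l * exp (- c))" for c
    using isolated_lex_tendsto[OF l A lex K1, of c] by (simp add: rounds_def)
  have T: "(\<lambda>n. \<P>(\<omega> in M n. ereal_of_enat (Tcon n (V n) (C n) \<omega>) \<le> ereal (time_bound l c n)))
      \<longlonglongrightarrow> exp (- d1 l * exp (- c))" for c
  proof (rule Lim_transform_eventually)
    show "(\<lambda>n. \<P>(\<omega> in M n. Y1 n (V n) (C n) (nat \<lfloor>time_bound l c n\<rfloor>) \<omega> = 0)
        - \<P>(\<omega> in M n. Y1 n (V n) (C n) (rounds l c n) \<omega> = 0
            \<and> \<not> graph_connected n (graph_after (V n) (C n) (rounds l c n) \<omega>)))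
        \<longlonglongrightarrow> exp (- d1 l * exp (- c))"
      using tendsto_diff[OF Y[of c] disconnected_without_isolated_tendsto[OF l A lex assms(3), of c]] by simp
    show "\<forall>\<^sub>F n in sequentially. \<P>(\<omega> in M n. Y1 n (V n) (C n) (nat \<lfloor>time_bound l c n\<rfloor>) \<omega> = 0)
        - \<P>(\<omega> in M n. Y1 n (V n) (C n) (rounds l c n) \<omega> = 0
            \<and> \<not> graph_connected n (graph_after (V n) (C n) (rounds l c n) \<omega>))
        = \<P>(\<omega> in M n. ereal_of_enat (Tcon n (V n) (C n) \<omega>) \<le> ereal (time_bound l c n))"
      using eventually_time_bound_nonneg[OF l1, of c] eventually_ge_at_top[of 2]
    proof eventually_elim
      case (elim n)
      then have n: "n \<ge> 1" "n \<ge> 2" and tb: "time_bound l c n \<ge> 0" by auto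
      show ?case
        using achlioptas.prob_no_isolated_split[OF A[OF n(1)] n(2), of "rounds l c n"]
        unfolding prob_Tcon_eq[OF tb] by (simp add: rounds_def)
    qed
  qed
  have "limsup (\<lambda>n. ereal (\<P>(\<omega> in M' n. ereal_of_enat (Tcon n (V' n) (C' n) \<omega>) \<le> ereal (time_bound l c n))))
      \<le> limsup (\<lambda>n. ereal (\<P>(\<omega> in M' n. Y1 n (V' n) (C' n) (nat \<lfloor>time_bound l c n\<rfloor>) \<omega> = 0)))"
    and "limsup (\<lambda>n. ereal (\<P>(\<omega> in M' n. Y1 n (V' n) (C' n) (nat \<lfloor>time_bound l c n\<rfloor>) \<omega> = 0)))
      \<le> ereal (lim (\<lambda>n. \<P>(\<omega> in M n. Y1 n (V n) (C n) (nat \<lfloor>time_bound l c n\<rfloor>) \<omega> = 0)))"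
    if "\<forall>n\<ge>1. achlioptas_process l n (M' n) (V' n) (C' n)"
    for M' :: "nat \<Rightarrow> 'b measure" and V' C' c
  proof -
    have A': "achlioptas (M' n) l n (V' n) (C' n)" if n: "n \<ge> 1" for n
      using \<open>\<forall>n\<ge>1. achlioptas_process l n (M' n) (V' n) (C' n)\<close> n l by (intro achlioptas_intro) auto
    show "limsup (\<lambda>n. ereal (\<P>(\<omega> in M' n. ereal_of_enat (Tcon n (V' n) (C' n) \<omega>) \<le> ereal (time_bound l c n))))
      \<le> limsup (\<lambda>n. ereal (\<P>(\<omega> in M' n. Y1 n (V' n) (C' n) (nat \<lfloor>time_bound l c n\<rfloor>) \<omega> = 0)))"
    proof (rule Limsup_mono)
      show "\<forall>\<^sub>F n in sequentially. ereal (\<P>(\<omega> in M' n. ereal_of_enat (Tcon n (V' n) (C' n) \<omega>) \<le> ereal (time_bound l c n)))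
        \<le> ereal (\<P>(\<omega> in M' n. Y1 n (V' n) (C' n) (nat \<lfloor>time_bound l c n\<rfloor>) \<omega> = 0))"
        using eventually_time_bound_nonneg[OF l1, of c] eventually_ge_at_top[of 2]
      proof eventually_elim
        case (elim n)
        then have n: "n \<ge> 1" "n \<ge> 2" and tb: "time_bound l c n \<ge> 0" by auto
        show ?case
          using achlioptas.prob_no_isolated_split[OF A'[OF n(1)] n(2), of "rounds l c n"]
          unfolding prob_Tcon_eq[OF tb] by (simp add: rounds_def)
      qed
    qed
    have "lim (\<lambda>n. \<P>(\<omega> in M n. Y1 n (V n) (C n) (nat \<lfloor>time_bound l c n\<rfloor>) \<omega> = 0)) = exp (- d1 l * exp (- c))"
      using Y by (rule limI)
    then show "limsup (\<lambda>n. ereal (\<P>(\<omega> in M' n. Y1 n (V' n) (C' n) (nat \<lfloor>time_bound l c n\<rfloor>) \<omega> = 0)))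
      \<le> ereal (lim (\<lambda>n. \<P>(\<omega> in M n. Y1 n (V n) (C n) (nat \<lfloor>time_bound l c n\<rfloor>) \<omega> = 0)))"
      using isolated_limsup[OF l A', of c] by (simp add: rounds_def)
  qed
  then show ?thesis
    using c1_fun_tendsto[OF l1] T Y by (simp add: c1_eq[OF l1])
qed

end
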